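(* Let $\mathcal{G}=\mathrm{Diff}(S^2,dV)$ be the group of area-preserving diffeomorphisms of the two-sphere. For every real $p>2$ and every integer $d\ge1$ there is a bi-Lipschitz embedding of groups $\mathbb{R}^d\to\mathcal{G}$, where $\mathbb{R}^d$ is endowed with the metric of the $l^1$-norm and $\mathcal{G}$ with the $L^p$-metric $d_p$; that is, there exist an injective group homomorphism $I:\mathbb{R}^d\to\mathcal{G}$ and a constant $K\ge1$ such that for all $v,w\in\mathbb{R}^d$ \[\tfrac1K\|v-w\|_{1}\le d_p(I(v),I(w))\le K\|v-w\|_{1},\qquad \|v\|_1=\sum_{i=1}^d|v_i|.\]
   Context: $S^2=\mathbb{C}P^1$ carries the standard Fubini-Study Riemannian metric and the Fubini-Study area form $dV$ scaled to have total area $2\pi$. For a (smooth) path $\{\phi_t\}_{t\in[0,1]}$ in $\mathcal{G}$ generated by the time-dependent vector field $X_t=\frac{d}{dt'}\big|_{t'=t}\phi_{t'}\circ\phi_t^{-1}$, put $l_p(\{\phi_t\})=\int_0^1\bigl(\int_{S^2}|X_t|^p\,dV\bigr)^{1/p}dt$. The $L^p$-metric is $d_p(\phi_0,\phi_1)=\inf l_p(\{\phi_t\})$, the infimum running over all paths in $\mathcal{G}$ from $\phi_0$ to $\phi_1$; it is right-invariant. *)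

theory Defs
  imports "HOL-Analysis.Analysis" "HOL-Algebra.Bij" "HOL-Real_Asymp.Real_Asymp"
begin

section \<open>Smooth maps\<close>

text \<open>\<open>Ck_on\<close> is meant for open sets only.\<close>

primrec Ck_on ::
  "nat \<Rightarrow> 'a::euclidean_space set \<Rightarrow> ('a \<Rightarrow> 'b::euclidean_space) \<Rightarrow> bool" where
  "Ck_on 0 U f \<longleftrightarrow> continuous_on U f"
| "Ck_on (Suc k) U f \<longleftrightarrow> (\<forall>x\<in>U. f differentiable (at x)) \<and>
     (\<forall>v. Ck_on k U (\<lambda>x. frechet_derivative f (at x) v))"

text \<open>On an arbitrary subset of a Euclidean space (a submanifold, possibly with boundary),
  smooth means locally extendable to a \<open>C\<^sup>\<infinity>\<close> map on an open set.\<close>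

definition smooth_on :: "'a::euclidean_space set \<Rightarrow> ('a \<Rightarrow> 'b::euclidean_space) \<Rightarrow> bool" where
  "smooth_on S f \<longleftrightarrow>
     (\<forall>x\<in>S. \<exists>U F. open U \<and> x \<in> U \<and> (\<forall>k. Ck_on k U F) \<and> (\<forall>y\<in>U \<inter> S. F y = f y))"


section \<open>The sphere with its Fubini-Study metric and area form\<close>

text \<open>The complex projective line with the Fubini-Study metric, given by
  \<open>|dz|\<^sup>2 / (1 + |z|\<^sup>2)\<^sup>2\<close> in the chart \<open>[1 : z]\<close>, is isometric to the round sphere of radius
  \<open>1/2\<close>; see \<open>norm_chart_deriv\<close> below for the isometry. The metric is thus the one induced by
  the inner product of the ambient space.\<close>

definition S2 :: "(real^3) set" where
  "S2 = sphere 0 (1/2)"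

definition tangent :: "real^3 \<Rightarrow> (real^3) set" where
  "tangent x = {u. x \<bullet> u = 0}"

text \<open>The outward unit normal at \<open>x\<close> is \<open>2 x\<close>, and the induced area form \<open>2 x \<bullet> (u \<times> v)\<close> has
  total area \<open>\<pi>\<close>; the further factor \<open>2\<close> makes the total area \<open>2 \<pi>\<close>.\<close>

definition area_form :: "real^3 \<Rightarrow> real^3 \<Rightarrow> real^3 \<Rightarrow> real" where
  "area_form x u v = 4 * (x \<bullet> cross3 u v)"

text \<open>The inverse of the affine chart \<open>[1 : x + i y] \<mapsto> (x, y)\<close>, which misses one point.\<close>

definition chart :: "real \<times> real \<Rightarrow> real^3" where
  "chart = (\<lambda>(x, y). (1 / (1 + x\<^sup>2 + y\<^sup>2)) *\<^sub>R vector [x, y, (1 - x\<^sup>2 - y\<^sup>2) / 2])"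

text \<open>The measure on the sphere defined by the area form: its density in the chart is the
  coefficient of the pulled back form (\<open>area_form_chart_deriv\<close>), and the point missed by the
  chart is a null set.\<close>

definition area_measure :: "(real^3) measure" where
  "area_measure =
     distr (density lborel (\<lambda>z. ennreal (2 / (1 + (norm z)\<^sup>2)\<^sup>2))) borel chart"

definition chart_deriv :: "real \<times> real \<Rightarrow> real \<times> real \<Rightarrow> real^3" where
  "chart_deriv = (\<lambda>(x, y) (a, b). let w = 1 + x\<^sup>2 + y\<^sup>2; s = x * a + y * b in
     vector [a / w - 2 * x * s / w\<^sup>2, b / w - 2 * y * s / w\<^sup>2, - (2 * s / w\<^sup>2)])"

lemma chart_denominator_pos: "1 + x\<^sup>2 + y\<^sup>2 > (0::real)"
  by (smt (verit) zero_le_power2)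

lemma norm_real3: "norm (v::real^3) = sqrt ((v$1)\<^sup>2 + (v$2)\<^sup>2 + (v$3)\<^sup>2)"
  by (simp add: norm_vec_def L2_set_def sum_3)

lemma chart_nth:
  "chart (x, y) $ 1 = x / (1 + x\<^sup>2 + y\<^sup>2)"
  "chart (x, y) $ 2 = y / (1 + x\<^sup>2 + y\<^sup>2)"
  "chart (x, y) $ 3 = 1 / (1 + x\<^sup>2 + y\<^sup>2) - 1 / 2"
  using chart_denominator_pos[of x y] by (simp_all add: chart_def field_simps)

lemma chart_bij: "bij_betw chart UNIV (S2 - {vector [0, 0, - (1/2)]})"
proof -
  have S2_iff: "v \<in> S2 \<longleftrightarrow> (v$1)\<^sup>2 + (v$2)\<^sup>2 + (v$3)\<^sup>2 = 1/4" for v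
  proof -
    have "v \<in> S2 \<longleftrightarrow> sqrt ((v$1)\<^sup>2 + (v$2)\<^sup>2 + (v$3)\<^sup>2) = sqrt (1/4)"
      by (simp add: S2_def norm_real3 real_sqrt_divide)
    then show ?thesis by simp
  qed
  show ?thesis
  proof (rule bij_betw_byWitness[where f' = "\<lambda>v. (v$1 / (v$3 + 1/2), v$2 / (v$3 + 1/2))"])
    show "\<forall>z\<in>UNIV. (chart z $ 1 / (chart z $ 3 + 1/2), chart z $ 2 / (chart z $ 3 + 1/2)) = z"
      using chart_denominator_pos by (auto simp: chart_nth less_imp_neq[symmetric])
    show "\<forall>v\<in>S2 - {vector [0, 0, - (1/2)]}. chart (v$1 / (v$3 + 1/2), v$2 / (v$3 + 1/2)) = v"
    proof
      fix v :: "real^3" assume v: "v \<in> S2 - {vector [0, 0, - (1/2)]}"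
      define q where "q = v$3 + 1/2"
      have e: "(v$1)\<^sup>2 + (v$2)\<^sup>2 = q * (1 - q)"
        using v by (auto simp: S2_iff q_def power2_eq_square algebra_simps)
      have q: "q \<noteq> 0"
      proof
        assume "q = 0"
        with e have "v$1 = 0" "v$2 = 0" by (simp_all add: sum_power2_eq_zero_iff)
        with \<open>q = 0\<close> have "v = vector [0, 0, - (1/2)]"
          by (simp add: vec_eq_iff forall_3 q_def)
        with v show False by simp
      qed
      have w: "1 + (v$1 / q)\<^sup>2 + (v$2 / q)\<^sup>2 = 1 / q"
      proof -
        have "1 + (v$1 / q)\<^sup>2 + (v$2 / q)\<^sup>2 = 1 + ((v$1)\<^sup>2 + (v$2)\<^sup>2) / q\<^sup>2"
          by (simp add: power_divide add_divide_distrib)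
        also have "\<dots> = 1 / q"
          unfolding e using q by (simp add: field_simps power2_eq_square)
        finally show ?thesis .
      qed
      have "chart (v$1 / q, v$2 / q) = v"
        using q by (simp add: vec_eq_iff forall_3 chart_nth w) (simp add: q_def)
      then show "chart (v$1 / (v$3 + 1/2), v$2 / (v$3 + 1/2)) = v"
        by (simp add: q_def)
    qed
    show "chart ` UNIV \<subseteq> S2 - {vector [0, 0, - (1/2)]}"
    proof safe
      fix x y :: real
      define w where "w = 1 + x\<^sup>2 + y\<^sup>2"
      have w: "w > 0" using chart_denominator_pos by (simp add: w_def)
      have "(x / w)\<^sup>2 + (y / w)\<^sup>2 + (1 / w - 1 / 2)\<^sup>2 = (w - 1) / w\<^sup>2 + (1 / w - 1 / 2)\<^sup>2"
        by (simp add: w_def power_divide add_divide_distrib)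
      also have "\<dots> = 1 / 4"
        using w by (simp add: field_simps power2_eq_square)
      finally show "chart (x, y) \<in> S2"
        by (simp add: S2_iff chart_nth w_def)
      assume "chart (x, y) = vector [0, 0, - (1/2)]"
      then have "chart (x, y) $ 3 = - (1/2)" by simp
      then show False using w by (simp add: chart_nth w_def)
    qed
  qed simp
qed

lemma chart_has_derivative: "(chart has_derivative chart_deriv z) (at z)"
proof -
  define W :: "real \<times> real \<Rightarrow> real" where "W = (\<lambda>z. 1 + (fst z)\<^sup>2 + (snd z)\<^sup>2)"
  have w: "W z \<noteq> 0"
    using chart_denominator_pos[of "fst z" "snd z"] by (simp add: W_def)
  have W': "(W has_derivative (\<lambda>h. 2 * (fst z * fst h + snd z * snd h))) (at z)"
    unfolding W_def by (rule derivative_eq_intros refl)+ (auto simp: fun_eq_iff)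
  have d: "chart_deriv z h $ 1 = fst h / W z - 2 * fst z * (fst z * fst h + snd z * snd h) / (W z)\<^sup>2"
    "chart_deriv z h $ 2 = snd h / W z - 2 * snd z * (fst z * fst h + snd z * snd h) / (W z)\<^sup>2"
    "chart_deriv z h $ 3 = - (2 * (fst z * fst h + snd z * snd h) / (W z)\<^sup>2)" for h
    by (simp_all add: chart_deriv_def Let_def split_beta W_def)
  have c: "(\<lambda>z. chart z $ 1) = (\<lambda>z. fst z / W z)" "(\<lambda>z. chart z $ 2) = (\<lambda>z. snd z / W z)"
    "(\<lambda>z. chart z $ 3) = (\<lambda>z. 1 / W z - 1 / 2)"
    by (auto simp: chart_nth fun_eq_iff W_def)
  have "((\<lambda>z. chart z $ 1) has_derivative (\<lambda>h. chart_deriv z h $ 1)) (at z)"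
    unfolding c d by (rule derivative_eq_intros refl W' w)+
      (use w in \<open>auto simp: fun_eq_iff field_simps power2_eq_square\<close>)
  moreover have "((\<lambda>z. chart z $ 2) has_derivative (\<lambda>h. chart_deriv z h $ 2)) (at z)"
    unfolding c d by (rule derivative_eq_intros refl W' w)+
      (use w in \<open>auto simp: fun_eq_iff field_simps power2_eq_square\<close>)
  moreover have "((\<lambda>z. chart z $ 3) has_derivative (\<lambda>h. chart_deriv z h $ 3)) (at z)"
    unfolding c d by (rule derivative_eq_intros refl W' w)+
      (use w in \<open>auto simp: fun_eq_iff field_simps power2_eq_square\<close>)
  ultimately have "((\<lambda>z. chart z $ i) has_derivative (\<lambda>h. chart_deriv z h $ i)) (at z)" for i
    using exhaust_3[of i] by auto
  then show ?thesis
    unfolding has_derivative_componentwise_within[of chart]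
    by (auto simp: Basis_vec_def inner_axis)
qed

lemma norm_chart_deriv: "norm (chart_deriv z h) = norm h / (1 + (norm z)\<^sup>2)"
proof -
  obtain x y where z: "z = (x, y)" by force
  obtain a b where h: "h = (a, b)" by force
  define w where "w = 1 + x\<^sup>2 + y\<^sup>2"
  define s where "s = x * a + y * b"
  have w: "w > 0" using chart_denominator_pos by (simp add: w_def)
  have "norm (chart_deriv z h)
      = sqrt ((a / w - 2 * x * s / w\<^sup>2)\<^sup>2 + (b / w - 2 * y * s / w\<^sup>2)\<^sup>2 + (2 * s / w\<^sup>2)\<^sup>2)"
    by (simp add: norm_real3 z h chart_deriv_def Let_def w_def s_def)
  also have "(a / w - 2 * x * s / w\<^sup>2)\<^sup>2 + (b / w - 2 * y * s / w\<^sup>2)\<^sup>2 + (2 * s / w\<^sup>2)\<^sup>2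
      = (a\<^sup>2 + b\<^sup>2) / w\<^sup>2 - 4 * (x * a + y * b) * s / w ^ 3 + 4 * s\<^sup>2 * (1 + x\<^sup>2 + y\<^sup>2) / w ^ 4"
    using w by (simp add: field_simps power2_eq_square power3_eq_cube power4_eq_xxxx)
  also have "\<dots> = (a\<^sup>2 + b\<^sup>2) / w\<^sup>2"
    unfolding s_def[symmetric] w_def[symmetric] using w
    by (simp add: field_simps power2_eq_square power3_eq_cube power4_eq_xxxx)
  also have "sqrt \<dots> = norm h / w"
    using w by (simp add: h norm_Pair real_sqrt_divide)
  also have "w = 1 + (norm z)\<^sup>2"
    by (simp add: w_def z norm_Pair)
  finally show ?thesis .
qed

lemma area_form_chart_deriv:
  "area_form (chart z) (chart_deriv z (1, 0)) (chart_deriv z (0, 1)) = 2 / (1 + (norm z)\<^sup>2)\<^sup>2"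
proof -
  obtain x y where z: "z = (x, y)" by force
  define i where "i = 1 / (1 + x\<^sup>2 + y\<^sup>2)"
  have i: "i * (1 + x * x + y * y) = 1"
    using chart_denominator_pos[of x y] by (simp add: i_def power2_eq_square)
  have c: "chart z $ 1 = x * i" "chart z $ 2 = y * i" "chart z $ 3 = i - 1 / 2"
    by (simp_all add: z chart_nth i_def)
  have d: "chart_deriv z (1, 0) = vector [i - 2 * x * x * i * i, - 2 * y * x * i * i, - 2 * x * i * i]"
    "chart_deriv z (0, 1) = vector [- 2 * x * y * i * i, i - 2 * y * y * i * i, - 2 * y * i * i]"
    by (simp_all add: z chart_deriv_def Let_def i_def power2_eq_square mult.assoc)
  have "area_form (chart z) (chart_deriv z (1, 0)) (chart_deriv z (0, 1)) = 2 * (i * i)"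
    unfolding area_form_def d cross3_def inner_vec_def sum_3 c vector_3 inner_real_def
    using i by algebra
  then show ?thesis by (simp add: z norm_Pair i_def add.assoc power2_eq_square)
qed

lemma emeasure_area_measure: "emeasure area_measure S2 = ennreal (2 * pi)"
proof -
  have chart_S2: "chart z \<in> S2" for z
    using bij_betw_apply[OF chart_bij] by auto
  have S2_borel: "S2 \<in> sets borel"
    by (simp add: S2_def borel_closed)
  have chart_meas: "chart \<in> borel_measurable borel"
    by (intro borel_measurable_continuous_onI continuous_at_imp_continuous_on ballI
        has_derivative_continuous[OF chart_has_derivative])
  have inner: "(\<integral>\<^sup>+y. ennreal (2 / (1 + x\<^sup>2 + y\<^sup>2)\<^sup>2) \<partial>lborel) = ennreal (pi / (sqrt (1 + x\<^sup>2)) ^ 3)"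
    for x :: real
  proof -
    define a where "a = sqrt (1 + x\<^sup>2)"
    have a: "a > 0" and a2: "a\<^sup>2 = 1 + x\<^sup>2"
      by (simp_all add: a_def add_pos_nonneg)
    define F where "F = (\<lambda>y. y / (a\<^sup>2 * (a\<^sup>2 + y\<^sup>2)) + arctan (y / a) / a ^ 3)"
    have pos: "a\<^sup>2 + y\<^sup>2 > 0" for y using a by (simp add: add_pos_nonneg)
    have deriv: "DERIV F y :> 2 / (a\<^sup>2 + y\<^sup>2)\<^sup>2" for y
    proof -
      have "((\<lambda>y. a\<^sup>2 * (a\<^sup>2 + y\<^sup>2)) has_real_derivative a\<^sup>2 * (2 * y)) (at y)"
        by (auto intro!: derivative_eq_intros)
      then have "((\<lambda>y. y / (a\<^sup>2 * (a\<^sup>2 + y\<^sup>2))) has_real_derivative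
          (1 * (a\<^sup>2 * (a\<^sup>2 + y\<^sup>2)) - y * (a\<^sup>2 * (2 * y))) / (a\<^sup>2 * (a\<^sup>2 + y\<^sup>2) * (a\<^sup>2 * (a\<^sup>2 + y\<^sup>2)))) (at y)"
        using a pos[of y] by (intro DERIV_divide DERIV_ident) auto
      moreover have "((\<lambda>y. arctan (y / a) / a ^ 3) has_real_derivative
          1 / (1 + (y / a)\<^sup>2) / a / a ^ 3) (at y)"
        using a by (auto intro!: derivative_eq_intros simp: divide_inverse)
      ultimately have "DERIV F y :> (1 * (a\<^sup>2 * (a\<^sup>2 + y\<^sup>2)) - y * (a\<^sup>2 * (2 * y)))
          / (a\<^sup>2 * (a\<^sup>2 + y\<^sup>2) * (a\<^sup>2 * (a\<^sup>2 + y\<^sup>2))) + 1 / (1 + (y / a)\<^sup>2) / a / a ^ 3"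
        unfolding F_def by (rule DERIV_add)
      also have "1 + (y / a)\<^sup>2 = (a\<^sup>2 + y\<^sup>2) / a\<^sup>2"
        using a by (simp add: field_simps)
      also have "(1 * (a\<^sup>2 * (a\<^sup>2 + y\<^sup>2)) - y * (a\<^sup>2 * (2 * y)))
          / (a\<^sup>2 * (a\<^sup>2 + y\<^sup>2) * (a\<^sup>2 * (a\<^sup>2 + y\<^sup>2))) + 1 / ((a\<^sup>2 + y\<^sup>2) / a\<^sup>2) / a / a ^ 3 = 2 / (a\<^sup>2 + y\<^sup>2)\<^sup>2"
      proof -
        define q where "q = a\<^sup>2 + y\<^sup>2"
        have q: "q > 0" and yy: "y * y = q - a * a"
          using pos[of y] by (simp_all add: q_def power2_eq_square)
        have num: "y * (a\<^sup>2 * (2 * y)) = 2 * a\<^sup>2 * (q - a\<^sup>2)"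
          using yy unfolding power2_eq_square by algebra
        show ?thesis unfolding num q_def[symmetric] using a q
          by (simp add: field_simps power2_eq_square power3_eq_cube)
      qed
      finally show ?thesis .
    qed
    have lim: "(F \<longlongrightarrow> pi * inverse (a ^ 3) / 2) at_top" "(F \<longlongrightarrow> - pi * inverse (a ^ 3) / 2) at_bot"
      unfolding F_def using a by real_asymp+
    have meas: "(\<lambda>y. 2 / (a\<^sup>2 + y\<^sup>2)\<^sup>2) \<in> borel_measurable borel" by measurable
    have cont: "isCont (\<lambda>y. 2 / (a\<^sup>2 + y\<^sup>2)\<^sup>2) y" for y
      using pos[of y] by (auto intro!: continuous_intros)
    have *: "((F \<circ> real_of_ereal) \<longlongrightarrow> - pi * inverse (a ^ 3) / 2) (at_right (- \<infinity>))"
      "((F \<circ> real_of_ereal) \<longlongrightarrow> pi * inverse (a ^ 3) / 2) (at_left \<infinity>)"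
      using lim by (simp_all add: ereal_tendsto_simps)
    have int: "set_integrable lborel (einterval (- \<infinity>) \<infinity>) (\<lambda>y. 2 / (a\<^sup>2 + y\<^sup>2)\<^sup>2)"
      and eq: "(LBINT y=-\<infinity>..\<infinity>. 2 / (a\<^sup>2 + y\<^sup>2)\<^sup>2) = pi * inverse (a ^ 3) / 2 - (- pi * inverse (a ^ 3) / 2)"
      by (rule interval_integral_FTC_nonneg[where F = F, OF _ _ _ _ *]; simp add: deriv cont)+
    have "(\<integral>\<^sup>+y. ennreal (2 / (a\<^sup>2 + y\<^sup>2)\<^sup>2) \<partial>lborel) = ennreal (\<integral>y. 2 / (a\<^sup>2 + y\<^sup>2)\<^sup>2 \<partial>lborel)"
      using int by (intro nn_integral_eq_integral) (auto simp: set_integrable_def einterval_def)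
    also have "(\<integral>y. 2 / (a\<^sup>2 + y\<^sup>2)\<^sup>2 \<partial>lborel) = pi / a ^ 3"
      using eq by (simp add: interval_lebesgue_integral_def set_lebesgue_integral_def
        einterval_def) (simp only: divide_inverse)
    finally show ?thesis by (simp only: a2) (simp add: a_def)
  qed
  have outer: "(\<integral>\<^sup>+x. ennreal (pi / (sqrt (1 + x\<^sup>2)) ^ 3) \<partial>lborel) = ennreal (2 * pi)"
  proof -
    define F where "F = (\<lambda>x::real. pi * x / sqrt (1 + x\<^sup>2))"
    have pos: "1 + x\<^sup>2 > 0" for x :: real by (simp add: add_pos_nonneg)
    have deriv: "DERIV F x :> pi / (sqrt (1 + x\<^sup>2)) ^ 3" for x
    proof -
      define s where "s = sqrt (1 + x\<^sup>2)"
      have s: "s > 0" and s2: "x\<^sup>2 = s\<^sup>2 - 1" using pos[of x] by (simp_all add: s_def)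
      have "DERIV F x :> (pi * s - pi * x * (x / s)) / s\<^sup>2"
        unfolding F_def s_def using pos[of x]
        by (auto intro!: derivative_eq_intros simp: field_simps power2_eq_square)
      also have "(pi * s - pi * x * (x / s)) / s\<^sup>2 = pi * (s\<^sup>2 - x\<^sup>2) / s ^ 3"
        using s by (simp add: field_simps power2_eq_square power3_eq_cube)
      finally show ?thesis by (simp add: s2) (simp add: s_def)
    qed
    have lim: "(F \<longlongrightarrow> pi) at_top" "(F \<longlongrightarrow> - pi) at_bot"
      unfolding F_def by real_asymp+
    have cont: "isCont (\<lambda>x. pi / (sqrt (1 + x\<^sup>2)) ^ 3) x" for x :: real
      using pos[of x] by (auto intro!: continuous_intros)
    have *: "((F \<circ> real_of_ereal) \<longlongrightarrow> - pi) (at_right (- \<infinity>))"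
      "((F \<circ> real_of_ereal) \<longlongrightarrow> pi) (at_left \<infinity>)"
      using lim by (simp_all add: ereal_tendsto_simps)
    have int: "set_integrable lborel (einterval (- \<infinity>) \<infinity>) (\<lambda>x. pi / (sqrt (1 + x\<^sup>2)) ^ 3)"
      and eq: "(LBINT x=-\<infinity>..\<infinity>. pi / (sqrt (1 + x\<^sup>2)) ^ 3) = pi - (- pi)"
      by (rule interval_integral_FTC_nonneg[where F = F, OF _ _ _ _ *]; simp add: deriv cont)+
    have "(\<integral>\<^sup>+x. ennreal (pi / (sqrt (1 + x\<^sup>2)) ^ 3) \<partial>lborel)
        = ennreal (\<integral>x. pi / (sqrt (1 + x\<^sup>2)) ^ 3 \<partial>lborel)"
      using int by (intro nn_integral_eq_integral) (auto simp: set_integrable_def einterval_def)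
    then show ?thesis
      using eq by (simp add: interval_lebesgue_integral_def set_lebesgue_integral_def einterval_def)
  qed
  have dens_meas: "(\<lambda>z. ennreal (2 / (1 + (norm z)\<^sup>2)\<^sup>2)) \<in>
      borel_measurable (lborel \<Otimes>\<^sub>M (lborel :: real measure) :: (real \<times> real) measure)"
    unfolding lborel_prod by simp
  have "emeasure area_measure S2 = (\<integral>\<^sup>+z. ennreal (2 / (1 + (norm z)\<^sup>2)\<^sup>2) \<partial>(lborel :: (real \<times> real) measure))"
    using chart_meas S2_borel chart_S2
    by (simp add: area_measure_def emeasure_distr emeasure_density vimage_def)
  also have "\<dots> = (\<integral>\<^sup>+x. \<integral>\<^sup>+y. ennreal (2 / (1 + (norm (x :: real, y :: real))\<^sup>2)\<^sup>2) \<partial>lborel \<partial>lborel)"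
    using lborel.nn_integral_fst[OF dens_meas] by (simp add: lborel_prod)
  also have "\<dots> = ennreal (2 * pi)"
    by (simp add: norm_Pair add.assoc[symmetric] inner outer)
  finally show ?thesis .
qed


section \<open>Area-preserving diffeomorphisms and the \<open>L\<^sup>p\<close>-metric\<close>

text \<open>The derivative of \<open>f\<close> within the sphere is determined only on tangent vectors, and it is
  used only there. Since it is the area form that is preserved, orientation is preserved too.\<close>

definition preserves_area :: "(real^3 \<Rightarrow> real^3) \<Rightarrow> bool" where
  "preserves_area f \<longleftrightarrow> (\<forall>x\<in>S2. \<exists>D. (f has_derivative D) (at x within S2) \<and>
     (\<forall>u\<in>tangent x. \<forall>v\<in>tangent x. area_form (f x) (D u) (D v) = area_form x u v))"

definition Diff_area :: "(real^3 \<Rightarrow> real^3) monoid" where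
  "Diff_area = (BijGroup S2)\<lparr>carrier :=
     {f \<in> Bij S2. smooth_on S2 f \<and> smooth_on S2 (inv_into S2 f) \<and> preserves_area f}\<rparr>"

definition smooth_paths ::
  "(real^3 \<Rightarrow> real^3) \<Rightarrow> (real^3 \<Rightarrow> real^3) \<Rightarrow> (real \<Rightarrow> real^3 \<Rightarrow> real^3) set" where
  "smooth_paths f g = {\<phi>. (\<forall>t\<in>{0..1}. \<phi> t \<in> carrier Diff_area) \<and>
     smooth_on ({0..1} \<times> S2) (\<lambda>(t, x). \<phi> t x) \<and> \<phi> 0 = f \<and> \<phi> 1 = g}"

definition generating_field :: "(real \<Rightarrow> real^3 \<Rightarrow> real^3) \<Rightarrow> real \<Rightarrow> real^3 \<Rightarrow> real^3" where
  "generating_field \<phi> t x =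
     vector_derivative (\<lambda>s. \<phi> s (inv_into S2 (\<phi> t) x)) (at t within {0..1})"

definition Lp_length :: "real \<Rightarrow> (real \<Rightarrow> real^3 \<Rightarrow> real^3) \<Rightarrow> real" where
  "Lp_length p \<phi> = (LINT t:{0..1}|lborel.
     (LINT x:S2|area_measure. norm (generating_field \<phi> t x) powr p) powr (1 / p))"

text \<open>Extended real values: two diffeomorphisms joined by no path are at distance \<open>\<infinity>\<close>.\<close>

definition Lp_dist :: "real \<Rightarrow> (real^3 \<Rightarrow> real^3) \<Rightarrow> (real^3 \<Rightarrow> real^3) \<Rightarrow> ereal" where
  "Lp_dist p f g = (INF \<phi>\<in>smooth_paths f g. ereal (Lp_length p \<phi>))"


section \<open>The vector group\<close>

definition vector_group :: "(real^'d) monoid" where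
  "vector_group = \<lparr>carrier = UNIV, mult = (+), one = 0\<rparr>"

definition l1_norm :: "real^'d \<Rightarrow> real" where
  "l1_norm v = (\<Sum>i\<in>UNIV. \<bar>v $ i\<bar>)"

end

theory Submission
  imports Defs
begin

text \<open>For four points with \<open>x1 \<noteq> x2 \<noteq> x3 \<noteq> x4 \<noteq> x1\<close> moving on the sphere along an isotopy \<open>\<phi>\<close>,
  the argument of their cross-ratio changes by
  \<open>\<theta>(x1, x2) - \<theta>(x2, x3) + \<theta>(x3, x4) - \<theta>(x4, x1)\<close> up to sign, where \<open>\<theta>\<close> is the time integral of a
  two-point form bounded by \<open>(|X(x)| + |X(y)|) / |x - y|\<close>. For two isotopies with the same end
  points this change differs by a multiple of \<open>2 \<pi>\<close>, continuous in \<open>x3\<close> and zero for \<open>x3 = x1\<close>;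
  so it depends on the end points of the isotopy only, and nothing about the fundamental group of
  the diffeomorphism group is needed. Since the isotopy preserves area and \<open>1 / |x - y|\<close> is
  uniformly integrable in \<open>y\<close>, the integral of \<open>|\<theta>|\<close> over all pairs of points is at most a
  constant times the \<open>L\<^sup>p\<close>-length.

  The embedding sends \<open>u\<close> to the twist that rotates the sphere about the vertical axis by the angle
  \<open>\<Sum> u\<^sub>i a\<^sub>i(height)\<close>, where the bump functions \<open>a\<^sub>i\<close> have disjoint supports. For points ordered by
  height, the straight path of twists changes the argument of the cross-ratio by the rotation angle
  of \<open>x2\<close> minus that of \<open>x3\<close>, plus the difference of the values of one bounded function at the
  two ends of the path. Averaged over bands, which twists preserve, this difference vanishes: if
  \<open>x2\<close> ranges over the support of \<open>a\<^sub>i\<close> and the other points over bands without rotation,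
  the average is \<open>u\<^sub>i\<close> times a positive constant, which bounds the \<open>L\<^sup>p\<close>-length from below.\<close>

section \<open>The argument of the cross-ratio\<close>

text \<open>Two points do not suffice: \<open>theta\<close> of a pair depends on the path. By
  \<open>gap_angle_derivative\<close>, a full turn about the vertical axis gives 2 pi (h + k) for a
  pair at heights h > k, while the constant path gives 0. Only the alternating sum around a
  four-cycle is the change of an argument. Let unit vectors e_i in C^2 span the lines of the points
  and let P_i be the projections onto them. The trace of P1 (1 - P2) P3 (1 - P4) is a product of
  determinants det(e_i, e_j) of neighbours and conjugates of such, with the phase of the
  cross-ratio. The complements at x2 and x4 place its zeros at coincident neighbours, which no
  isotopy produces; four plain projections would place them at antipodal neighbours. Opposite points
  may coincide, and for x3 = x1 the trace is positive, which anchors the argument without a choice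
  of branch. A pointwise estimate would leave an additive constant, since the boundary terms are
  merely bounded, and would give no more than a quasi-isometry. This is why averages over bands
  invariant under all twists are taken.\<close>

type_synonym mat2 = "complex \<times> complex \<times> complex \<times> complex"

definition mul2 :: "mat2 \<Rightarrow> mat2 \<Rightarrow> mat2" where
  "mul2 = (\<lambda>(a, b, c, d) (e, f, g, h). (a * e + b * g, a * f + b * h, c * e + d * g, c * f + d * h))"

definition tr2 :: "mat2 \<Rightarrow> complex" where
  "tr2 = (\<lambda>(a, b, c, d). a + d)"

definition tr4 :: "mat2 \<Rightarrow> mat2 \<Rightarrow> mat2 \<Rightarrow> mat2 \<Rightarrow> complex" where
  "tr4 A B C D = tr2 (mul2 (mul2 A B) (mul2 C D))"

text \<open>For \<open>y\<close> on the sphere of radius \<open>1/2\<close>, \<open>spin (1/2) y\<close> is the orthogonal projection onto the line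
  in \<open>\<complex>\<^sup>2\<close> represented by \<open>y\<close>, and \<open>spin (1/2) (- y)\<close> the one onto its orthogonal complement. The map
  \<open>spin 0\<close> is the derivative.\<close>

definition spin :: "real \<Rightarrow> real^3 \<Rightarrow> mat2" where
  "spin s y = (Complex (s + y$3) 0, Complex (y$1) (- y$2), Complex (y$1) (y$2), Complex (s - y$3) 0)"

lemma tr4_cyclic: "tr4 A B C D = tr4 B C D A"
  by (cases A, cases B, cases C, cases D) (simp add: tr4_def tr2_def mul2_def algebra_simps)

lemma tr4_cyclic': "tr4 A B C D = tr4 C D A B" "tr4 A B C D = tr4 D A B C"
  by (rule tr4_cyclic[THEN trans], rule tr4_cyclic) (rule tr4_cyclic[symmetric])

definition rank1 :: "mat2 \<Rightarrow> bool" where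
  "rank1 A \<longleftrightarrow> (\<exists>u1 u2 v1 v2. A = (u1 * v1, u1 * v2, u2 * v1, u2 * v2))"

text \<open>Between rank one matrices the trace factors, \<open>tr4 A B C D = \<alpha>(A) \<gamma>(C)\<close>.\<close>

lemma tr4_exchange:
  assumes "rank1 B" "rank1 D"
  shows "tr4 A B C D * tr4 A' B C' D = tr4 A' B C D * tr4 A B C' D"
proof -
  obtain u1 u2 v1 v2 where B: "B = (u1 * v1, u1 * v2, u2 * v1, u2 * v2)"
    using assms(1) unfolding rank1_def by blast
  obtain w1 w2 z1 z2 where D: "D = (w1 * z1, w1 * z2, w2 * z1, w2 * z2)"
    using assms(2) unfolding rank1_def by blast
  \<comment> \<open>With \<open>B = u v^T\<close> and \<open>D = w z^T\<close> the trace is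
    \<open>(z^T A u) (v^T C w)\<close>.\<close>
  have *: "tr4 (a, b, c, d) B (e, f, g, h) D =
      (z1 * (a * u1 + b * u2) + z2 * (c * u1 + d * u2)) *
      (v1 * (e * w1 + f * w2) + v2 * (g * w1 + h * w2))" for a b c d e f g h
    by (simp add: B D tr4_def tr2_def mul2_def algebra_simps)
  show ?thesis
    by (cases A, cases A', cases C, cases C') (simp add: *)
qed

lemma S2_iff: "v \<in> S2 \<longleftrightarrow> (v$1)\<^sup>2 + (v$2)\<^sup>2 + (v$3)\<^sup>2 = 1/4"
proof -
  have "v \<in> S2 \<longleftrightarrow> sqrt ((v$1)\<^sup>2 + (v$2)\<^sup>2 + (v$3)\<^sup>2) = sqrt (1/4)"
    by (simp add: S2_def norm_real3 real_sqrt_divide)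
  then show ?thesis by simp
qed

text \<open>The determinant of \<open>spin (1/2) y\<close> is \<open>1/4 - |y|^2\<close>, which
  vanishes on the sphere. The corner entry \<open>1/2 + y$3\<close> is the pivot of the
  factorization, except at the south pole, where the first row and column vanish.\<close>

lemma rank1_spin:
  assumes "y \<in> S2"
  shows "rank1 (spin (1/2) y)"
proof (cases "1/2 + y$3 = 0")
  case True
  with assms have "(y$1)\<^sup>2 + (y$2)\<^sup>2 = 0"
    unfolding S2_iff by algebra
  then have "y$1 = 0" "y$2 = 0" by (simp_all add: sum_power2_eq_zero_iff)
  with True have "spin (1/2) y = (0 * 0, 0 * 1, 1 * 0, Complex (1/2 - y$3) 0 * 1)"
    by (auto simp: spin_def complex_eq_iff)
  then show ?thesis unfolding rank1_def
    by (metis mult_zero_left mult_zero_right mult.commute)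
next
  case False
  define p where "p = 1/2 + y$3"
  have e: "(y$1)\<^sup>2 + (y$2)\<^sup>2 = p * (1/2 - y$3)"
    using assms by (auto simp: S2_iff p_def power2_eq_square algebra_simps)
  have p: "p \<noteq> 0" and y3: "y$3 = p - 1/2" using False by (simp_all add: p_def)
  have "spin (1/2) y = (Complex p 0 * 1, Complex p 0 * Complex (y$1 / p) (- y$2 / p),
      Complex (y$1) (y$2) * 1, Complex (y$1) (y$2) * Complex (y$1 / p) (- y$2 / p))"
    using p e by (simp add: spin_def complex_eq_iff y3 field_simps power2_eq_square)
  then show ?thesis unfolding rank1_def by blast
qed

lemma norm_sq_real3: "(norm (v::real^3))\<^sup>2 = (v$1)\<^sup>2 + (v$2)\<^sup>2 + (v$3)\<^sup>2"
  by (simp add: norm_real3)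

lemma inner_real3: "(u::real^3) \<bullet> v = u$1 * v$1 + u$2 * v$2 + u$3 * v$3"
  by (simp add: inner_vec_def sum_3)

lemma cross3_nth:
  "cross3 u v $ 1 = u$2 * v$3 - u$3 * v$2"
  "cross3 u v $ 2 = u$3 * v$1 - u$1 * v$3"
  "cross3 u v $ 3 = u$1 * v$2 - u$2 * v$1"
  by (simp_all add: cross3_def)

text \<open>For projections of rank one, \<open>P1 P2 P1 = tr (P1 P2) P1\<close>, so the trace
  splits into \<open>tr (P1 P2) tr (P1 P4)\<close>; and \<open>tr (P1 P2) = 1/2 + 2 y1 . y2\<close>
  is the squared distance from \<open>y1\<close> to \<open>- y2\<close>.\<close>

lemma tr4_spin_same:
  assumes "y1 \<in> S2" "y2 \<in> S2" "y4 \<in> S2"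
  shows "tr4 (spin (1/2) y1) (spin (1/2) y2) (spin (1/2) y1) (spin (1/2) y4) =
    of_real ((norm (y1 + y2))\<^sup>2 * (norm (y1 + y4))\<^sup>2)"
proof -
  obtain a b c where y1: "y1$1 = a" "y1$2 = b" "y1$3 = c" by blast
  obtain d e f where y2: "y2$1 = d" "y2$2 = e" "y2$3 = f" by blast
  obtain g h k where y4: "y4$1 = g" "y4$2 = h" "y4$3 = k" by blast
  have "a\<^sup>2 + b\<^sup>2 + c\<^sup>2 = 1/4" "d\<^sup>2 + e\<^sup>2 + f\<^sup>2 = 1/4" "g\<^sup>2 + h\<^sup>2 + k\<^sup>2 = 1/4"
    using assms by (simp_all add: S2_iff y1 y2 y4)
  note rel = this
  have "Re (tr4 (spin (1/2) y1) (spin (1/2) y2) (spin (1/2) y1) (spin (1/2) y4)) =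
      (norm (y1 + y2))\<^sup>2 * (norm (y1 + y4))\<^sup>2"
    unfolding norm_sq_real3 using rel
    apply (simp add: tr4_def tr2_def mul2_def spin_def y1 y2 y4)
    by algebra
  moreover have "Im (tr4 (spin (1/2) y1) (spin (1/2) y2) (spin (1/2) y1) (spin (1/2) y4)) = 0"
    by (simp add: tr4_def tr2_def mul2_def spin_def field_simps)
  ultimately show ?thesis by (simp add: complex_eq_iff)
qed

text \<open>The numerator of the logarithmic derivative at \<open>y3 = y1\<close>, where
  \<open>tr4_spin_same\<close> makes the denominator real. A polynomial identity modulo the
  equations of the sphere and of the tangent plane.\<close>

lemma Im_tr4_spin:
  assumes "y1 \<in> S2" "y2 \<in> S2" "y4 \<in> S2" "y1 \<bullet> Y = 0"
  shows "Im (tr4 (spin 0 Y) (spin (1/2) y2) (spin (1/2) y1) (spin (1/2) y4)) =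
    2 * (y2 \<bullet> cross3 y1 Y * (norm (y1 + y4))\<^sup>2 - y4 \<bullet> cross3 y1 Y * (norm (y1 + y2))\<^sup>2)"
proof -
  obtain a b c where y1: "y1$1 = a" "y1$2 = b" "y1$3 = c" by blast
  obtain d e f where y2: "y2$1 = d" "y2$2 = e" "y2$3 = f" by blast
  obtain g h k where y4: "y4$1 = g" "y4$2 = h" "y4$3 = k" by blast
  obtain l m n where Y: "Y$1 = l" "Y$2 = m" "Y$3 = n" by blast
  have "a\<^sup>2 + b\<^sup>2 + c\<^sup>2 = 1/4" "d\<^sup>2 + e\<^sup>2 + f\<^sup>2 = 1/4" "g\<^sup>2 + h\<^sup>2 + k\<^sup>2 = 1/4"
     "a * l + b * m + c * n = 0"
    using assms by (simp_all add: S2_iff y1 y2 y4 Y inner_real3)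
  then show ?thesis
    unfolding norm_sq_real3 inner_real3 cross3_nth
    apply (simp add: tr4_def tr2_def mul2_def spin_def y1 y2 y4 Y)
    by algebra
qed

section \<open>Logarithmic derivative of the cross-ratio of moving points\<close>

lemma bounded_bilinear_mul2: "bounded_bilinear mul2"
  unfolding bilinear_conv_bounded_bilinear[symmetric] bilinear_def
  by (intro conjI allI linearI)
    (simp_all add: mul2_def split_beta prod_eq_iff distrib_left distrib_right scaleR_add_right)

lemma bounded_linear_tr2: "bounded_linear tr2"
  unfolding linear_conv_bounded_linear[symmetric]
  by (intro linearI) (simp_all add: tr2_def split_beta scaleR_add_right)

lemma bounded_linear_spin: "bounded_linear (spin 0)"
  unfolding linear_conv_bounded_linear[symmetric]
  by (intro linearI) (simp_all add: spin_def complex_eq_iff)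

lemma spin_has_vector_derivative:
  assumes "(x has_vector_derivative X) F"
  shows "((\<lambda>t. spin s (x t)) has_vector_derivative spin 0 X) F"
proof -
  have eq: "(\<lambda>t. spin s (x t)) = (\<lambda>t. spin s 0 + spin 0 (x t))"
    by (simp add: fun_eq_iff spin_def complex_eq_iff)
  have "((\<lambda>t. spin s 0 + spin 0 (x t)) has_vector_derivative 0 + spin 0 X) F"
    by (rule has_vector_derivative_add[OF has_vector_derivative_const
      bounded_linear.has_vector_derivative[OF bounded_linear_spin assms]])
  then show ?thesis unfolding eq by simp
qed

lemma tr4_has_vector_derivative:
  assumes "(A has_vector_derivative A') (at t within S)" "(B has_vector_derivative B') (at t within S)"
    "(C has_vector_derivative C') (at t within S)" "(D has_vector_derivative D') (at t within S)"
  shows "((\<lambda>t. tr4 (A t) (B t) (C t) (D t)) has_vector_derivative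
    tr4 A' (B t) (C t) (D t) + tr4 (A t) B' (C t) (D t) + tr4 (A t) (B t) C' (D t) + tr4 (A t) (B t) (C t) D')
    (at t within S)"
proof -
  have "((\<lambda>t. tr4 (A t) (B t) (C t) (D t)) has_vector_derivative
    tr2 (mul2 (mul2 (A t) (B t)) (mul2 (C t) D' + mul2 C' (D t)) +
         mul2 (mul2 (A t) B' + mul2 A' (B t)) (mul2 (C t) (D t)))) (at t within S)"
    unfolding tr4_def
    by (rule bounded_linear.has_vector_derivative[OF bounded_linear_tr2]
      bounded_bilinear.has_vector_derivative[OF bounded_bilinear_mul2] assms)+
  also have "tr2 (mul2 (mul2 (A t) (B t)) (mul2 (C t) D' + mul2 C' (D t)) +
         mul2 (mul2 (A t) B' + mul2 A' (B t)) (mul2 (C t) (D t))) =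
    tr4 A' (B t) (C t) (D t) + tr4 (A t) B' (C t) (D t) + tr4 (A t) (B t) C' (D t) + tr4 (A t) (B t) (C t) D'"
    unfolding tr4_def
    by (simp add: bounded_bilinear.add_left[OF bounded_bilinear_mul2]
      bounded_bilinear.add_right[OF bounded_bilinear_mul2]
      linear_add[OF bounded_linear.linear[OF bounded_linear_tr2]])
  finally show ?thesis .
qed

text \<open>A positive multiple of the cross-ratio of the four points or of its conjugate, but polynomial
  and thus free of charts. Its modulus is the product of the chords \<open>|x1 - x2| |x2 - x3| |x3 - x4| |x4 - x1|\<close>.\<close>

definition quad :: "real^3 \<Rightarrow> real^3 \<Rightarrow> real^3 \<Rightarrow> real^3 \<Rightarrow> complex" where
  "quad x1 x2 x3 x4 = tr4 (spin (1/2) x1) (spin (1/2) (- x2)) (spin (1/2) x3) (spin (1/2) (- x4))"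

lemma uminus_S2: "x \<in> S2 \<Longrightarrow> - x \<in> S2"
  by (simp add: S2_def)

text \<open>Multiplication by the trace with \<open>y1\<close> and \<open>y3\<close> interchanged
  gives, by \<open>tr4_exchange\<close>, a product of two traces as in \<open>tr4_spin_same\<close>,
  that is of squared norms of sums of neighbours, none of which is zero.\<close>

lemma tr4_spin_nonzero:
  assumes "y1 \<in> S2" "y2 \<in> S2" "y3 \<in> S2" "y4 \<in> S2"
    "y1 + y2 \<noteq> 0" "y2 + y3 \<noteq> 0" "y3 + y4 \<noteq> 0" "y4 + y1 \<noteq> 0"
  shows "tr4 (spin (1/2) y1) (spin (1/2) y2) (spin (1/2) y3) (spin (1/2) y4) \<noteq> 0"
proof
  let ?P = "spin (1/2)"
  assume *: "tr4 (?P y1) (?P y2) (?P y3) (?P y4) = 0"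
  have "tr4 (?P y1) (?P y2) (?P y3) (?P y4) * tr4 (?P y3) (?P y2) (?P y1) (?P y4) =
      tr4 (?P y3) (?P y2) (?P y3) (?P y4) * tr4 (?P y1) (?P y2) (?P y1) (?P y4)"
    by (intro tr4_exchange rank1_spin assms)
  then show False
    using assms unfolding * by (simp add: tr4_spin_same add.commute)
qed

text \<open>By \<open>tr4_exchange\<close>, the logarithmic derivative in \<open>y1\<close> does not depend on \<open>y3\<close>; so take \<open>y3 = y1\<close>, where the
  denominator is real.\<close>

lemma Im_tr4_ratio:
  assumes "y1 \<in> S2" "y2 \<in> S2" "y3 \<in> S2" "y4 \<in> S2" "y1 \<bullet> Y = 0"
    "y1 + y2 \<noteq> 0" "y2 + y3 \<noteq> 0" "y3 + y4 \<noteq> 0" "y4 + y1 \<noteq> 0"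
  shows "Im (tr4 (spin 0 Y) (spin (1/2) y2) (spin (1/2) y3) (spin (1/2) y4) /
             tr4 (spin (1/2) y1) (spin (1/2) y2) (spin (1/2) y3) (spin (1/2) y4)) =
    2 * (y2 \<bullet> cross3 y1 Y) / (norm (y1 + y2))\<^sup>2 - 2 * (y4 \<bullet> cross3 y1 Y) / (norm (y4 + y1))\<^sup>2"
proof -
  let ?P = "spin (1/2)"
  define n where "n = (norm (y1 + y2))\<^sup>2 * (norm (y1 + y4))\<^sup>2"
  have n: "n \<noteq> 0" using assms by (simp add: n_def add.commute)
  have "tr4 (?P y1) (?P y2) (?P y3) (?P y4) * tr4 (spin 0 Y) (?P y2) (?P y1) (?P y4) =
      tr4 (spin 0 Y) (?P y2) (?P y3) (?P y4) * tr4 (?P y1) (?P y2) (?P y1) (?P y4)"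
    by (intro tr4_exchange rank1_spin assms)
  then have "tr4 (spin 0 Y) (?P y2) (?P y3) (?P y4) / tr4 (?P y1) (?P y2) (?P y3) (?P y4) =
      tr4 (spin 0 Y) (?P y2) (?P y1) (?P y4) / of_real n"
    using tr4_spin_nonzero[of y1 y2 y3 y4] assms n
    by (simp add: tr4_spin_same n_def[symmetric] frac_eq_eq mult.commute)
  then have "Im (tr4 (spin 0 Y) (?P y2) (?P y3) (?P y4) / tr4 (?P y1) (?P y2) (?P y3) (?P y4)) =
     2 * (y2 \<bullet> cross3 y1 Y * (norm (y1 + y4))\<^sup>2 - y4 \<bullet> cross3 y1 Y * (norm (y1 + y2))\<^sup>2) / n"
    using assms by (simp add: Im_tr4_spin)
  also have "\<dots> = 2 * (y2 \<bullet> cross3 y1 Y) / (norm (y1 + y2))\<^sup>2 - 2 * (y4 \<bullet> cross3 y1 Y) / (norm (y4 + y1))\<^sup>2"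
    using n unfolding n_def add.commute[of y4 y1] by (simp add: diff_divide_distrib right_diff_distrib)
  finally show ?thesis .
qed

text \<open>The share of the edge from \<open>x\<close> to \<open>y\<close> in the logarithmic
  derivative: each end contributes one of the two terms of \<open>Im_tr4_ratio\<close>, and the
  antipodes taken at \<open>x2\<close> and \<open>x4\<close> turn the sums there into
  differences.\<close>

definition rate :: "real^3 \<Rightarrow> real^3 \<Rightarrow> real^3 \<Rightarrow> real^3 \<Rightarrow> real" where
  "rate x X y Y = 2 * (y \<bullet> cross3 x X + x \<bullet> cross3 y Y) / (norm (x - y))\<^sup>2"

definition quad_deriv :: "real^3 \<Rightarrow> real^3 \<Rightarrow> real^3 \<Rightarrow> real^3 \<Rightarrow> real^3 \<Rightarrow> real^3 \<Rightarrow> real^3 \<Rightarrow> real^3 \<Rightarrow> complex" where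
  "quad_deriv x1 X1 x2 X2 x3 X3 x4 X4 =
     tr4 (spin 0 X1) (spin (1/2) (- x2)) (spin (1/2) x3) (spin (1/2) (- x4)) +
     tr4 (spin (1/2) x1) (spin 0 (- X2)) (spin (1/2) x3) (spin (1/2) (- x4)) +
     tr4 (spin (1/2) x1) (spin (1/2) (- x2)) (spin 0 X3) (spin (1/2) (- x4)) +
     tr4 (spin (1/2) x1) (spin (1/2) (- x2)) (spin (1/2) x3) (spin 0 (- X4))"

lemma continuous_on_spin [continuous_intros]:
  assumes "continuous_on S x"
  shows "continuous_on S (\<lambda>t. spin s (x t))"
proof -
  have eq: "(\<lambda>t. spin s (x t)) = (\<lambda>t. spin s 0 + spin 0 (x t))"
    by (simp add: fun_eq_iff spin_def complex_eq_iff)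
  show ?thesis unfolding eq
    by (intro continuous_on_add continuous_on_const bounded_linear.continuous_on[OF bounded_linear_spin] assms)
qed

lemma continuous_on_tr4 [continuous_intros]:
  assumes "continuous_on S A" "continuous_on S B" "continuous_on S C" "continuous_on S D"
  shows "continuous_on S (\<lambda>t. tr4 (A t) (B t) (C t) (D t))"
  unfolding tr4_def
  by (rule bounded_linear.continuous_on[OF bounded_linear_tr2]
      bounded_bilinear.continuous_on[OF bounded_bilinear_mul2] assms)+

text \<open>Cyclic invariance of the trace brings each differentiated factor to the front, where
  \<open>Im_tr4_ratio\<close> applies. Every edge of the four-cycle then receives one term from each
  of its ends with the same sign, and the signs alternate along the cycle.\<close>

lemma quad_log_derivative:
  assumes "x1 t \<in> S2" "x2 t \<in> S2" "x3 t \<in> S2" "x4 t \<in> S2"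
    and "x1 t \<bullet> X1 = 0" "x2 t \<bullet> X2 = 0" "x3 t \<bullet> X3 = 0" "x4 t \<bullet> X4 = 0"
    and "x1 t \<noteq> x2 t" "x2 t \<noteq> x3 t" "x3 t \<noteq> x4 t" "x4 t \<noteq> x1 t"
    and "(x1 has_vector_derivative X1) (at t within S)" "(x2 has_vector_derivative X2) (at t within S)"
      "(x3 has_vector_derivative X3) (at t within S)" "(x4 has_vector_derivative X4) (at t within S)"
  shows quad_has_vector_derivative: "((\<lambda>t. quad (x1 t) (x2 t) (x3 t) (x4 t)) has_vector_derivative
      quad_deriv (x1 t) X1 (x2 t) X2 (x3 t) X3 (x4 t) X4) (at t within S)" (is ?deriv)
    and "Im (quad_deriv (x1 t) X1 (x2 t) X2 (x3 t) X3 (x4 t) X4 / quad (x1 t) (x2 t) (x3 t) (x4 t)) =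
      - (rate (x1 t) X1 (x2 t) X2 - rate (x2 t) X2 (x3 t) X3 + rate (x3 t) X3 (x4 t) X4 - rate (x4 t) X4 (x1 t) X1)"
      (is ?ratio)
proof -
  let ?P = "spin (1/2)"
  let ?q = "quad (x1 t) (x2 t) (x3 t) (x4 t)"
  let ?Q = "quad_deriv (x1 t) X1 (x2 t) X2 (x3 t) X3 (x4 t) X4"
  show ?deriv
    unfolding quad_def quad_deriv_def
    by (intro tr4_has_vector_derivative spin_has_vector_derivative has_vector_derivative_minus assms)
  have q2: "?q = tr4 (?P (- x2 t)) (?P (x3 t)) (?P (- x4 t)) (?P (x1 t))"
    unfolding quad_def by (rule tr4_cyclic)
  have q3: "?q = tr4 (?P (x3 t)) (?P (- x4 t)) (?P (x1 t)) (?P (- x2 t))"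
    unfolding q2 by (rule tr4_cyclic)
  have q4: "?q = tr4 (?P (- x4 t)) (?P (x1 t)) (?P (- x2 t)) (?P (x3 t))"
    unfolding q3 by (rule tr4_cyclic)
  have Q: "?Q = tr4 (spin 0 X1) (?P (- x2 t)) (?P (x3 t)) (?P (- x4 t)) +
     tr4 (spin 0 (- X2)) (?P (x3 t)) (?P (- x4 t)) (?P (x1 t)) +
     tr4 (spin 0 X3) (?P (- x4 t)) (?P (x1 t)) (?P (- x2 t)) +
     tr4 (spin 0 (- X4)) (?P (x1 t)) (?P (- x2 t)) (?P (x3 t))"
    by (simp only: quad_deriv_def tr4_cyclic[of _ "spin 0 (- X2)"] tr4_cyclic'(1)[of _ _ "spin 0 X3"]
      tr4_cyclic'(2)[of _ _ _ "spin 0 (- X4)"])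
  have I1: "Im (tr4 (spin 0 X1) (?P (- x2 t)) (?P (x3 t)) (?P (- x4 t)) / ?q) =
      2 * (- x2 t \<bullet> cross3 (x1 t) X1) / (norm (x1 t + - x2 t))\<^sup>2 - 2 * (- x4 t \<bullet> cross3 (x1 t) X1) / (norm (- x4 t + x1 t))\<^sup>2"
    unfolding quad_def by (rule Im_tr4_ratio) (use assms in \<open>auto intro: uminus_S2\<close>)
  have I2: "Im (tr4 (spin 0 (- X2)) (?P (x3 t)) (?P (- x4 t)) (?P (x1 t)) / ?q) =
      2 * (x3 t \<bullet> cross3 (- x2 t) (- X2)) / (norm (- x2 t + x3 t))\<^sup>2 - 2 * (x1 t \<bullet> cross3 (- x2 t) (- X2)) / (norm (x1 t + - x2 t))\<^sup>2"
    unfolding q2 by (rule Im_tr4_ratio) (use assms in \<open>auto intro: uminus_S2\<close>)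
  have I3: "Im (tr4 (spin 0 X3) (?P (- x4 t)) (?P (x1 t)) (?P (- x2 t)) / ?q) =
      2 * (- x4 t \<bullet> cross3 (x3 t) X3) / (norm (x3 t + - x4 t))\<^sup>2 - 2 * (- x2 t \<bullet> cross3 (x3 t) X3) / (norm (- x2 t + x3 t))\<^sup>2"
    unfolding q3 by (rule Im_tr4_ratio) (use assms in \<open>auto intro: uminus_S2\<close>)
  have I4: "Im (tr4 (spin 0 (- X4)) (?P (x1 t)) (?P (- x2 t)) (?P (x3 t)) / ?q) =
      2 * (x1 t \<bullet> cross3 (- x4 t) (- X4)) / (norm (- x4 t + x1 t))\<^sup>2 - 2 * (x3 t \<bullet> cross3 (- x4 t) (- X4)) / (norm (x3 t + - x4 t))\<^sup>2"
    unfolding q4 by (rule Im_tr4_ratio) (use assms in \<open>auto intro: uminus_S2\<close>)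
  have c: "cross3 (- u) (- v) = cross3 u v" for u v :: "real^3"
    by (simp add: cross3_simps)
  have nn: "norm (- u + v) = norm (u - v)" for u v :: "real^3"
    using norm_minus_commute[of v u] by simp
  have "Im (?Q / ?q) = Im (tr4 (spin 0 X1) (?P (- x2 t)) (?P (x3 t)) (?P (- x4 t)) / ?q) +
     Im (tr4 (spin 0 (- X2)) (?P (x3 t)) (?P (- x4 t)) (?P (x1 t)) / ?q) +
     Im (tr4 (spin 0 X3) (?P (- x4 t)) (?P (x1 t)) (?P (- x2 t)) / ?q) +
     Im (tr4 (spin 0 (- X4)) (?P (x1 t)) (?P (- x2 t)) (?P (x3 t)) / ?q)"
    unfolding Q add_divide_distrib plus_complex.sel ..
  also have "\<dots> = - (rate (x1 t) X1 (x2 t) X2 - rate (x2 t) X2 (x3 t) X3 + rate (x3 t) X3 (x4 t) X4 - rate (x4 t) X4 (x1 t) X1)"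
    unfolding I1 I2 I3 I4 c rate_def nn
    by (simp add: add_divide_distrib distrib_left)
  finally show ?ratio .
qed

text \<open>With \<open>L\<close> the integral of \<open>T' / T\<close>, the product
  \<open>T exp (- L)\<close> has derivative zero.\<close>

lemma complex_log_lift:
  fixes T T' :: "real \<Rightarrow> complex"
  assumes der: "\<And>t. t \<in> {0..1} \<Longrightarrow> (T has_vector_derivative T' t) (at t within {0..1})"
    and cont: "continuous_on {0..1} T'" and nz: "\<And>t. t \<in> {0..1} \<Longrightarrow> T t \<noteq> 0"
  shows "T 1 = T 0 * exp (integral {0..1} (\<lambda>t. T' t / T t))"
proof -
  define L where "L t = integral {0..t} (\<lambda>s. T' s / T s)" for t
  have contT: "continuous_on {0..1} T"
    using der has_vector_derivative_continuous continuous_on_eq_continuous_within by blast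
  have dL: "(L has_vector_derivative T' t / T t) (at t within {0..1})" if "t \<in> {0..1}" for t
    unfolding L_def using that nz
    by (intro integral_has_vector_derivative continuous_on_divide cont contT) auto
  have "((\<lambda>t. T t * exp (- L t)) has_vector_derivative
      T t * (- (T' t / T t) * exp (- L t)) + T' t * exp (- L t)) (at t within {0..1})" if "t \<in> {0..1}" for t
    by (intro has_vector_derivative_mult der that
      field_vector_diff_chain_within[of "\<lambda>t. - L t" "- (T' t / T t)" t "{0..1}" exp, unfolded o_def]
      has_vector_derivative_minus dL DERIV_exp has_field_derivative_at_within)
  then have "((\<lambda>t. T t * exp (- L t)) has_vector_derivative 0) (at t within {0..1})" if "t \<in> {0..1}" for t
    using nz that by (simp add: field_simps)
  then obtain c where "\<And>t. t \<in> {0..1} \<Longrightarrow> T t * exp (- L t) = c"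
    using has_vector_derivative_zero_constant[of "{0..1}" "\<lambda>t. T t * exp (- L t)"] by auto
  from this[of 0] this[of 1] have "T 1 * exp (- L 1) = T 0 * exp (- L 0)" by simp
  moreover have "L 0 = 0" by (simp add: L_def)
  ultimately show ?thesis
    by (simp add: exp_minus L_def field_simps)
qed

section \<open>Lifting the argument along an isotopy\<close>

lemma bounded_bilinear_cross3: "bounded_bilinear cross3"
  using bilinear_cross bilinear_conv_bounded_bilinear by blast

text \<open>The Lagrangian velocity, that is \<open>generating_field\<close> at the moving point
  \<open>\<phi> t x\<close>; no inverse map enters.\<close>

definition vel :: "(real \<Rightarrow> real^3 \<Rightarrow> real^3) \<Rightarrow> real \<Rightarrow> real^3 \<Rightarrow> real^3" where
  "vel \<phi> t x = vector_derivative (\<lambda>s. \<phi> s x) (at t within {0..1})"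

definition theta :: "(real \<Rightarrow> real^3 \<Rightarrow> real^3) \<Rightarrow> real^3 \<Rightarrow> real^3 \<Rightarrow> real" where
  "theta \<phi> x y = integral {0..1} (\<lambda>t. rate (\<phi> t x) (vel \<phi> t x) (\<phi> t y) (vel \<phi> t y))"

text \<open>What the topological part needs, independent of area: points that start distinct stay
  distinct, and velocities are continuous in time and space.\<close>

locale c1_isotopy =
  fixes \<phi> :: "real \<Rightarrow> real^3 \<Rightarrow> real^3"
  assumes maps_to: "t \<in> {0..1} \<Longrightarrow> x \<in> S2 \<Longrightarrow> \<phi> t x \<in> S2"
    and inj: "t \<in> {0..1} \<Longrightarrow> inj_on (\<phi> t) S2"
    and continuous: "continuous_on ({0..1} \<times> S2) (\<lambda>(t, x). \<phi> t x)"
    and has_vel: "t \<in> {0..1} \<Longrightarrow> x \<in> S2 \<Longrightarrow> ((\<lambda>s. \<phi> s x) has_vector_derivative vel \<phi> t x) (at t within {0..1})"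
    and continuous_vel: "continuous_on ({0..1} \<times> S2) (\<lambda>(t, x). vel \<phi> t x)"
begin

lemma distinct: "t \<in> {0..1} \<Longrightarrow> x \<in> S2 \<Longrightarrow> y \<in> S2 \<Longrightarrow> x \<noteq> y \<Longrightarrow> \<phi> t x \<noteq> \<phi> t y"
  using inj inj_onD by metis

lemma continuous_comp:
  assumes a: "continuous_on S a" and b: "continuous_on S b"
    and ab: "\<And>z. z \<in> S \<Longrightarrow> a z \<in> {0..1} \<and> b z \<in> S2"
  shows "continuous_on S (\<lambda>z. \<phi> (a z) (b z))" "continuous_on S (\<lambda>z. vel \<phi> (a z) (b z))"
proof -
  have "(\<lambda>z. (a z, b z)) ` S \<subseteq> {0..1} \<times> S2" using ab by auto
  then show "continuous_on S (\<lambda>z. \<phi> (a z) (b z))" "continuous_on S (\<lambda>z. vel \<phi> (a z) (b z))"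
    using continuous_on_compose2[OF continuous continuous_on_Pair[OF a b]]
      continuous_on_compose2[OF continuous_vel continuous_on_Pair[OF a b]] by simp_all
qed

lemma vel_orthogonal:
  assumes t: "t \<in> {0..1}" and x: "x \<in> S2"
  shows "\<phi> t x \<bullet> vel \<phi> t x = 0"
proof -
  have "((\<lambda>s. \<phi> s x \<bullet> \<phi> s x) has_vector_derivative
      \<phi> t x \<bullet> vel \<phi> t x + vel \<phi> t x \<bullet> \<phi> t x) (at t within {0..1})"
    by (intro bounded_bilinear.has_vector_derivative[OF bounded_bilinear_inner] has_vel t x)
  moreover have "((\<lambda>s. \<phi> s x \<bullet> \<phi> s x) has_vector_derivative 0) (at t within {0..1})"
  proof (rule has_vector_derivative_transform[OF t _ has_vector_derivative_const[of "1/4"]])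
    fix s :: real assume "s \<in> {0..1}"
    then have "norm (\<phi> s x) = 1/2" using maps_to x by (simp add: S2_def)
    then show "\<phi> s x \<bullet> \<phi> s x = 1/4" by (simp only: power2_norm_eq_inner[symmetric]) (simp add: power_divide)
  qed
  ultimately have "\<phi> t x \<bullet> vel \<phi> t x + vel \<phi> t x \<bullet> \<phi> t x = 0"
    using t by (intro vector_derivative_unique_within_closed_interval[of 0 1 t]) auto
  then show ?thesis by (simp add: inner_commute)
qed

lemma continuous_rate:
  assumes a: "continuous_on S a" and b: "continuous_on S b" and c: "continuous_on S c"
    and "\<And>z. z \<in> S \<Longrightarrow> a z \<in> {0..1} \<and> b z \<in> S2 \<and> c z \<in> S2 \<and> b z \<noteq> c z"
  shows "continuous_on S (\<lambda>z. rate (\<phi> (a z) (b z)) (vel \<phi> (a z) (b z)) (\<phi> (a z) (c z)) (vel \<phi> (a z) (c z)))"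
  unfolding rate_def
  by (intro continuous_intros bounded_bilinear.continuous_on[OF bounded_bilinear_cross3] continuous_comp a b c)
    (use assms(4) distinct in auto)

lemma continuous_theta:
  assumes x: "x \<in> S2"
  shows "continuous_on (S2 - {x}) (theta \<phi> x)"
  unfolding theta_def cbox_interval[symmetric]
  by (rule integral_continuous_on_param)
    (auto simp: split_beta x intro!: continuous_rate continuous_intros)

lemma theta_commute: "theta \<phi> x y = theta \<phi> y x"
  by (simp add: theta_def rate_def norm_minus_commute add.commute)

lemma rate_integrable:
  assumes "x \<in> S2" "y \<in> S2" "x \<noteq> y"
  shows "(\<lambda>t. rate (\<phi> t x) (vel \<phi> t x) (\<phi> t y) (vel \<phi> t y)) integrable_on {0..1}"
  by (intro integrable_continuous_interval continuous_rate) (use assms in \<open>auto intro!: continuous_intros\<close>)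

text \<open>Only the imaginary part of the logarithm is recorded. The end points of the isotopy
  determine \<open>exp L\<close>, hence that imaginary part modulo 2 pi.\<close>

lemma quad_lift:
  assumes "x1 \<in> S2" "x2 \<in> S2" "x3 \<in> S2" "x4 \<in> S2" "x1 \<noteq> x2" "x2 \<noteq> x3" "x3 \<noteq> x4" "x4 \<noteq> x1"
  shows "\<exists>L. quad (\<phi> 1 x1) (\<phi> 1 x2) (\<phi> 1 x3) (\<phi> 1 x4) = quad (\<phi> 0 x1) (\<phi> 0 x2) (\<phi> 0 x3) (\<phi> 0 x4) * exp L
    \<and> quad (\<phi> 0 x1) (\<phi> 0 x2) (\<phi> 0 x3) (\<phi> 0 x4) \<noteq> 0
    \<and> Im L = - (theta \<phi> x1 x2 - theta \<phi> x2 x3 + theta \<phi> x3 x4 - theta \<phi> x4 x1)"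
proof -
  define T where "T t = quad (\<phi> t x1) (\<phi> t x2) (\<phi> t x3) (\<phi> t x4)" for t
  define T' where "T' t = quad_deriv (\<phi> t x1) (vel \<phi> t x1) (\<phi> t x2) (vel \<phi> t x2)
     (\<phi> t x3) (vel \<phi> t x3) (\<phi> t x4) (vel \<phi> t x4)" for t
  define R where "R x y t = rate (\<phi> t x) (vel \<phi> t x) (\<phi> t y) (vel \<phi> t y)" for x y t
  have der: "(T has_vector_derivative T' t) (at t within {0..1})" if "t \<in> {0..1}" for t
    unfolding T_def T'_def
    by (rule quad_has_vector_derivative) (use that assms maps_to vel_orthogonal distinct has_vel in auto)
  have ratio: "Im (T' t / T t) = - (R x1 x2 t - R x2 x3 t + R x3 x4 t - R x4 x1 t)" if "t \<in> {0..1}" for t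
    unfolding T_def T'_def R_def
    by (rule quad_log_derivative(2)[where S = "{0..1}"]) (use that assms maps_to vel_orthogonal distinct has_vel in auto)
  have nz: "T t \<noteq> 0" if "t \<in> {0..1}" for t
    unfolding T_def quad_def
    by (rule tr4_spin_nonzero) (use that assms maps_to distinct uminus_S2 in auto)
  have cT': "continuous_on {0..1} T'"
    unfolding T'_def quad_deriv_def
    by (intro continuous_intros continuous_comp) (use assms in auto)
  have cT: "continuous_on {0..1} T"
    unfolding T_def quad_def
    by (intro continuous_intros continuous_comp) (use assms in auto)
  define L where "L = integral {0..1} (\<lambda>t. T' t / T t)"
  have int: "(\<lambda>t. T' t / T t) integrable_on {0..1}"
    by (intro integrable_continuous_interval continuous_on_divide cT cT') (use nz in auto)
  have "Im L = integral {0..1} (\<lambda>t. Im (T' t / T t))"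
    unfolding L_def by (rule integral_linear[OF int bounded_linear_Im, unfolded o_def, symmetric])
  also have "\<dots> = integral {0..1} (\<lambda>t. - (R x1 x2 t - R x2 x3 t + R x3 x4 t - R x4 x1 t))"
    by (rule integral_cong) (rule ratio)
  also have "\<dots> = - (theta \<phi> x1 x2 - theta \<phi> x2 x3 + theta \<phi> x3 x4 - theta \<phi> x4 x1)"
  proof -
    have "R x1 x2 integrable_on {0..1}" "R x2 x3 integrable_on {0..1}"
      "R x3 x4 integrable_on {0..1}" "R x4 x1 integrable_on {0..1}"
      unfolding R_def using assms by (auto intro!: rate_integrable)
    then have "((\<lambda>t. - (R x1 x2 t - R x2 x3 t + R x3 x4 t - R x4 x1 t)) has_integral
      - (integral {0..1} (R x1 x2) - integral {0..1} (R x2 x3) + integral {0..1} (R x3 x4) - integral {0..1} (R x4 x1)))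
      {0..1}"
      by (intro has_integral_neg has_integral_add has_integral_diff integrable_integral)
    then show ?thesis
      unfolding theta_def R_def by (rule integral_unique)
  qed
  finally have "Im L = - (theta \<phi> x1 x2 - theta \<phi> x2 x3 + theta \<phi> x3 x4 - theta \<phi> x4 x1)" .
  moreover have "T 1 = T 0 * exp L"
    unfolding L_def by (rule complex_log_lift[OF der cT' nz])
  ultimately show ?thesis using nz[of 0] unfolding T_def by auto
qed

end

text \<open>Stereographic projection from \<open>b\<close> leaves a plane minus at most one point,
  and a convex set that is not collinear stays connected without a countable subset. The case
  \<open>b = c\<close> occurs, since \<open>x2\<close> and \<open>x4\<close> may coincide
  below.\<close>

lemma connected_S2_minus_two:
  assumes b: "b \<in> S2" and c: "c \<in> S2"
  shows "connected (S2 - {b, c})"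
proof -
  define H where "H = {x::real^3. axis 1 1 \<bullet> x = 0}"
  have "(sphere 0 (1/2) - {b}) homeomorphic H"
    unfolding H_def by (rule homeomorphic_punctured_sphere_hyperplane) (use b in \<open>auto simp: S2_def axis_eq_0_iff\<close>)
  then obtain k h where "homeomorphism (S2 - {b}) H k h"
    unfolding S2_def homeomorphic_def by blast
  then have hk: "homeomorphism H (S2 - {b}) h k"
    by (rule homeomorphism_symD)
  have cH: "convex H" unfolding H_def by (rule convex_hyperplane)
  have ncol: "\<not> collinear H"
  proof
    assume "collinear H"
    then have "collinear {0, axis 2 1, axis 3 1 :: real^3}"
      by (rule collinear_subset) (auto simp: H_def inner_axis_axis)
    then obtain r where "axis 3 1 = (r::real) *\<^sub>R (axis 2 1 :: real^3)"
      by (auto simp: collinear_lemma axis_eq_0_iff)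
    from arg_cong[OF this, of "\<lambda>v. v $ 3"] show False by (simp add: axis_def)
  qed
  have "connected (h ` (H - T))" if "countable T" for T
  proof (rule connected_continuous_image)
    show "continuous_on (H - T) h"
      by (rule continuous_on_subset[OF homeomorphism_cont1[OF hk]]) auto
    show "connected (H - T)"
      by (rule connected_convex_diff_countable[OF cH ncol that])
  qed
  from this[of "{k c}"] this[of "{}"]
  have conn: "connected (h ` (H - {k c}))" "connected (h ` H)" by simp_all
  have im: "h ` H = S2 - {b}" by (rule homeomorphism_image1[OF hk])
  show ?thesis
  proof (cases "b = c")
    case False
    then have k: "k c \<in> H" "h (k c) = c" using c hk unfolding homeomorphism_def by auto
    have "inj_on h H" using hk unfolding homeomorphism_def by (metis inj_on_inverseI)
    then have "h ` (H - {k c}) = S2 - {b} - {c}"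
      using k im by (subst inj_on_image_set_diff[of h H]) auto
    moreover have "S2 - {b} - {c} = S2 - {b, c}" by auto
    ultimately show ?thesis using conn by simp
  qed (use conn im in simp)
qed

theorem theta_cocycle_unique:
  assumes "c1_isotopy \<phi>" "c1_isotopy \<psi>"
    and ends: "\<And>x. x \<in> S2 \<Longrightarrow> \<phi> 0 x = \<psi> 0 x" "\<And>x. x \<in> S2 \<Longrightarrow> \<phi> 1 x = \<psi> 1 x"
    and x: "x1 \<in> S2" "x2 \<in> S2" "x3 \<in> S2" "x4 \<in> S2" "x1 \<noteq> x2" "x2 \<noteq> x3" "x3 \<noteq> x4" "x4 \<noteq> x1"
  shows "theta \<phi> x1 x2 - theta \<phi> x2 x3 + theta \<phi> x3 x4 - theta \<phi> x4 x1 =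
         theta \<psi> x1 x2 - theta \<psi> x2 x3 + theta \<psi> x3 x4 - theta \<psi> x4 x1"
proof -
  interpret P: c1_isotopy \<phi> by fact
  interpret Q: c1_isotopy \<psi> by fact
  define A where "A \<phi> y = theta \<phi> x1 x2 - theta \<phi> x2 y + theta \<phi> y x4 - theta \<phi> x4 x1" for \<phi> y
  define D where "D y = (A \<phi> y - A \<psi> y) / (2 * pi)" for y
  \<comment> \<open>The third point has to avoid its neighbours \<open>x2\<close> and
    \<open>x4\<close> only, so it can be moved from \<open>x3\<close> to \<open>x1\<close>.\<close>
  have x1: "x1 \<in> S2 - {x2, x4}" and x3: "x3 \<in> S2 - {x2, x4}" using x by auto
  have cont: "continuous_on (S2 - {x2, x4}) D"
  proof -
    have "continuous_on (S2 - {x2, x4}) (theta \<phi> x2)" "continuous_on (S2 - {x2, x4}) (theta \<phi> x4)"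
      "continuous_on (S2 - {x2, x4}) (theta \<psi> x2)" "continuous_on (S2 - {x2, x4}) (theta \<psi> x4)"
      using P.continuous_theta[of x2] P.continuous_theta[of x4] Q.continuous_theta[of x2] Q.continuous_theta[of x4] x
      by (auto elim!: continuous_on_subset)
    then show ?thesis unfolding D_def A_def P.theta_commute[of _ x4] Q.theta_commute[of _ x4]
      by (intro continuous_intros) auto
  qed
  have int: "D y \<in> \<int>" if y: "y \<in> S2 - {x2, x4}" for y
  proof -
    obtain L M where L: "quad (\<phi> 1 x1) (\<phi> 1 x2) (\<phi> 1 y) (\<phi> 1 x4) = quad (\<phi> 0 x1) (\<phi> 0 x2) (\<phi> 0 y) (\<phi> 0 x4) * exp L"
      "quad (\<phi> 0 x1) (\<phi> 0 x2) (\<phi> 0 y) (\<phi> 0 x4) \<noteq> 0" "Im L = - A \<phi> y"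
     and M: "quad (\<psi> 1 x1) (\<psi> 1 x2) (\<psi> 1 y) (\<psi> 1 x4) = quad (\<psi> 0 x1) (\<psi> 0 x2) (\<psi> 0 y) (\<psi> 0 x4) * exp M"
      "Im M = - A \<psi> y"
      using P.quad_lift[of x1 x2 y x4] Q.quad_lift[of x1 x2 y x4] x y unfolding A_def by blast
    have "exp L = exp M" using L M ends x y by auto
    then obtain n :: int where "L = M + of_int (2 * n) * pi * \<i>"
      unfolding exp_eq by blast
    then have "Im L = Im M + 2 * n * pi" by simp
    then have "D y = of_int (- n)" unfolding D_def L M by (simp add: L M field_simps)
    then show ?thesis by (metis Ints_of_int)
  qed
  have "D constant_on (S2 - {x2, x4})"
  proof (rule continuous_discrete_range_constant[OF connected_S2_minus_two[OF x(2,4)] cont])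
    fix y assume y: "y \<in> S2 - {x2, x4}"
    have "1 \<le> norm (D z - D y)" if "z \<in> S2 - {x2, x4}" "D z \<noteq> D y" for z
      using int[OF y] int[OF that(1)] that(2) by (metis Ints_diff Ints_nonzero_abs_ge1 eq_iff_diff_eq_0 real_norm_def)
    then show "\<exists>e>0. \<forall>z. z \<in> S2 - {x2, x4} \<and> D z \<noteq> D y \<longrightarrow> e \<le> norm (D z - D y)"
      by (metis zero_less_one)
  qed
  then have "D x3 = D x1" using x1 x3 unfolding constant_on_def by metis
  \<comment> \<open>For \<open>y = x1\<close> the four-cycle retraces its own edges, and the
    symmetry of \<open>theta\<close> cancels them for each isotopy separately.\<close>
  also have "D x1 = 0"
    unfolding D_def A_def using P.theta_commute Q.theta_commute by simp
  finally show ?thesis by (simp add: D_def A_def)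
qed

section \<open>Invariance of the area measure\<close>

text \<open>The change of variables theorem is available for \<open>real^2\<close> but not for \<open>real \<times> real\<close>, so the
  chart is transferred to \<open>real^2\<close>.\<close>

definition chart2 :: "real^2 \<Rightarrow> real^3" where
  "chart2 v = chart (v$1, v$2)"

definition unchart :: "real^3 \<Rightarrow> real^2" where
  "unchart x = vector [x$1 / (x$3 + 1/2), x$2 / (x$3 + 1/2)]"

definition dens :: "real^2 \<Rightarrow> real" where
  "dens v = 2 / (1 + (norm v)\<^sup>2)\<^sup>2"

lemma lborel_prod_real2:
  "(lborel :: (real \<times> real) measure) = distr lborel borel (\<lambda>v::real^2. (v$1, v$2))"
proof (rule lborel_eqI)
  fix l u :: "real \<times> real" assume le: "\<And>b. b \<in> Basis \<Longrightarrow> l \<bullet> b \<le> u \<bullet> b"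
  obtain l1 l2 u1 u2 where lu: "l = (l1, l2)" "u = (u1, u2)" by (cases l, cases u)
  have le: "l1 \<le> u1" "l2 \<le> u2"
    using le[of "(1, 0)"] le[of "(0, 1)"] by (auto simp: lu Basis_prod_def)
  have m: "(\<lambda>v::real^2. (v$1, v$2)) \<in> borel_measurable borel"
    by (intro borel_measurable_continuous_onI continuous_intros)
  have pre: "(\<lambda>v::real^2. (v$1, v$2)) -` box (l1, l2) (u1, u2) = box (vector [l1, l2]) (vector [u1, u2])"
    by (auto simp: box_def Basis_prod_def Basis_vec_def inner_axis forall_2 inner_Pair_0 set_eq_iff)
  have le2: "\<And>b. b \<in> Basis \<Longrightarrow> (vector [l1, l2] :: real^2) \<bullet> b \<le> vector [u1, u2] \<bullet> b"
    using le by (auto simp: Basis_vec_def inner_axis forall_2 UNIV_2)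
  have B2: "(Basis :: (real^2) set) = {axis 1 1, axis 2 1}"
    by (auto simp: Basis_vec_def UNIV_2)
  have ne: "(axis 1 1 :: real^2) \<noteq> axis 2 1" by (simp add: axis_eq_axis)
  have B1: "(Basis :: (real \<times> real) set) = {(1, 0), (0, 1)}" by (auto simp: Basis_prod_def)
  have "emeasure lborel (box (vector [l1, l2] :: real^2) (vector [u1, u2])) = ennreal ((u1 - l1) * (u2 - l2))"
    by (subst emeasure_lborel_box[OF le2]) (simp_all add: B2 ne inner_axis)
  then show "emeasure (distr lborel borel (\<lambda>v::real^2. (v$1, v$2))) (box l u) = ennreal (\<Prod>b\<in>Basis. (u - l) \<bullet> b)"
    using m unfolding lu
    by (simp add: emeasure_distr pre B1)
qed simp

lemma chart2_continuous: "continuous_on S chart2"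
proof -
  have c: "continuous_on UNIV chart"
    by (intro continuous_at_imp_continuous_on ballI has_derivative_continuous[OF chart_has_derivative])
  show ?thesis unfolding chart2_def
    by (rule continuous_on_compose2[OF c]) (auto intro!: continuous_intros)
qed

lemma chart2_measurable [measurable]: "chart2 \<in> borel_measurable borel"
  by (rule borel_measurable_continuous_onI[OF chart2_continuous])

lemma dens_measurable [measurable]: "dens \<in> borel_measurable borel"
  unfolding dens_def by measurable

lemma dens_pos: "dens v > 0"
proof -
  have "1 + (norm v)\<^sup>2 > 0" by (simp add: add_pos_nonneg)
  then show ?thesis unfolding dens_def by simp
qed

lemma area_measure_eq: "area_measure = distr (density lborel (\<lambda>v. ennreal (dens v))) borel chart2"
proof -
  have m: "(\<lambda>v::real^2. (v$1, v$2)) \<in> borel_measurable borel"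
    by (intro borel_measurable_continuous_onI continuous_intros)
  have c: "chart \<in> borel_measurable borel"
    by (intro borel_measurable_continuous_onI continuous_at_imp_continuous_on ballI has_derivative_continuous[OF chart_has_derivative])
  have n: "norm (v$1, v$2) = norm v" for v :: "real^2"
    by (simp add: norm_Pair norm_vec_def L2_set_def sum_2)
  have "density (distr lborel borel (\<lambda>v::real^2. (v$1, v$2))) (\<lambda>z. ennreal (2 / (1 + (norm z)\<^sup>2)\<^sup>2)) =
      distr (density lborel (\<lambda>v. ennreal (dens v))) borel (\<lambda>v. (v$1, v$2))"
    using m by (subst density_distr) (auto simp: dens_def n)
  then show ?thesis
    unfolding area_measure_def lborel_prod_real2 using m c
    by (simp add: distr_distr chart2_def[abs_def] o_def)
qed

lemma chart2_bij: "bij_betw chart2 UNIV (S2 - {vector [0, 0, - (1/2)]})"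
proof -
  have "bij_betw (\<lambda>v::real^2. (v$1, v$2)) UNIV UNIV"
    by (rule bij_betw_byWitness[where f' = "\<lambda>z. vector [fst z, snd z]"]) (auto simp: vec_eq_iff forall_2)
  from bij_betw_trans[OF this chart_bij] show ?thesis
    by (simp add: o_def chart2_def[abs_def])
qed

lemma chart2_S2: "chart2 v \<in> S2" and chart2_ne: "chart2 v \<noteq> vector [0, 0, - (1/2)]"
  using bij_betw_apply[OF chart2_bij, of v] by auto

lemma unchart_chart2: "unchart (chart2 v) = v"
  using chart_denominator_pos[of "v$1" "v$2"]
  by (simp add: unchart_def chart2_def chart_nth vec_eq_iff forall_2 less_imp_neq[symmetric])

lemma chart2_unchart: "x \<in> S2 \<Longrightarrow> x \<noteq> vector [0, 0, - (1/2)] \<Longrightarrow> chart2 (unchart x) = x"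
  using bij_betw_imp_surj_on[OF chart2_bij] unchart_chart2 by (metis (no_types) DiffI imageE singletonD)

lemma third_coordinate_ne: "x \<in> S2 \<Longrightarrow> x \<noteq> vector [0, 0, - (1/2)] \<Longrightarrow> x$3 + 1/2 \<noteq> 0"
proof
  assume x: "x \<in> S2" "x \<noteq> vector [0, 0, - (1/2)]" "x$3 + 1/2 = 0"
  have "(x$1)\<^sup>2 + (x$2)\<^sup>2 = 0" using x(1,3) unfolding S2_iff by algebra
  then have "x$1 = 0" "x$2 = 0" by (simp_all add: sum_power2_eq_zero_iff)
  then show False using x by (simp add: vec_eq_iff forall_3 eq_neg_iff_add_eq_0)
qed

definition chart2_deriv :: "real^2 \<Rightarrow> real^2 \<Rightarrow> real^3" where
  "chart2_deriv v h = chart_deriv (v$1, v$2) (h$1, h$2)"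

lemma chart2_has_derivative: "(chart2 has_derivative chart2_deriv v) (at v within S)"
proof -
  have "((\<lambda>v::real^2. (v$1, v$2)) has_derivative (\<lambda>h. (h$1, h$2))) (at v within S)"
    by (intro bounded_linear_imp_has_derivative) (auto intro!: bounded_linear_Pair bounded_linear_vec_nth)
  from has_derivative_compose[OF this chart_has_derivative] show ?thesis
    by (simp add: chart2_def[abs_def] chart2_deriv_def[abs_def])
qed

lemma area_form_chart2_deriv:
  "area_form (chart2 v) (chart2_deriv v (axis 1 1)) (chart2_deriv v (axis 2 1)) = dens v"
proof -
  have n: "norm (v$1, v$2) = norm v"
    by (simp add: norm_Pair norm_vec_def L2_set_def sum_2)
  show ?thesis
    using area_form_chart_deriv[of "(v$1, v$2)"]
    by (simp add: chart2_def chart2_deriv_def dens_def n axis_def)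
qed

lemma bilinear_area_form:
  "area_form x (a *\<^sub>R u + b *\<^sub>R v) (c *\<^sub>R u + d *\<^sub>R v) = (a * d - b * c) * area_form x u v"
  by (simp add: area_form_def inner_real3 cross3_nth algebra_simps)

lemma chart2_deriv_tangent: "chart2_deriv v h \<in> tangent (chart2 v)"
proof -
  have "((\<lambda>v. chart2 v \<bullet> chart2 v) has_derivative (\<lambda>h. chart2 v \<bullet> chart2_deriv v h + chart2_deriv v h \<bullet> chart2 v)) (at v)"
    by (intro has_derivative_inner chart2_has_derivative)
  moreover have "(\<lambda>v. chart2 v \<bullet> chart2 v) = (\<lambda>v. 1/4)"
    using chart2_S2 by (auto simp: fun_eq_iff S2_iff inner_real3 power2_eq_square)
  moreover have "((\<lambda>v::real^2. 1/4 :: real) has_derivative (\<lambda>h. 0)) (at v)"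
    by (rule has_derivative_const)
  ultimately have "(\<lambda>h. chart2 v \<bullet> chart2_deriv v h + chart2_deriv v h \<bullet> chart2 v) = (\<lambda>h. 0)"
    by (auto intro: has_derivative_unique)
  from fun_cong[OF this, of h] show ?thesis by (simp add: tangent_def inner_commute)
qed

lemma linear_chart2_deriv: "linear (chart2_deriv v)"
  using chart2_has_derivative has_derivative_linear by blast

lemma unchart_differentiable:
  assumes "y$3 + 1/2 \<noteq> 0"
  shows "unchart differentiable (at y)"
proof -
  have nth: "(\<lambda>y::real^3. y $ i) differentiable (at y)" for i
    by (rule bounded_linear_imp_differentiable) (rule bounded_linear_vec_nth)
  have "(\<lambda>y. unchart y $ i) differentiable (at y)" for i
    using exhaust_2[of i] assms unfolding unchart_def
    by (auto intro!: derivative_intros nth)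
  then show ?thesis
    unfolding differentiable_componentwise_within[of unchart]
    by (auto simp: Basis_vec_def inner_axis)
qed

lemma preserves_area_imp_continuous: "preserves_area f \<Longrightarrow> continuous_on S2 f"
  unfolding preserves_area_def continuous_on_eq_continuous_within
  using has_derivative_continuous by blast

text \<open>In the chart the area form is \<open>dens\<close> times the standard one, so
  preservation of the form is an equation for the Jacobian determinant. \<open>D\<close> removes the
  points sent to the pole that the chart misses. The derivative of \<open>f\<close> within the
  sphere suffices, because \<open>f\<close> is composed with a map into the sphere.\<close>

lemma preserves_area_jacobian:
  fixes f :: "real^3 \<Rightarrow> real^3"
  defines "D \<equiv> {v. f (chart2 v) \<noteq> vector [0, 0, - (1/2)]}"
  defines "G \<equiv> \<lambda>v. unchart (f (chart2 v))"
  assumes f: "f ` S2 \<subseteq> S2" "preserves_area f"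
    and v: "v \<in> D"
  shows "\<exists>G'. (G has_derivative G') (at v) \<and> \<bar>det (matrix G')\<bar> * dens (G v) = dens v"
proof -
  have "continuous_on UNIV (\<lambda>v. f (chart2 v))"
    by (rule continuous_on_compose2[OF preserves_area_imp_continuous[OF f(2)] chart2_continuous])
      (use chart2_S2 in auto)
  then have "open ((\<lambda>v. f (chart2 v)) -` (- {vector [0, 0, - (1/2)]}))"
    by (intro open_vimage) auto
  then have D: "open D" by (simp add: D_def vimage_def Collect_neg_eq)
  have fS: "f (chart2 v) \<in> S2" for v using f(1) chart2_S2 by auto
  obtain Df where Df: "(f has_derivative Df) (at (chart2 v) within S2)"
    and area: "\<And>u w. u \<in> tangent (chart2 v) \<Longrightarrow> w \<in> tangent (chart2 v) \<Longrightarrow>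
      area_form (f (chart2 v)) (Df u) (Df w) = area_form (chart2 v) u w"
    using f(2) chart2_S2[of v] unfolding preserves_area_def by blast
  have "(f has_derivative Df) (at (chart2 v) within chart2 ` UNIV)"
    by (rule has_derivative_subset[OF Df]) (use chart2_S2 in auto)
  from has_derivative_in_compose[OF chart2_has_derivative this]
  have h: "((\<lambda>v. f (chart2 v)) has_derivative (\<lambda>u. Df (chart2_deriv v u))) (at v)" .
  have "f (chart2 v) $ 3 + 1/2 \<noteq> 0"
    using third_coordinate_ne[OF fS] v unfolding D_def by simp
  then obtain U where U: "(unchart has_derivative U) (at (f (chart2 v)))"
    using unchart_differentiable unfolding differentiable_def by blast
  define G' where "G' u = U (Df (chart2_deriv v u))" for u
  have G': "(G has_derivative G') (at v)"
    unfolding G_def G'_def by (rule has_derivative_compose[OF h U])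
  \<comment> \<open>Comparing the two derivatives of \<open>chart2 o G = f o chart2\<close>
    expresses \<open>Df\<close> on tangent vectors through \<open>G'\<close>.\<close>
  have "((\<lambda>v. chart2 (G v)) has_derivative (\<lambda>u. chart2_deriv (G v) (G' u))) (at v)"
    by (rule has_derivative_compose[OF G' chart2_has_derivative])
  then have "((\<lambda>v. f (chart2 v)) has_derivative (\<lambda>u. chart2_deriv (G v) (G' u))) (at v)"
  proof (rule has_derivative_transform_within_open[OF _ D v])
    show "chart2 (G w) = f (chart2 w)" if "w \<in> D" for w
      using chart2_unchart[OF fS] that unfolding G_def D_def by simp
  qed
  from has_derivative_unique[OF h this]
  have eq: "Df (chart2_deriv v u) = chart2_deriv (G v) (G' u)" for u by (rule fun_cong)
  have lin: "chart2_deriv (G v) u = u$1 *\<^sub>R chart2_deriv (G v) (axis 1 1) + u$2 *\<^sub>R chart2_deriv (G v) (axis 2 1)" for u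
  proof -
    have "u = u$1 *\<^sub>R axis 1 1 + u$2 *\<^sub>R axis 2 1" by (simp add: vec_eq_iff forall_2 axis_def)
    then have "chart2_deriv (G v) u = chart2_deriv (G v) (u$1 *\<^sub>R axis 1 1 + u$2 *\<^sub>R axis 2 1)" by simp
    then show ?thesis by (simp only: linear_add[OF linear_chart2_deriv] linear_scale[OF linear_chart2_deriv])
  qed
  have "dens v = area_form (f (chart2 v)) (Df (chart2_deriv v (axis 1 1))) (Df (chart2_deriv v (axis 2 1)))"
    by (simp only: area[OF chart2_deriv_tangent chart2_deriv_tangent] area_form_chart2_deriv)
  also have "f (chart2 v) = chart2 (G v)"
    using chart2_unchart[OF fS] v unfolding G_def D_def by simp
  also have "area_form (chart2 (G v)) (Df (chart2_deriv v (axis 1 1))) (Df (chart2_deriv v (axis 2 1))) =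
     det (matrix G') * dens (G v)"
    unfolding eq lin[of "G' (axis 1 1)"] lin[of "G' (axis 2 1)"] bilinear_area_form area_form_chart2_deriv
    by (simp add: det_2 matrix_def)
  finally have e: "dens v = det (matrix G') * dens (G v)" .
  then have "det (matrix G') > 0"
    using dens_pos[of v] dens_pos[of "G v"] by (simp add: zero_less_mult_iff)
  with e G' show ?thesis by auto
qed

lemma nn_integral_area_measure:
  assumes [measurable]: "F \<in> borel_measurable borel"
  shows "(\<integral>\<^sup>+x. F x \<partial>area_measure) = (\<integral>\<^sup>+v. ennreal (dens v) * F (chart2 v) \<partial>lborel)"
  unfolding area_measure_eq by (simp add: nn_integral_distr nn_integral_density)

lemma sets_area_measure [measurable_cong, simp]: "sets area_measure = sets borel"
  by (simp add: area_measure_def)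

lemma space_area_measure [simp]: "space area_measure = UNIV"
  by (simp add: area_measure_def)

lemma S2_borel [measurable]: "S2 \<in> sets borel"
  by (simp add: S2_def borel_closed)

lemma AE_area_measure_S2: "AE x in area_measure. x \<in> S2"
  unfolding area_measure_eq by (simp add: AE_distr_iff chart2_S2)

lemma emeasure_area_measure_UNIV: "emeasure area_measure UNIV = ennreal (2 * pi)"
  by (subst emeasure_area_measure[symmetric], rule emeasure_eq_AE) (use AE_area_measure_S2 in auto)

lemma finite_area_measure: "finite_measure area_measure"
  by (rule finite_measureI) (simp add: emeasure_area_measure_UNIV)

interpretation area: finite_measure area_measure by (rule finite_area_measure)

lemma integrable_dens: "integrable lborel dens"
proof (rule integrableI_nonneg)
  have "(\<integral>\<^sup>+v. ennreal (dens v) \<partial>lborel) = emeasure area_measure UNIV"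
    using nn_integral_area_measure[of "\<lambda>_. 1"] by simp
  then show "(\<integral>\<^sup>+v. ennreal (dens v) \<partial>lborel) < \<infinity>"
    by (simp add: emeasure_area_measure_UNIV)
qed (use dens_pos in \<open>auto intro!: AE_I2 simp: less_imp_le\<close>)

lemma chart2_change_of_variables:
  fixes f :: "real^3 \<Rightarrow> real^3"
  assumes f: "bij_betw f S2 S2" "preserves_area f" and [measurable]: "f \<in> borel_measurable borel" "A \<in> sets borel"
  shows "(\<integral>v. dens v * indicator A (f (chart2 v)) \<partial>lborel) = (\<integral>v. dens v * indicator A (chart2 v) \<partial>lborel)"
proof -
  define D where "D = {v. f (chart2 v) \<noteq> vector [0, 0, - (1/2)]}"
  define G where "G v = unchart (f (chart2 v))" for v
  define a where "a w = (dens w * indicator A (chart2 w) :: real)" for w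
  define b where "b w = (dens w * indicator A (f (chart2 w)) :: real)" for w
  have f_im: "f ` S2 = S2" and f_inj: "inj_on f S2" using f(1) by (auto simp: bij_betw_def)
  have fS: "f (chart2 v) \<in> S2" for v using f_im chart2_S2 by auto
  have cG: "chart2 (G v) = f (chart2 v)" if "v \<in> D" for v
    using chart2_unchart[OF fS] that unfolding G_def D_def by simp
  have "\<exists>G'. (G has_derivative G') (at v) \<and> \<bar>det (matrix G')\<bar> * dens (G v) = dens v" if "v \<in> D" for v
    unfolding G_def[abs_def] by (rule preserves_area_jacobian) (use f_im f(2) that D_def in auto)
  then obtain G' where G': "\<And>v. v \<in> D \<Longrightarrow> (G has_derivative G' v) (at v)"
    and det: "\<And>v. v \<in> D \<Longrightarrow> \<bar>det (matrix (G' v))\<bar> * dens (G v) = dens v"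
    by metis
  have inj: "inj_on G D"
  proof (rule inj_onI)
    fix v w assume "v \<in> D" "w \<in> D" "G v = G w"
    then have "f (chart2 v) = f (chart2 w)" using cG by metis
    then have "chart2 v = chart2 w" using f_inj chart2_S2 by (metis inj_onD)
    then show "v = w" using unchart_chart2 by metis
  qed
  have D_meas: "D \<in> sets borel"
  proof -
    have "{v \<in> space borel. f (chart2 v) \<in> - {vector [0, 0, - (1/2)]}} \<in> sets borel" by measurable
    then show ?thesis by (simp add: D_def)
  qed
  have negD: "negligible (UNIV - D)"
  proof -
    obtain s where s: "s \<in> S2" "f s = vector [0, 0, - (1/2)]"
    proof -
      have "vector [0, 0, - (1/2)] \<in> S2" by (simp add: S2_iff power2_eq_square)
      then show ?thesis using f_im that by (metis imageE)
    qed
    have "UNIV - D \<subseteq> {unchart s}"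
    proof
      fix v assume "v \<in> UNIV - D"
      then have "f (chart2 v) = f s" using s by (simp add: D_def)
      then have "chart2 v = s" using f_inj chart2_S2 s by (metis inj_onD)
      then show "v \<in> {unchart s}" using unchart_chart2[of v] by simp
    qed
    then show ?thesis by (meson negligible_sing negligible_subset)
  qed
  have negGD: "negligible (UNIV - G ` D)"
  proof -
    have "UNIV - G ` D \<subseteq> {unchart (f (vector [0, 0, - (1/2)]))}"
    proof
      fix w assume w: "w \<in> UNIV - G ` D"
      obtain x where x: "x \<in> S2" "f x = chart2 w" using f_im chart2_S2 by (metis imageE)
      have "x = vector [0, 0, - (1/2)]"
      proof (rule ccontr)
        assume ne: "x \<noteq> vector [0, 0, - (1/2)]"
        have "unchart x \<in> D" using chart2_unchart[OF x(1) ne] x chart2_ne by (simp add: D_def)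
        moreover have "G (unchart x) = w" using chart2_unchart[OF x(1) ne] x unchart_chart2 by (simp add: G_def)
        ultimately show False using w by blast
      qed
      then show "w \<in> {unchart (f (vector [0, 0, - (1/2)]))}" using x unchart_chart2 by simp
    qed
    then show ?thesis by (meson negligible_sing negligible_subset)
  qed
  have int_a: "integrable lborel a" unfolding a_def
    by (rule Bochner_Integration.integrable_bound[OF integrable_dens])
      (auto simp: indicator_def less_imp_le[OF dens_pos] intro!: AE_I2)
  have int_b: "integrable lborel b" unfolding b_def
    by (rule Bochner_Integration.integrable_bound[OF integrable_dens])
      (auto simp: indicator_def less_imp_le[OF dens_pos] intro!: AE_I2)
  \<comment> \<open>The change of variables theorem speaks of functions with values in
    \<open>real^n\<close>; scalars are wrapped into \<open>real^1\<close>.\<close>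
  have vec: "bounded_linear (vec :: real \<Rightarrow> real^1)"
    by (simp add: linear_vec linear_conv_bounded_linear[symmetric])
  have bv: "(\<lambda>v. vec (b v) :: real^1) absolutely_integrable_on UNIV"
    using integrable_bounded_linear[OF vec int_b]
    by (simp add: set_integrable_def integrable_completion)
  then have bD: "(\<lambda>v. vec (b v) :: real^1) absolutely_integrable_on D"
    by (rule set_integrable_subset) (use D_meas in auto)
  have eq: "(vec (b v) :: real^1) = \<bar>det (matrix (G' v))\<bar> *\<^sub>R vec (a (G v))" if "v \<in> D" for v
  proof -
    have "b v = \<bar>det (matrix (G' v))\<bar> * a (G v)"
      unfolding a_def b_def cG[OF that] mult.assoc[symmetric] det[OF that] ..
    then show ?thesis by (simp add: vec_eq_iff)
  qed
  have "(\<lambda>v. \<bar>det (matrix (G' v))\<bar> *\<^sub>R (vec (a (G v)) :: real^1)) absolutely_integrable_on D"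
    using bD by (subst set_integrable_cong[OF refl refl eq[symmetric]])
  then have "integral (G ` D) (\<lambda>w. vec (a w) :: real^1) =
      integral D (\<lambda>v. \<bar>det (matrix (G' v))\<bar> *\<^sub>R (vec (a (G v)) :: real^1))"
    using has_absolute_integral_change_of_variables[of D G G' "\<lambda>w. vec (a w) :: real^1"] D_meas G' inj
    by (auto intro: has_derivative_at_withinI)
  also have "\<dots> = integral D (\<lambda>v. vec (b v) :: real^1)"
    by (rule integral_cong) (simp add: eq)
  finally have "integral UNIV (\<lambda>w. vec (a w) :: real^1) = integral UNIV (\<lambda>v. vec (b v) :: real^1)"
    using integral_subset_negligible[OF subset_UNIV negD] integral_subset_negligible[OF subset_UNIV negGD] by metis
  then have "(\<integral>w. (vec (a w) :: real^1) \<partial>lborel) = (\<integral>w. vec (b w) \<partial>lborel)"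
    using integral_lborel[OF integrable_bounded_linear[OF vec int_a]]
      integral_lborel[OF integrable_bounded_linear[OF vec int_b]] by metis
  then have "(vec (\<integral>w. a w \<partial>lborel) :: real^1) = vec (\<integral>w. b w \<partial>lborel)"
    using integral_bounded_linear[OF vec int_a] integral_bounded_linear[OF vec int_b] by metis
  then show ?thesis by (simp add: vec_eq_iff a_def b_def)
qed

theorem distr_area_measure:
  fixes f :: "real^3 \<Rightarrow> real^3"
  assumes f: "bij_betw f S2 S2" "preserves_area f" and [measurable]: "f \<in> borel_measurable borel"
  shows "distr area_measure borel f = area_measure"
proof (rule measure_eqI)
  fix A assume "A \<in> sets (distr area_measure borel f)"
  then have A [measurable]: "A \<in> sets borel" by simp
  have int: "integrable lborel (\<lambda>v. dens v * indicator A (g (chart2 v)))" if [measurable]: "g \<in> borel_measurable borel" for g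
    by (rule Bochner_Integration.integrable_bound[OF integrable_dens])
      (auto simp: indicator_def less_imp_le[OF dens_pos] intro!: AE_I2)
  have em: "(\<integral>\<^sup>+x. indicator A (g x) \<partial>area_measure) = ennreal (\<integral>v. dens v * indicator A (g (chart2 v)) \<partial>lborel)"
    if [measurable]: "g \<in> borel_measurable borel" for g
  proof -
    have "(\<integral>\<^sup>+x. indicator A (g x) \<partial>area_measure) = (\<integral>\<^sup>+v. ennreal (dens v * indicator A (g (chart2 v))) \<partial>lborel)"
      by (subst nn_integral_area_measure) (auto intro!: nn_integral_cong simp: indicator_def)
    also have "\<dots> = ennreal (\<integral>v. dens v * indicator A (g (chart2 v)) \<partial>lborel)"
      by (rule nn_integral_eq_integral[OF int]) (auto simp: less_imp_le[OF dens_pos])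
    finally show ?thesis .
  qed
  have "emeasure (distr area_measure borel f) A = (\<integral>\<^sup>+x. indicator A x \<partial>distr area_measure borel f)"
    by simp
  also have "\<dots> = (\<integral>\<^sup>+x. indicator A (f x) \<partial>area_measure)"
    by (subst nn_integral_distr) auto
  also have "\<dots> = (\<integral>\<^sup>+x. indicator A x \<partial>area_measure)"
    using em[of f] em[of "\<lambda>x. x"] chart2_change_of_variables[OF f] by simp
  also have "\<dots> = emeasure area_measure A" by simp
  finally show "emeasure (distr area_measure borel f) A = emeasure area_measure A" .
qed simp

section \<open>The kernel \<open>1 / |x - y|\<close>\<close>

text \<open>The pulled back kernel at the pole is bounded by a product of two functions of one variable,
  each with the antiderivative \<open>2 sqrt (a / (1 + a))\<close>. Division by zero makes \<open>kern 0 = 0\<close>.\<close>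

definition kern :: "real \<Rightarrow> real" where
  "kern a = 1 / (sqrt a * ((1 + a) * sqrt (1 + a)))"

lemma kern_nonneg: "0 \<le> a \<Longrightarrow> 0 \<le> kern a"
  by (simp add: kern_def)

lemma kern_measurable [measurable]: "kern \<in> borel_measurable borel"
  unfolding kern_def by measurable

lemma kern_integral_finite: "(\<integral>\<^sup>+a. ennreal (indicator {0<..} a * kern a) \<partial>lborel) < \<infinity>"
proof -
  define F where "F a = 2 * sqrt (a / (1 + a))" for a :: real
  have deriv: "DERIV F a :> kern a" if "a > 0" for a
  proof -
    define s t where "s = sqrt a" and "t = sqrt (1 + a)"
    have st: "s > 0" "t > 0" "a = s\<^sup>2" "1 + a = t\<^sup>2" using that by (simp_all add: s_def t_def)
    have "((\<lambda>a. a / (1 + a)) has_real_derivative (1 * (1 + a) - a * 1) / ((1 + a) * (1 + a))) (at a)"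
      using that by (intro derivative_eq_intros refl | simp)+
    moreover have "a / (1 + a) > 0" using that by simp
    ultimately have "DERIV F a :> 2 * (inverse (sqrt (a / (1 + a))) / 2 * ((1 * (1 + a) - a * 1) / ((1 + a) * (1 + a))))"
      unfolding F_def
      by (intro DERIV_cmult DERIV_chain2[OF DERIV_real_sqrt]) auto
    also have "2 * (inverse (sqrt (a / (1 + a))) / 2 * ((1 * (1 + a) - a * 1) / ((1 + a) * (1 + a)))) = kern a"
    proof -
      have "sqrt (a / (1 + a)) = s / t" by (simp add: real_sqrt_divide s_def t_def)
      then have "2 * (inverse (sqrt (a / (1 + a))) / 2 * ((1 * (1 + a) - a * 1) / ((1 + a) * (1 + a)))) = t / s * (1 / (t\<^sup>2 * t\<^sup>2))"
        by (simp add: st(4)[symmetric])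
      also have "\<dots> = 1 / (s * (t\<^sup>2 * t))" using st(1,2) by (simp add: field_simps power2_eq_square)
      also have "\<dots> = kern a" unfolding kern_def s_def[symmetric] t_def[symmetric] by (simp add: st(4))
      finally show ?thesis .
    qed
    finally show ?thesis .
  qed
  have cont: "isCont kern a" if "a > 0" for a
    unfolding kern_def using that by (intro continuous_intros) auto
  have nonneg: "kern a \<ge> 0" if "a > 0" for a using that by (simp add: kern_def)
  have lim: "(F \<longlongrightarrow> 2) at_top" "(F \<longlongrightarrow> 0) (at_right 0)"
    unfolding F_def by real_asymp+
  have *: "((F \<circ> real_of_ereal) \<longlongrightarrow> 0) (at_right (ereal 0))" "((F \<circ> real_of_ereal) \<longlongrightarrow> 2) (at_left \<infinity>)"
    using lim by (simp_all add: ereal_tendsto_simps)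
  have "set_integrable lborel (einterval (ereal 0) \<infinity>) kern"
    by (rule interval_integral_FTC_nonneg(1)[where F = F, OF _ _ _ _ *]) (auto simp: deriv cont nonneg)
  moreover have "einterval (ereal 0) \<infinity> = {0<..}" by (auto simp: einterval_def)
  ultimately have "integrable lborel (\<lambda>a. indicator {0<..} a * kern a)"
    by (simp add: set_integrable_def)
  then have "(\<integral>\<^sup>+a. ennreal (norm (indicator {0<..} a * kern a)) \<partial>lborel) < \<infinity>"
    by (simp add: integrable_iff_bounded)
  also have "(\<lambda>a. norm (indicator {0<..} a * kern a)) = (\<lambda>a. indicator {0<..} a * kern a)"
    using nonneg by (auto simp: fun_eq_iff indicator_def)
  finally show ?thesis .
qed

lemma kern_abs_integral_finite: "(\<integral>\<^sup>+a. ennreal (kern \<bar>a\<bar>) \<partial>lborel) < \<infinity>"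
proof -
  let ?I = "\<lambda>a. ennreal (indicator {0<..} a * kern a)"
  have "(\<integral>\<^sup>+a. ?I a \<partial>lborel) = ennreal \<bar>-1\<bar> * (\<integral>\<^sup>+a. ?I (0 + (-1) * a) \<partial>lborel)"
    by (rule nn_integral_real_affine) auto
  then have refl: "(\<integral>\<^sup>+a. ?I (- a) \<partial>lborel) = (\<integral>\<^sup>+a. ?I a \<partial>lborel)" by simp
  have "(\<integral>\<^sup>+a. ennreal (kern \<bar>a\<bar>) \<partial>lborel) = (\<integral>\<^sup>+a. ?I a + ?I (- a) \<partial>lborel)"
    by (rule nn_integral_cong) (auto simp: indicator_def kern_def)
  also have "\<dots> = (\<integral>\<^sup>+a. ?I a \<partial>lborel) + (\<integral>\<^sup>+a. ?I (- a) \<partial>lborel)"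
    by (rule nn_integral_add) auto
  also have "\<dots> < \<infinity>" using kern_integral_finite by (simp add: refl)
  finally show ?thesis .
qed

text \<open>With \<open>r = |(a, b)|\<close> and \<open>w = 1 + r^2\<close> the left side is
  \<open>2 / (r w^(3/2))\<close>. The inequalities \<open>|a| |b| <= r^2\<close> and
  \<open>(1 + |a|) (1 + |b|) <= 2 w\<close> separate the variables.\<close>

lemma pole_kernel_bound:
  fixes a b :: real
  assumes ab: "a \<noteq> 0" "b \<noteq> 0"
  shows "2 / (1 + (norm (a, b))\<^sup>2)\<^sup>2 * (1 / norm (vector [0, 0, 1/2] - chart (a, b))) \<le> 8 * (kern \<bar>a\<bar> * kern \<bar>b\<bar>)"
proof -
  define r w where "r = norm (a, b)" and "w = 1 + r\<^sup>2"
  have r2: "r\<^sup>2 = a\<^sup>2 + b\<^sup>2" by (simp add: r_def norm_Pair)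
  have r: "r > 0" using ab by (simp add: r_def zero_prod_def)
  have w: "w > 0" by (simp add: w_def add_pos_nonneg)
  have wab: "1 + a\<^sup>2 + b\<^sup>2 = w" by (simp add: w_def r2)
  have "(norm (vector [0, 0, 1/2] - chart (a, b)))\<^sup>2 = r\<^sup>2 / w"
  proof -
    have "(norm (vector [0, 0, 1/2] - chart (a, b)))\<^sup>2 = (a\<^sup>2 + b\<^sup>2) / w\<^sup>2 + (1 - 1 / w)\<^sup>2"
      by (simp add: norm_sq_real3 chart_nth wab power_divide add_divide_distrib)
    also have "\<dots> = r\<^sup>2 / w\<^sup>2 + ((w - 1) / w)\<^sup>2" using w by (simp add: r2 diff_divide_distrib)
    also have "\<dots> = r\<^sup>2 * (1 + r\<^sup>2) / w\<^sup>2"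
      by (simp add: w_def power_divide add_divide_distrib[symmetric] power2_eq_square algebra_simps)
    also have "\<dots> = r\<^sup>2 / w" unfolding w_def[symmetric] using w by (simp add: power2_eq_square)
    finally show ?thesis .
  qed
  then have n: "norm (vector [0, 0, 1/2] - chart (a, b)) = r / sqrt w"
    using r by (metis abs_norm_cancel real_sqrt_abs real_sqrt_divide abs_of_pos)
  define P Q where "P = (1 + \<bar>a\<bar>) * (1 + \<bar>b\<bar>)" and "Q = \<bar>a\<bar> * \<bar>b\<bar>"
  have PQ: "P > 0" "Q > 0" using ab by (simp_all add: P_def Q_def add_pos_nonneg)
  have "2 * P \<le> (1 + \<bar>a\<bar>)\<^sup>2 + (1 + \<bar>b\<bar>)\<^sup>2"
    using sum_squares_bound[of "1 + \<bar>a\<bar>" "1 + \<bar>b\<bar>"] unfolding P_def by (simp only: mult.assoc)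
  also have "\<dots> \<le> 2 * (1 + a\<^sup>2) + 2 * (1 + b\<^sup>2)"
    using sum_squares_bound[of 1 "\<bar>a\<bar>"] sum_squares_bound[of 1 "\<bar>b\<bar>"] by (simp add: power2_eq_square algebra_simps)
  also have "\<dots> \<le> 4 * w" by (simp add: wab[symmetric])
  finally have P: "P \<le> 2 * w" by simp
  have Q: "Q \<le> r\<^sup>2" using sum_squares_bound[of "\<bar>a\<bar>" "\<bar>b\<bar>"] PQ by (simp add: r2 Q_def)
  have "sqrt Q \<le> r" using Q r by (simp add: real_le_lsqrt)
  \<comment> \<open>Under the root \<open>2 w\<close> is weakened to \<open>4 w\<close>, which makes
    the constant rational and is the origin of the factor 8 in the claim.\<close>
  moreover have "P * sqrt P \<le> 4 * (w * sqrt w)"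
  proof -
    have "P * sqrt P \<le> (2 * w) * sqrt (4 * w)" using P PQ w by (intro mult_mono) auto
    then show ?thesis by (simp add: real_sqrt_mult)
  qed
  ultimately have "sqrt Q * (P * sqrt P) \<le> r * (4 * (w * sqrt w))"
    by (rule mult_mono) (use r PQ in auto)
  then have "1 / (r * (4 * (w * sqrt w))) \<le> 1 / (sqrt Q * (P * sqrt P))"
    using PQ r w by (intro divide_left_mono) auto
  also have "\<dots> = kern \<bar>a\<bar> * kern \<bar>b\<bar>"
    by (simp add: kern_def P_def Q_def real_sqrt_mult)
  finally have k: "1 / (r * (4 * (w * sqrt w))) \<le> kern \<bar>a\<bar> * kern \<bar>b\<bar>" .
  have sw: "sqrt w * sqrt w = w" "sqrt w > 0" using w by simp_all
  have eq8: "2 / w\<^sup>2 * (1 / (r / sqrt w)) = 8 * (1 / (r * (4 * (w * sqrt w))))"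
  proof -
    have "2 / w\<^sup>2 * (1 / (r / sqrt w)) = 2 * sqrt w / (w * (sqrt w * sqrt w) * r)"
      using w by (simp add: power2_eq_square)
    also have "\<dots> = 8 * (1 / (r * (4 * (w * sqrt w))))" using sw(2) w r by (simp add: field_simps)
    finally show ?thesis .
  qed
  show ?thesis unfolding n r_def[symmetric] w_def[symmetric] eq8 by (intro mult_left_mono k) simp
qed

definition pole_const :: ennreal where
  "pole_const = (\<integral>\<^sup>+y. ennreal (1 / norm (vector [0, 0, 1/2] - y)) \<partial>area_measure)"

lemma pole_const_finite: "pole_const < \<infinity>"
proof -
  have c [measurable]: "chart \<in> borel_measurable borel"
    by (intro borel_measurable_continuous_onI continuous_at_imp_continuous_on ballI has_derivative_continuous[OF chart_has_derivative])
  let ?F = "\<lambda>z. ennreal (2 / (1 + (norm z)\<^sup>2)\<^sup>2) * ennreal (1 / norm (vector [0, 0, 1/2] - chart z))"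
  have "pole_const = (\<integral>\<^sup>+z. ?F z \<partial>lborel)"
    unfolding pole_const_def area_measure_def by (simp add: nn_integral_distr nn_integral_density)
  also have "\<dots> = (\<integral>\<^sup>+a. \<integral>\<^sup>+b. ?F (a, b) \<partial>lborel \<partial>lborel)"
    by (subst lborel_prod[symmetric], rule lborel.nn_integral_fst[symmetric]) (simp add: lborel_prod)
  also have "\<dots> \<le> (\<integral>\<^sup>+a. \<integral>\<^sup>+b. 8 * (ennreal (kern \<bar>a\<bar>) * ennreal (kern \<bar>b\<bar>)) \<partial>lborel \<partial>lborel)"
  proof (rule nn_integral_mono_AE)
    \<comment> \<open>Since \<open>kern 0 = 0\<close>, the pointwise bound is available off the
      coordinate axes, a null set.\<close>
    show "AE a in lborel. (\<integral>\<^sup>+b. ?F (a, b) \<partial>lborel) \<le> (\<integral>\<^sup>+b. 8 * (ennreal (kern \<bar>a\<bar>) * ennreal (kern \<bar>b\<bar>)) \<partial>lborel)"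
      using AE_lborel_singleton[of "0::real"]
    proof eventually_elim
      case (elim a)
      show ?case
      proof (rule nn_integral_mono_AE)
        show "AE b in lborel. ?F (a, b) \<le> 8 * (ennreal (kern \<bar>a\<bar>) * ennreal (kern \<bar>b\<bar>))"
          using AE_lborel_singleton[of "0::real"]
        proof eventually_elim
          case (elim b)
          have "?F (a, b) = ennreal (2 / (1 + (norm (a, b))\<^sup>2)\<^sup>2 * (1 / norm (vector [0, 0, 1/2] - chart (a, b))))"
            by (rule ennreal_mult[symmetric]) auto
          also have "\<dots> \<le> ennreal (8 * (kern \<bar>a\<bar> * kern \<bar>b\<bar>))"
            by (rule ennreal_leI) (rule pole_kernel_bound; use \<open>a \<noteq> 0\<close> elim in simp)
          also have "\<dots> = 8 * (ennreal (kern \<bar>a\<bar>) * ennreal (kern \<bar>b\<bar>))"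
            by (simp add: ennreal_mult kern_nonneg)
          finally show ?case .
        qed
      qed
    qed
  qed
  also have "\<dots> = 8 * ((\<integral>\<^sup>+a. ennreal (kern \<bar>a\<bar>) \<partial>lborel) * (\<integral>\<^sup>+a. ennreal (kern \<bar>a\<bar>) \<partial>lborel))"
    by (simp add: nn_integral_cmult nn_integral_multc)
  also have "\<dots> < \<infinity>"
    using kern_abs_integral_finite by (simp add: ennreal_mult_less_top)
  finally show ?thesis .
qed

text \<open>The determinant enters through the cross product, which rotations respect and
  reflections reverse.\<close>

lemma rotation_preserves_area:
  fixes f :: "real^3 \<Rightarrow> real^3"
  assumes f: "orthogonal_transformation f" "det (matrix f) = 1"
  shows "bij_betw f S2 S2" "preserves_area f" "f \<in> borel_measurable borel"
proof -
  have lin: "linear f" and bl: "bounded_linear f"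
    using f by (auto simp: orthogonal_transformation_linear linear_conv_bounded_linear[symmetric])
  have n: "norm (f x) = norm x" for x using f orthogonal_transformation_norm by blast
  show "bij_betw f S2 S2"
  proof (rule bij_betw_imageI)
    show "inj_on f S2"
      using orthogonal_transformation_inj[OF f(1)] by (rule inj_on_subset) simp
    show "f ` S2 = S2"
    proof
      show "S2 \<subseteq> f ` S2"
      proof
        fix y assume "y \<in> S2"
        moreover obtain x where "y = f x" using orthogonal_transformation_surj[OF f(1)] by (auto simp: surj_def)
        ultimately show "y \<in> f ` S2" using n by (auto simp: S2_def)
      qed
    qed (use n in \<open>auto simp: S2_def\<close>)
  qed
  show "preserves_area f"
    unfolding preserves_area_def area_form_def
  proof (intro ballI exI conjI)
    fix x show "(f has_derivative f) (at x within S2)" by (rule bounded_linear_imp_has_derivative[OF bl])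
    fix u v
    show "4 * (f x \<bullet> cross3 (f u) (f v)) = 4 * (x \<bullet> cross3 u v)"
      using f by (simp add: cross_orthogonal_transformation orthogonal_transformation_def)
  qed
  show "f \<in> borel_measurable borel"
    by (intro borel_measurable_continuous_onI linear_continuous_on bl)
qed

text \<open>A rotation takes \<open>x\<close> to the pole and preserves the measure. Having one
  constant for all \<open>x\<close> is what lets the kernel be integrated out.\<close>

theorem kernel_const:
  assumes x: "x \<in> S2"
  shows "(\<integral>\<^sup>+y. ennreal (1 / norm (x - y)) \<partial>area_measure) = pole_const"
proof -
  have "norm x = norm (vector [0, 0, 1/2] :: real^3)"
    using x by (simp add: S2_def norm_real3)
  then obtain f where f: "orthogonal_transformation f" "det (matrix f) = 1" "f x = vector [0, 0, 1/2]"
    using rotation_exists[of x "vector [0, 0, 1/2]"] by auto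
  note r = rotation_preserves_area[OF f(1,2)]
  have [measurable]: "f \<in> borel_measurable borel" by fact
  have "norm (x - y) = norm (vector [0, 0, 1/2] - f y)" for y
    using f by (metis orthogonal_transformation_linear orthogonal_transformation_norm linear_diff)
  then have "(\<integral>\<^sup>+y. ennreal (1 / norm (x - y)) \<partial>area_measure) =
      (\<integral>\<^sup>+y. ennreal (1 / norm (vector [0, 0, 1/2] - f y)) \<partial>area_measure)" by simp
  also have "\<dots> = (\<integral>\<^sup>+y. ennreal (1 / norm (vector [0, 0, 1/2] - y)) \<partial>distr area_measure borel f)"
    by (subst nn_integral_distr) auto
  also have "\<dots> = pole_const" unfolding distr_area_measure[OF r] pole_const_def ..
  finally show ?thesis .
qed

section \<open>Isotopies and their \<open>L\<^sup>p\<close>-length\<close>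

text \<open>Replacing \<open>y\<close> by \<open>y - x\<close> in \<open>y . (x cross X)\<close>
  changes nothing and gains a factor \<open>|x - y|\<close> over the obvious estimate;
  \<open>|x| = 1/2\<close> absorbs the factor 2. What remains has the singularity
  \<open>1 / |x - y|\<close>, integrable on a surface. For \<open>x = y\<close> both sides are 0 by
  division by zero.\<close>

lemma abs_rate_le:
  assumes "x \<in> S2" "y \<in> S2"
  shows "\<bar>rate x X y Y\<bar> \<le> (norm X + norm Y) / norm (x - y)"
proof (cases "x = y")
  case False
  have n: "norm x = 1/2" "norm y = 1/2" using assms by (simp_all add: S2_def)
  have tri: "\<bar>b \<bullet> cross3 a A\<bar> \<le> norm (a - b) * (norm A / 2)" if "norm a = 1/2" for a b A :: "real^3"
  proof -
    have "b \<bullet> cross3 a A = (b - a) \<bullet> cross3 a A" by (simp add: inner_diff_left dot_cross_self)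
    also have "\<bar>\<dots>\<bar> \<le> norm (b - a) * norm (cross3 a A)" by (rule Cauchy_Schwarz_ineq2)
    also have "norm (cross3 a A) \<le> norm a * norm A"
    proof (rule power2_le_imp_le)
      show "(norm (cross3 a A))\<^sup>2 \<le> (norm a * norm A)\<^sup>2"
        using norm_cross[of a A] by (simp add: power_mult_distrib)
    qed simp
    finally show ?thesis using that by (simp add: mult_left_mono norm_minus_commute)
  qed
  have "\<bar>2 * (y \<bullet> cross3 x X + x \<bullet> cross3 y Y)\<bar> \<le> 2 * (norm (x - y) * (norm X / 2) + norm (y - x) * (norm Y / 2))"
    using add_mono[OF tri[OF n(1), of y X] tri[OF n(2), of x Y]]
      abs_triangle_ineq[of "y \<bullet> cross3 x X" "x \<bullet> cross3 y Y"]
    by (simp only: abs_mult abs_numeral mult_le_cancel_left_pos zero_less_numeral)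
  also have "\<dots> = norm (x - y) * (norm X + norm Y)"
    by (simp add: norm_minus_commute algebra_simps)
  finally have "\<bar>2 * (y \<bullet> cross3 x X + x \<bullet> cross3 y Y)\<bar> \<le> norm (x - y) * (norm X + norm Y)" .
  then show ?thesis using False unfolding rate_def abs_divide
    by (simp add: divide_simps power2_eq_square mult.commute mult.left_commute)
qed (simp add: rate_def)

locale area_isotopy = c1_isotopy +
  assumes measurable_map [measurable]: "t \<in> {0..1} \<Longrightarrow> \<phi> t \<in> borel_measurable borel"
    and distr_map: "t \<in> {0..1} \<Longrightarrow> distr area_measure borel (\<phi> t) = area_measure"
    and continuous_inv: "t \<in> {0..1} \<Longrightarrow> continuous_on S2 (inv_into S2 (\<phi> t))"
    and surj: "t \<in> {0..1} \<Longrightarrow> \<phi> t ` S2 = S2"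
begin

text \<open>The indicator cuts off times and points where \<open>\<phi>\<close> is arbitrary, so the
  function is jointly measurable on the whole space.\<close>

definition strain :: "real \<Rightarrow> real^3 \<Rightarrow> real^3 \<Rightarrow> real" where
  "strain t x y = indicator {(t, x, y). t \<in> {0..1} \<and> x \<in> S2 \<and> y \<in> S2 \<and> x \<noteq> y} (t, x, y) *
    ((norm (vel \<phi> t x) + norm (vel \<phi> t y)) / norm (\<phi> t x - \<phi> t y))"

text \<open>A majorant of \<open>|theta|\<close> with values in \<open>ennreal\<close>, so that
  integrals can be exchanged before finiteness is known.\<close>

definition total :: "real^3 \<Rightarrow> real^3 \<Rightarrow> ennreal" where
  "total x y = (\<integral>\<^sup>+t. ennreal (strain t x y) \<partial>lborel)"

definition speed :: "real \<Rightarrow> real^3 \<Rightarrow> real" where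
  "speed t x = indicator ({0..1} \<times> S2) (t, x) * norm (vel \<phi> t x)"

lemma strain_measurable: "(\<lambda>(t, x, y). strain t x y) \<in> borel_measurable (borel \<Otimes>\<^sub>M borel \<Otimes>\<^sub>M borel)"
proof -
  define A where "A = {(t::real, x::real^3, y::real^3). t \<in> {0..1} \<and> x \<in> S2 \<and> y \<in> S2 \<and> x \<noteq> y}"
  have "{z :: real \<times> (real^3) \<times> (real^3). fst (snd z) \<noteq> snd (snd z)} \<in> sets borel"
    by (intro borel_open open_Collect_neq continuous_intros)
  moreover have "{0..1} \<times> S2 \<times> S2 \<in> sets (borel :: (real \<times> (real^3) \<times> (real^3)) measure)"
    by (intro borel_closed closed_Times) (auto simp: S2_def)
  moreover have "A = ({0..1} \<times> S2 \<times> S2) \<inter> {z. fst (snd z) \<noteq> snd (snd z)}"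
    by (auto simp: A_def)
  ultimately have A: "A \<in> sets borel" by auto
  have "continuous_on A (\<lambda>z. (norm (vel \<phi> (fst z) (fst (snd z))) + norm (vel \<phi> (fst z) (snd (snd z)))) /
      norm (\<phi> (fst z) (fst (snd z)) - \<phi> (fst z) (snd (snd z))))"
    by (intro continuous_intros continuous_comp) (auto simp: A_def dest: distinct[rotated 3])
  from borel_measurable_continuous_on_indicator[OF A this]
  show ?thesis
    unfolding borel_prod strain_def A_def by (simp add: split_beta')
qed

lemma speed_measurable: "(\<lambda>(t, x). speed t x) \<in> borel_measurable (borel \<Otimes>\<^sub>M borel)"
proof -
  have A: "{0..1} \<times> S2 \<in> sets (borel :: (real \<times> (real^3)) measure)"
    by (intro borel_closed closed_Times) (auto simp: S2_def)
  have "continuous_on ({0..1} \<times> S2) (\<lambda>z. norm (vel \<phi> (fst z) (snd z)))"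
    by (intro continuous_intros continuous_comp) auto
  from borel_measurable_continuous_on_indicator[OF A this]
  show ?thesis
    unfolding borel_prod speed_def by (simp add: split_beta')
qed

lemma speed_nonneg: "0 \<le> speed t x" by (simp add: speed_def)

lemma speed_measurable' [measurable]:
  assumes [measurable]: "f \<in> M \<rightarrow>\<^sub>M borel" "g \<in> M \<rightarrow>\<^sub>M borel"
  shows "(\<lambda>z. speed (f z) (g z)) \<in> borel_measurable M"
  using measurable_compose[OF measurable_Pair[OF assms] speed_measurable] by simp

lemma strain_measurable' [measurable]:
  assumes [measurable]: "f \<in> M \<rightarrow>\<^sub>M borel" "g \<in> M \<rightarrow>\<^sub>M borel" "h \<in> M \<rightarrow>\<^sub>M borel"
  shows "(\<lambda>z. strain (f z) (g z) (h z)) \<in> borel_measurable M"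
  using measurable_compose[OF measurable_Pair[OF assms(1) measurable_Pair[OF assms(2,3)]] strain_measurable] by simp

lemma total_measurable [measurable]:
  assumes [measurable]: "g \<in> M \<rightarrow>\<^sub>M borel" "h \<in> M \<rightarrow>\<^sub>M borel"
  shows "(\<lambda>z. total (g z) (h z)) \<in> borel_measurable M"
  unfolding total_def by measurable

lemma abs_theta_le_total:
  assumes "x \<in> S2" "y \<in> S2" "x \<noteq> y"
  shows "ennreal \<bar>theta \<phi> x y\<bar> \<le> total x y"
proof -
  let ?R = "\<lambda>t. rate (\<phi> t x) (vel \<phi> t x) (\<phi> t y) (vel \<phi> t y)"
  have "continuous_on {0..1} ?R"
    by (rule continuous_rate) (use assms in \<open>auto intro!: continuous_intros\<close>)
  then have int: "set_integrable lborel {0..1} ?R"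
    unfolding set_integrable_def by (rule borel_integrable_compact[rotated]) simp
  have "theta \<phi> x y = (\<integral>t. indicator {0..1} t *\<^sub>R ?R t \<partial>lborel)"
    unfolding theta_def using set_borel_integral_eq_integral(2)[OF int] by (simp add: set_lebesgue_integral_def)
  then have "ennreal \<bar>theta \<phi> x y\<bar> \<le> (\<integral>\<^sup>+t. norm (indicator {0..1} t *\<^sub>R ?R t) \<partial>lborel)"
    using integral_norm_bound_ennreal[OF int[unfolded set_integrable_def]] by simp
  also have "\<dots> \<le> total x y"
    unfolding total_def
    by (intro nn_integral_mono ennreal_leI)
      (use assms abs_rate_le maps_to in \<open>auto simp: strain_def indicator_def\<close>)
  finally show ?thesis .
qed

lemma kernel_map:
  assumes t: "t \<in> {0..1}" and x: "x \<in> S2"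
  shows "(\<integral>\<^sup>+y. ennreal (1 / norm (\<phi> t x - \<phi> t y)) \<partial>area_measure) = pole_const"
proof -
  note [measurable] = measurable_map[OF t]
  have "(\<integral>\<^sup>+y. ennreal (1 / norm (\<phi> t x - \<phi> t y)) \<partial>area_measure) =
     (\<integral>\<^sup>+y. ennreal (1 / norm (\<phi> t x - y)) \<partial>distr area_measure borel (\<phi> t))"
    by (subst nn_integral_distr) auto
  then show ?thesis unfolding distr_map[OF t] using kernel_const maps_to t x by simp
qed

text \<open>Each summand pairs the speed of one point with the kernel. Integrating out the other
  point gives \<open>pole_const\<close>, because \<open>\<phi> t\<close> preserves area; the two
  summands are mirror images, whence the factor 2.\<close>

lemma strain_integral_le:
  assumes t: "t \<in> {0..1}"
  shows "(\<integral>\<^sup>+x. \<integral>\<^sup>+y. ennreal (strain t x y) \<partial>area_measure \<partial>area_measure) \<le>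
    2 * pole_const * (\<integral>\<^sup>+x. ennreal (speed t x) \<partial>area_measure)"
proof -
  note [measurable] = measurable_map[OF t]
  interpret P: pair_sigma_finite area_measure area_measure ..
  define a where "a x y = ennreal (speed t x) * ennreal (1 / norm (\<phi> t x - \<phi> t y))" for x y
  have a_meas: "(\<lambda>(x, y). a x y) \<in> borel_measurable (area_measure \<Otimes>\<^sub>M area_measure)"
    unfolding a_def by measurable
  have a_int: "(\<integral>\<^sup>+x. \<integral>\<^sup>+y. a x y \<partial>area_measure \<partial>area_measure) = pole_const * (\<integral>\<^sup>+x. ennreal (speed t x) \<partial>area_measure)"
  proof -
    have "(\<integral>\<^sup>+y. a x y \<partial>area_measure) = pole_const * ennreal (speed t x)" for x
    proof (cases "x \<in> S2")
      case True
      then show ?thesis unfolding a_def by (simp add: nn_integral_cmult kernel_map[OF t] mult.commute)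
    next
      case False then show ?thesis by (simp add: a_def speed_def)
    qed
    then show ?thesis by (simp add: nn_integral_cmult)
  qed
  have "(\<integral>\<^sup>+x. \<integral>\<^sup>+y. ennreal (strain t x y) \<partial>area_measure \<partial>area_measure) \<le>
      (\<integral>\<^sup>+x. \<integral>\<^sup>+y. a x y + a y x \<partial>area_measure \<partial>area_measure)"
  proof (intro nn_integral_mono)
    fix x y
    show "ennreal (strain t x y) \<le> a x y + a y x"
      using t by (auto simp: a_def strain_def speed_def indicator_def add_divide_distrib norm_minus_commute
        ennreal_mult[symmetric] ennreal_plus[symmetric] simp del: ennreal_plus)
  qed
  also have "\<dots> = (\<integral>\<^sup>+x. \<integral>\<^sup>+y. a x y \<partial>area_measure \<partial>area_measure) + (\<integral>\<^sup>+x. \<integral>\<^sup>+y. a y x \<partial>area_measure \<partial>area_measure)"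
  proof -
    have [measurable]: "(\<lambda>z. a (fst z) (snd z)) \<in> borel_measurable (area_measure \<Otimes>\<^sub>M area_measure)"
      using a_meas by (simp add: split_beta')
    have [measurable]: "(\<lambda>z. a (snd z) (fst z)) \<in> borel_measurable (area_measure \<Otimes>\<^sub>M area_measure)"
      unfolding a_def by measurable
    have [measurable]: "a x \<in> borel_measurable area_measure" "(\<lambda>y. a y x) \<in> borel_measurable area_measure" for x
      unfolding a_def by measurable
    show ?thesis unfolding a_def by (simp add: nn_integral_add)
  qed
  also have "(\<integral>\<^sup>+x. \<integral>\<^sup>+y. a y x \<partial>area_measure \<partial>area_measure) = (\<integral>\<^sup>+x. \<integral>\<^sup>+y. a x y \<partial>area_measure \<partial>area_measure)"
    by (rule P.Fubini'[OF a_meas])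
  finally show ?thesis unfolding a_int by (simp add: mult_2 distrib_right mult.assoc)
qed

lemma total_integral_le:
  "(\<integral>\<^sup>+x. \<integral>\<^sup>+y. total x y \<partial>area_measure \<partial>area_measure) \<le>
    2 * pole_const * (\<integral>\<^sup>+t. \<integral>\<^sup>+x. ennreal (speed t x) \<partial>area_measure \<partial>lborel)"
proof -
  interpret P: pair_sigma_finite lborel area_measure ..
  have "(\<integral>\<^sup>+x. \<integral>\<^sup>+y. total x y \<partial>area_measure \<partial>area_measure) =
     (\<integral>\<^sup>+x. \<integral>\<^sup>+t. \<integral>\<^sup>+y. ennreal (strain t x y) \<partial>area_measure \<partial>lborel \<partial>area_measure)"
    unfolding total_def
    by (intro nn_integral_cong P.Fubini') measurable
  also have "\<dots> = (\<integral>\<^sup>+t. \<integral>\<^sup>+x. \<integral>\<^sup>+y. ennreal (strain t x y) \<partial>area_measure \<partial>area_measure \<partial>lborel)"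
    by (intro P.Fubini') measurable
  also have "\<dots> \<le> (\<integral>\<^sup>+t. 2 * pole_const * (\<integral>\<^sup>+x. ennreal (speed t x) \<partial>area_measure) \<partial>lborel)"
  proof (rule nn_integral_mono)
    fix t
    show "(\<integral>\<^sup>+x. \<integral>\<^sup>+y. ennreal (strain t x y) \<partial>area_measure \<partial>area_measure) \<le>
      2 * pole_const * (\<integral>\<^sup>+x. ennreal (speed t x) \<partial>area_measure)"
    proof (cases "t \<in> {0..1}")
      case False
      then have "strain t x y = 0" for x y by (auto simp: strain_def)
      then show ?thesis by simp
    qed (rule strain_integral_le)
  qed
  also have "\<dots> = 2 * pole_const * (\<integral>\<^sup>+t. \<integral>\<^sup>+x. ennreal (speed t x) \<partial>area_measure \<partial>lborel)"
    by (rule nn_integral_cmult) measurable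
  finally show ?thesis .
qed

lemma speed_bounded: "\<exists>B\<ge>0. \<forall>t x. speed t x \<le> B"
proof -
  have "compact ((\<lambda>(t, x). vel \<phi> t x) ` ({0..1} \<times> S2))"
    by (intro compact_continuous_image continuous_vel compact_Times) (auto simp: S2_def)
  then obtain B where B: "\<forall>v \<in> (\<lambda>(t, x). vel \<phi> t x) ` ({0..1} \<times> S2). norm v \<le> B"
    using compact_imp_bounded bounded_iff by metis
  have "speed t x \<le> max B 0" for t x
  proof (cases "(t, x) \<in> {0..1} \<times> S2")
    case True
    then have "vel \<phi> t x \<in> (\<lambda>(t, x). vel \<phi> t x) ` ({0..1} \<times> S2)" by (auto intro: image_eqI[of _ _ "(t, x)"])
    then have "norm (vel \<phi> t x) \<le> B" using B by blast
    then show ?thesis by (simp add: speed_def indicator_def le_max_iff_disj)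
  qed (simp add: speed_def)
  then show ?thesis by (intro exI[of _ "max B 0"]) auto
qed

lemma integrable_speed_powr:
  assumes p: "p > 0"
  shows "integrable area_measure (\<lambda>x. speed t x powr p)"
proof -
  obtain B where "\<And>t x. speed t x \<le> B" using speed_bounded by blast
  then show ?thesis
    by (intro area.integrable_const_bound[of _ "B powr p"])
      (auto intro!: AE_I2 powr_mono2 simp: speed_nonneg less_imp_le[OF p])
qed

definition energy :: "real \<Rightarrow> real \<Rightarrow> real" where
  "energy p t = (\<integral>x. speed t x powr p \<partial>area_measure)"

lemma energy_nonneg: "0 \<le> energy p t"
  unfolding energy_def by (rule integral_nonneg_AE) simp

lemma energy_measurable [measurable]: "energy p \<in> borel_measurable borel"
  unfolding energy_def[abs_def]
  by (rule area.borel_measurable_lebesgue_integral) measurable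

text \<open>A substitute for Hoelder's inequality: \<open>s <= l + l^(1-p) s^p\<close> is integrated
  over the total area \<open>2 * pi\<close>, and for \<open>l = energy^(1/p)\<close> the second term
  again yields \<open>l\<close>. This explains \<open>2 * pi + 1\<close>.\<close>

lemma L1_le_energy:
  assumes p: "p > 1"
  shows "(\<integral>\<^sup>+x. ennreal (speed t x) \<partial>area_measure) \<le> ennreal ((2 * pi + 1) * energy p t powr (1 / p))"
proof -
  have int: "integrable area_measure (\<lambda>x. speed t x powr p)" using p by (intro integrable_speed_powr) simp
  show ?thesis
  proof (cases "energy p t = 0")
    case True
    then have "AE x in area_measure. speed t x powr p = 0"
      using integral_nonneg_eq_0_iff_AE[OF int] by (simp add: energy_def)
    then have "AE x in area_measure. ennreal (speed t x) = 0" by eventually_elim simp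
    then have "(\<integral>\<^sup>+x. ennreal (speed t x) \<partial>area_measure) = 0"
      by (subst nn_integral_0_iff_AE) auto
    then show ?thesis by simp
  next
    case False
    then have E: "energy p t > 0" using energy_nonneg[of p t] by simp
    define l where "l = energy p t powr (1 / p)"
    have l: "l > 0" using E by (simp add: l_def)
    \<comment> \<open>Young's inequality; this choice of \<open>l\<close> balances the two terms.\<close>
    have le: "speed t x \<le> l + l powr (1 - p) * speed t x powr p" for x
    proof (cases "speed t x \<le> l")
      case True then show ?thesis by (simp add: add_increasing2)
    next
      case False
      then have s: "speed t x > l" "speed t x > 0" using l by auto
      have "1 \<le> (speed t x / l) powr (p - 1)" using s l p by (intro ge_one_powr_ge_zero) auto
      then have "speed t x * 1 \<le> speed t x * (speed t x / l) powr (p - 1)" using s by (intro mult_left_mono) auto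
      also have "\<dots> = l powr (1 - p) * speed t x powr p"
        using s l by (simp add: powr_divide powr_diff field_simps)
      finally show ?thesis using l by simp
    qed
    have "(\<integral>\<^sup>+x. ennreal (speed t x) \<partial>area_measure) \<le> (\<integral>\<^sup>+x. ennreal (l + l powr (1 - p) * speed t x powr p) \<partial>area_measure)"
      by (intro nn_integral_mono ennreal_leI le)
    also have "\<dots> = ennreal (\<integral>x. l + l powr (1 - p) * speed t x powr p \<partial>area_measure)"
      using int l by (intro nn_integral_eq_integral) (auto intro!: AE_I2)
    also have "(\<integral>x. l + l powr (1 - p) * speed t x powr p \<partial>area_measure) = 2 * pi * l + l powr (1 - p) * energy p t"
      using int by (simp add: energy_def measure_def emeasure_area_measure_UNIV)
    also have "l powr (1 - p) * energy p t = l"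
    proof -
      have "energy p t = l powr p" using E p by (simp add: l_def powr_powr)
      then show ?thesis using l by (simp add: powr_add[symmetric])
    qed
    finally show ?thesis by (simp add: l_def algebra_simps)
  qed
qed

text \<open>The area-preserving substitution by \<open>\<phi> t\<close> turns the norm of the
  generating field into the Lagrangian speed. Bounded speed provides integrability in time;
  otherwise \<open>Lp_length\<close> could be the default value 0 of the integral.\<close>

lemma Lp_length_eq:
  assumes p: "p > 1"
  shows "ennreal (Lp_length p \<phi>) = (\<integral>\<^sup>+t. ennreal (indicator {0..1} t * energy p t powr (1 / p)) \<partial>lborel)"
proof -
  have inner: "(LINT x:S2|area_measure. norm (generating_field \<phi> t x) powr p) = energy p t" if t: "t \<in> {0..1}" for t
  proof -
    note [measurable] = measurable_map[OF t]
    define q where "q x = indicator S2 x *\<^sub>R (norm (generating_field \<phi> t x) powr p)" for x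
    have gen: "generating_field \<phi> t x = vel \<phi> t (inv_into S2 (\<phi> t) x)" for x
      by (simp add: generating_field_def vel_def)
    have "continuous_on S2 (\<lambda>x. norm (generating_field \<phi> t x) powr p)"
      unfolding gen
      by (intro continuous_intros continuous_on_powr' continuous_comp continuous_inv)
        (use t p surj[OF t] inv_into_into[of _ "\<phi> t" S2] in auto)
    then have [measurable]: "q \<in> borel_measurable borel"
      unfolding q_def[abs_def] by (intro borel_measurable_continuous_on_indicator) (simp_all add: S2_borel)
    have "(LINT x:S2|area_measure. norm (generating_field \<phi> t x) powr p) = (\<integral>x. q x \<partial>area_measure)"
      by (simp add: set_lebesgue_integral_def q_def)
    also have "\<dots> = (\<integral>x. q x \<partial>distr area_measure borel (\<phi> t))"
      by (simp add: distr_map[OF t])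
    also have "\<dots> = (\<integral>x. q (\<phi> t x) \<partial>area_measure)"
      by (rule integral_distr) measurable
    also have "\<dots> = (\<integral>x. speed t x powr p \<partial>area_measure)"
    proof (rule integral_cong_AE)
      show "AE x in area_measure. q (\<phi> t x) = speed t x powr p"
        using AE_area_measure_S2
      proof eventually_elim
        case (elim x)
        then show ?case using t inj[OF t] maps_to[OF t]
          by (simp add: q_def gen speed_def)
      qed
    qed measurable
    finally show ?thesis by (simp add: energy_def)
  qed
  obtain B where B: "B \<ge> 0" "\<And>t x. speed t x \<le> B" using speed_bounded by blast
  have "energy p t \<le> 2 * pi * B powr p" for t
  proof -
    have "energy p t \<le> (\<integral>x. B powr p \<partial>area_measure)"
      unfolding energy_def using p B speed_nonneg
      by (intro integral_mono integrable_speed_powr powr_mono2) auto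
    then show ?thesis by (simp add: measure_def emeasure_area_measure_UNIV)
  qed
  then have bd: "energy p t powr (1 / p) \<le> (2 * pi * B powr p) powr (1 / p)" for t
    using energy_nonneg p by (intro powr_mono2) auto
  have int: "integrable lborel (\<lambda>t. indicator {0..1} t * energy p t powr (1 / p))"
  proof (rule Bochner_Integration.integrable_bound)
    show "integrable lborel (\<lambda>t. indicator {0..1::real} t * (2 * pi * B powr p) powr (1 / p))"
      by simp
    show "AE t in lborel. norm (indicator {0..1} t * energy p t powr (1 / p)) \<le> norm (indicator {0..1} t * (2 * pi * B powr p) powr (1 / p))"
      using bd by (auto intro!: AE_I2 simp: indicator_def)
  qed measurable
  have "Lp_length p \<phi> = (\<integral>t. indicator {0..1} t * energy p t powr (1 / p) \<partial>lborel)"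
    unfolding Lp_length_def set_lebesgue_integral_def[of lborel]
    by (intro Bochner_Integration.integral_cong) (auto simp: inner indicator_def)
  then show ?thesis
    using nn_integral_eq_integral[OF int] by simp
qed

theorem total_le_Lp_length:
  assumes p: "p > 1"
  shows "(\<integral>\<^sup>+x. \<integral>\<^sup>+y. total x y \<partial>area_measure \<partial>area_measure) \<le>
    2 * pole_const * ennreal (2 * pi + 1) * ennreal (Lp_length p \<phi>)"
proof -
  have "(\<integral>\<^sup>+t. \<integral>\<^sup>+x. ennreal (speed t x) \<partial>area_measure \<partial>lborel) \<le>
     (\<integral>\<^sup>+t. ennreal (2 * pi + 1) * ennreal (indicator {0..1} t * energy p t powr (1 / p)) \<partial>lborel)"
  proof (rule nn_integral_mono)
    fix t
    show "(\<integral>\<^sup>+x. ennreal (speed t x) \<partial>area_measure) \<le>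
      ennreal (2 * pi + 1) * ennreal (indicator {0..1} t * energy p t powr (1 / p))"
    proof (cases "t \<in> {0..1}")
      case True
      then show ?thesis using L1_le_energy[OF p, of t] by (simp add: ennreal_mult[symmetric] del: ennreal_plus)
    next
      case False
      then have "speed t x = 0" for x by (auto simp: speed_def)
      then show ?thesis by simp
    qed
  qed
  also have "\<dots> = ennreal (2 * pi + 1) * ennreal (Lp_length p \<phi>)"
    unfolding Lp_length_eq[OF p] by (rule nn_integral_cmult) measurable
  finally have "2 * pole_const * (\<integral>\<^sup>+t. \<integral>\<^sup>+x. ennreal (speed t x) \<partial>area_measure \<partial>lborel) \<le>
     2 * pole_const * (ennreal (2 * pi + 1) * ennreal (Lp_length p \<phi>))"
    by (rule mult_left_mono) simp
  with total_integral_le show ?thesis by (simp add: mult.assoc)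
qed

end

section \<open>Smooth functions\<close>

lemma continuous_on_local:
  fixes f :: "'a::t2_space \<Rightarrow> 'b::topological_space"
  assumes "\<And>x. x \<in> S \<Longrightarrow> \<exists>U. open U \<and> x \<in> U \<and> continuous_on (U \<inter> S) f"
  shows "continuous_on S f"
  unfolding continuous_on_eq_continuous_within
proof
  fix x assume x: "x \<in> S"
  then obtain U where U: "open U" "x \<in> U" "continuous_on (U \<inter> S) f" using assms by blast
  have "at x within S = at x within (U \<inter> S)"
    by (rule at_within_nhd[OF U(2,1)]) auto
  then show "continuous (at x within S) f"
    using U x by (simp add: continuous_on_eq_continuous_within)
qed

lemma smooth_onE:
  assumes "smooth_on S f" "x \<in> S"
  obtains U F where "open U" "x \<in> U" "\<And>k. Ck_on k U F" "\<And>y. y \<in> U \<Longrightarrow> y \<in> S \<Longrightarrow> F y = f y"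
proof -
  obtain U F where *: "open U \<and> x \<in> U \<and> (\<forall>k. Ck_on k U F) \<and> (\<forall>y\<in>U \<inter> S. F y = f y)"
    using assms unfolding smooth_on_def by (elim bexE ballE exE) auto
  show ?thesis by (rule that[of U F]) (use * in auto)
qed

lemma smooth_on_imp_continuous_on:
  assumes "smooth_on S f"
  shows "continuous_on S f"
proof (rule continuous_on_local)
  fix x assume x: "x \<in> S"
  show "\<exists>U. open U \<and> x \<in> U \<and> continuous_on (U \<inter> S) f"
  proof (rule smooth_onE[OF assms x])
    fix U F assume U: "open U" "x \<in> U" "\<And>k. Ck_on k U F" "\<And>y. y \<in> U \<Longrightarrow> y \<in> S \<Longrightarrow> F y = f y"
    have "continuous_on U F" using U(3)[of 0] by simp
    then have "continuous_on (U \<inter> S) F" by (rule continuous_on_subset) simp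
    then have "continuous_on (U \<inter> S) f" by (rule continuous_on_eq) (use U(4) in simp)
    with U(1,2) show "\<exists>U. open U \<and> x \<in> U \<and> continuous_on (U \<inter> S) f" by blast
  qed
qed

text \<open>A local extension \<open>F\<close> on an open set has the ordinary partial derivative
  \<open>F' (1, 0)\<close>. Derivatives within \<open>{0..1}\<close> are unique even at its ends, so
  \<open>vel\<close> equals this one for every choice of \<open>F\<close> and inherits its
  continuity.\<close>

lemma smooth_on_time_derivative:
  fixes \<phi> :: "real \<Rightarrow> real^3 \<Rightarrow> real^3"
  assumes sm: "smooth_on ({0..1} \<times> S2) (\<lambda>(t, x). \<phi> t x)"
  shows "t \<in> {0..1} \<Longrightarrow> x \<in> S2 \<Longrightarrow> ((\<lambda>s. \<phi> s x) has_vector_derivative vel \<phi> t x) (at t within {0..1})"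
    and "continuous_on ({0..1} \<times> S2) (\<lambda>(t, x). vel \<phi> t x)"
proof -
  have velF: "((\<lambda>s. \<phi> s y) has_vector_derivative vel \<phi> s y) (at s within {0..1}) \<and>
      vel \<phi> s y = frechet_derivative F (at (s, y)) (1, 0)"
    if s: "s \<in> {0..1}" and y: "y \<in> S2" and U: "open U" "(s, y) \<in> U" and F: "Ck_on (Suc 0) U F"
      and eq: "\<And>z. z \<in> U \<Longrightarrow> z \<in> {0..1} \<times> S2 \<Longrightarrow> F z = (case z of (t, x) \<Rightarrow> \<phi> t x)"
    for s y U and F :: "real \<times> (real^3) \<Rightarrow> real^3"
  proof -
    let ?F' = "frechet_derivative F (at (s, y))"
    have F': "(F has_derivative ?F') (at (s, y))"
      using F U(2) unfolding Ck_on.simps frechet_derivative_works[symmetric] by blast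
    have "((\<lambda>r. (r, y)) has_derivative (\<lambda>h. (h, 0))) (at s within {0..1})"
      by (intro has_derivative_Pair has_derivative_ident has_derivative_const)
    from has_derivative_compose[OF this F']
    have "((\<lambda>r. F (r, y)) has_derivative (\<lambda>h. ?F' (h, 0))) (at s within {0..1})" .
    moreover have "(\<lambda>h. ?F' (h, 0)) = (\<lambda>h. h *\<^sub>R ?F' (1, 0))"
    proof
      fix h show "?F' (h, 0) = h *\<^sub>R ?F' (1, 0)"
        using linear_scale[OF has_derivative_linear[OF F'], of h "(1, 0)"] by simp
    qed
    ultimately have D: "((\<lambda>r. F (r, y)) has_vector_derivative ?F' (1, 0)) (at s within {0..1})"
      by (simp add: has_vector_derivative_def)
    have "open ((\<lambda>r. (r, y)) -` U)" by (intro open_vimage U(1) continuous_intros)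
    moreover have "s \<in> (\<lambda>r. (r, y)) -` U" using U(2) by simp
    ultimately obtain e where e: "e > 0" "ball s e \<subseteq> (\<lambda>r. (r, y)) -` U"
      by (rule openE)
    have "((\<lambda>s. \<phi> s y) has_vector_derivative ?F' (1, 0)) (at s within {0..1})"
    proof (rule has_vector_derivative_transform_within[OF D e(1) s])
      fix r :: real assume r: "r \<in> {0..1}" "dist r s < e"
      then have "r \<in> ball s e" by (simp add: dist_commute)
      then have "(r, y) \<in> U" using e(2) by auto
      then show "F (r, y) = \<phi> r y" using eq[of "(r, y)"] r y by simp
    qed
    moreover from this have "vel \<phi> s y = ?F' (1, 0)"
      unfolding vel_def by (intro vector_derivative_within_closed_interval) (use s in auto)
    ultimately show ?thesis by simp
  qed
  show "((\<lambda>s. \<phi> s x) has_vector_derivative vel \<phi> t x) (at t within {0..1})" if t: "t \<in> {0..1}" and x: "x \<in> S2"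
  proof -
    have tx: "(t, x) \<in> {0..1} \<times> S2" using t x by simp
    show ?thesis
    proof (rule smooth_onE[OF sm tx])
      fix U F assume "open U" "(t, x) \<in> U" "\<And>k. Ck_on k U F"
        "\<And>z. z \<in> U \<Longrightarrow> z \<in> {0..1} \<times> S2 \<Longrightarrow> F z = (case z of (t, x) \<Rightarrow> \<phi> t x)"
      from velF[OF t x this] show ?thesis ..
    qed
  qed
  show "continuous_on ({0..1} \<times> S2) (\<lambda>(t, x). vel \<phi> t x)"
  proof (rule continuous_on_local)
    fix z assume z: "z \<in> {0..1::real} \<times> S2"
    show "\<exists>U. open U \<and> z \<in> U \<and> continuous_on (U \<inter> ({0..1} \<times> S2)) (\<lambda>(t, x). vel \<phi> t x)"
    proof (rule smooth_onE[OF sm z])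
      fix U F assume U: "open U" "z \<in> U" "\<And>k. Ck_on k U F"
        "\<And>z. z \<in> U \<Longrightarrow> z \<in> {0..1} \<times> S2 \<Longrightarrow> F z = (case z of (t, x) \<Rightarrow> \<phi> t x)"
      have "continuous_on U (\<lambda>z. frechet_derivative F (at z) (1, 0))"
        using U(3)[of "Suc 0"] by simp
      then have "continuous_on (U \<inter> ({0..1} \<times> S2)) (\<lambda>z. frechet_derivative F (at z) (1, 0))"
        by (rule continuous_on_subset) auto
      then have "continuous_on (U \<inter> ({0..1} \<times> S2)) (\<lambda>(t, x). vel \<phi> t x)"
      proof (rule continuous_on_eq)
        fix w assume "w \<in> U \<inter> ({0..1} \<times> S2)"
        moreover obtain s y where w: "w = (s, y)" by (cases w)
        ultimately have sy: "s \<in> {0..1}" "y \<in> S2" "(s, y) \<in> U" by auto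
        from velF[OF sy(1,2) U(1) sy(3) U(3) U(4)]
        show "frechet_derivative F (at w) (1, 0) = (\<lambda>(t, x). vel \<phi> t x) w" by (simp add: w)
      qed
      with U(1,2) show "\<exists>U. open U \<and> z \<in> U \<and> continuous_on (U \<inter> ({0..1} \<times> S2)) (\<lambda>(t, x). vel \<phi> t x)" by blast
    qed
  qed
qed

section \<open>Calculus of smooth maps on the whole space\<close>

abbreviation smooth :: "('a::euclidean_space \<Rightarrow> 'b::euclidean_space) \<Rightarrow> bool" where
  "smooth f \<equiv> \<forall>k. Ck_on k UNIV f"

lemma smooth_imp_smooth_on:
  assumes "smooth F" "\<And>x. x \<in> S \<Longrightarrow> F x = f x"
  shows "smooth_on S f"
  unfolding smooth_on_def using assms by (intro ballI exI[of _ UNIV] exI[of _ F]) auto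

text \<open>For the product rule, in which factors also appear undifferentiated. At order 0
  continuity comes from differentiability.\<close>

lemma Ck_on_pred: "Ck_on (Suc k) UNIV f \<Longrightarrow> Ck_on k UNIV f"
proof (induction k arbitrary: f)
  case 0
  then show ?case
    by (auto intro!: continuous_at_imp_continuous_on differentiable_imp_continuous_within)
next
  case (Suc k)
  then show ?case by (metis Ck_on.simps(2))
qed

lemma Ck_on_SucI:
  assumes "\<And>x. (f has_derivative f' x) (at x)" "\<And>v. Ck_on k UNIV (\<lambda>x. f' x v)"
  shows "Ck_on (Suc k) UNIV f"
proof -
  have "frechet_derivative f (at x) = f' x" for x using frechet_derivative_at[OF assms(1)] by simp
  with assms show ?thesis unfolding Ck_on.simps differentiable_def by auto
qed

lemma Ck_on_SucD:
  assumes "Ck_on (Suc k) UNIV f"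
  shows "(f has_derivative frechet_derivative f (at x)) (at x)" "Ck_on k UNIV (\<lambda>x. frechet_derivative f (at x) v)"
  using assms frechet_derivative_works by auto

lemma Ck_on_const: "Ck_on k UNIV (\<lambda>x. c)"
proof (induction k arbitrary: c)
  case (Suc k)
  show ?case by (rule Ck_on_SucI[OF has_derivative_const]) (rule Suc)
qed simp

lemma smooth_const: "smooth (\<lambda>x. c)" using Ck_on_const by blast

lemma smooth_bounded_linear:
  assumes "bounded_linear f" shows "smooth f"
proof
  fix k show "Ck_on k UNIV f"
  proof (cases k)
    case 0 then show ?thesis using linear_continuous_on[OF assms] by simp
  next
    case (Suc n)
    show ?thesis unfolding Suc
      by (rule Ck_on_SucI[OF bounded_linear_imp_has_derivative[OF assms]]) (rule Ck_on_const)
  qed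
qed

lemma Ck_on_add: "Ck_on k UNIV f \<Longrightarrow> Ck_on k UNIV g \<Longrightarrow> Ck_on k UNIV (\<lambda>x. f x + g x)"
proof (induction k arbitrary: f g)
  case 0 then show ?case by (simp add: continuous_on_add)
next
  case (Suc k)
  show ?case
    by (rule Ck_on_SucI[OF has_derivative_add[OF Ck_on_SucD(1)[OF Suc.prems(1)] Ck_on_SucD(1)[OF Suc.prems(2)]]])
      (intro Suc.IH Ck_on_SucD(2) Suc.prems)
qed

lemma Ck_on_scaleR:
  fixes f :: "'a::euclidean_space \<Rightarrow> real"
  shows "Ck_on k UNIV f \<Longrightarrow> Ck_on k UNIV g \<Longrightarrow> Ck_on k UNIV (\<lambda>x. f x *\<^sub>R g x)"
proof (induction k arbitrary: f g)
  case 0 then show ?case by (simp add: continuous_on_scaleR)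
next
  case (Suc k)
  show ?case
    by (rule Ck_on_SucI[OF has_derivative_scaleR[OF Ck_on_SucD(1)[OF Suc.prems(1)] Ck_on_SucD(1)[OF Suc.prems(2)]]])
      (intro Ck_on_add Suc.IH Ck_on_SucD(2) Suc.prems Ck_on_pred)
qed

lemma smooth_add: "smooth f \<Longrightarrow> smooth g \<Longrightarrow> smooth (\<lambda>x. f x + g x)"
  by (blast intro: Ck_on_add)

lemma smooth_scaleR: "smooth (f :: _ \<Rightarrow> real) \<Longrightarrow> smooth g \<Longrightarrow> smooth (\<lambda>x. f x *\<^sub>R g x)"
  by (blast intro: Ck_on_scaleR)

lemma smooth_mult: "smooth (f :: _ \<Rightarrow> real) \<Longrightarrow> smooth g \<Longrightarrow> smooth (\<lambda>x. f x * g x)"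
  using smooth_scaleR[of f g] by simp

lemma smooth_minus: "smooth (f :: _ \<Rightarrow> real) \<Longrightarrow> smooth (\<lambda>x. - f x)"
  using smooth_mult[OF smooth_const[of "-1"], of f] by simp

lemma smooth_diff: "smooth (f :: _ \<Rightarrow> real) \<Longrightarrow> smooth g \<Longrightarrow> smooth (\<lambda>x. f x - g x)"
  using smooth_add[OF _ smooth_minus, of f g] by simp

lemma smooth_sum: "finite A \<Longrightarrow> (\<And>i. i \<in> A \<Longrightarrow> smooth (f i)) \<Longrightarrow> smooth (\<lambda>x. \<Sum>i\<in>A. f i x)"
proof (induction A rule: finite_induct)
  case empty then show ?case using smooth_const[of 0] by simp
next
  case (insert a A)
  have "smooth (\<lambda>x. f a x + (\<Sum>i\<in>A. f i x))"
    by (rule smooth_add) (use insert in auto)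
  then show ?case using insert by simp
qed

text \<open>A known sequence of derivatives replaces the general chain rule of higher order: the
  derivative of \<open>D n (f x)\<close> is \<open>D (Suc n) (f x)\<close> times that of
  \<open>f\<close>, and the induction on \<open>k\<close> treats all \<open>n\<close> at
  once.\<close>

lemma smooth_compose_tower:
  fixes f :: "'a::euclidean_space \<Rightarrow> real" and D :: "nat \<Rightarrow> real \<Rightarrow> real"
  assumes D: "\<And>n x. (D n has_real_derivative D (Suc n) x) (at x)" and f: "smooth f"
  shows "smooth (\<lambda>x. D n (f x))"
proof
  fix k show "Ck_on k UNIV (\<lambda>x. D n (f x))"
  proof (induction k arbitrary: n)
    case 0
    have "continuous_on UNIV (D n)"
      using D DERIV_isCont by (blast intro: continuous_at_imp_continuous_on)
    moreover have "continuous_on UNIV f" using spec[OF f, of 0] by (simp only: Ck_on.simps)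
    ultimately show ?case by (auto intro: continuous_on_compose2)
  next
    case (Suc k)
    have f': "Ck_on (Suc k) UNIV f" using f by blast
    have "((\<lambda>x. D n (f x)) has_derivative (\<lambda>v. D (Suc n) (f x) *\<^sub>R frechet_derivative f (at x) v)) (at x)" for x
      using has_derivative_compose[OF Ck_on_SucD(1)[OF f'] D[THEN has_field_derivative_imp_has_derivative]]
      by simp
    then show ?case
      by (rule Ck_on_SucI) (intro Ck_on_scaleR Suc.IH Ck_on_SucD(2) f')
  qed
qed

lemma smooth_sin_cos:
  fixes f :: "'a::euclidean_space \<Rightarrow> real"
  assumes "smooth f"
  shows "smooth (\<lambda>x. sin (f x))" "smooth (\<lambda>x. cos (f x))"
proof -
  \<comment> \<open>Differentiating the sine shifts it by a quarter turn.\<close>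
  define D where "D n x = sin (x + of_nat n * (pi / 2))" for n :: nat and x :: real
  have "(D n has_real_derivative D (Suc n) x) (at x)" for n x
  proof -
    have "(D n has_real_derivative cos (x + of_nat n * (pi / 2))) (at x)"
      unfolding D_def by (auto intro!: derivative_eq_intros)
    also have "cos (x + of_nat n * (pi / 2)) = D (Suc n) x"
    proof -
      have "x + of_nat (Suc n) * (pi / 2) = (x + of_nat n * (pi / 2)) + pi / 2" by (simp add: distrib_right)
      then show ?thesis unfolding D_def by (simp only: sin_add) simp
    qed
    finally show ?thesis .
  qed
  note tower = smooth_compose_tower[of D, OF this assms]
  show "smooth (\<lambda>x. sin (f x))" using tower[of 0] by (simp add: D_def)
  have "D 1 y = cos y" for y unfolding D_def using sin_add[of y "pi / 2"] by simp
  then show "smooth (\<lambda>x. cos (f x))" using tower[of 1] by simp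
qed

text \<open>The derivative of \<open>q(1/x) exp (-1/x)\<close> is
  \<open>y^2 (q(y) - q'(y)) exp (-y)\<close> at \<open>y = 1/x\<close>.\<close>

primrec flat_poly :: "nat \<Rightarrow> real poly" where
  "flat_poly 0 = 1"
| "flat_poly (Suc n) = [:0, 0, 1:] * (flat_poly n - pderiv (flat_poly n))"

definition flat_deriv :: "nat \<Rightarrow> real \<Rightarrow> real" where
  "flat_deriv n x = (if x > 0 then poly (flat_poly n) (1 / x) * exp (- (1 / x)) else 0)"

lemma poly_exp_tendsto_0: "((\<lambda>y. poly q y * exp (- y)) \<longlongrightarrow> (0::real)) at_top"
proof -
  have "((\<lambda>y. \<Sum>i\<le>degree q. coeff q i * (y ^ i / exp y)) \<longlongrightarrow> (\<Sum>i\<le>degree q. coeff q i * 0)) at_top"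
    by (intro tendsto_sum tendsto_mult tendsto_const tendsto_power_div_exp_0)
  moreover have "(\<Sum>i\<le>degree q. coeff q i * (y ^ i / exp y)) = poly q y * exp (- y)" for y
    by (simp add: poly_altdef sum_distrib_right exp_minus divide_inverse mult.assoc)
  ultimately show ?thesis by simp
qed

text \<open>Only the origin is delicate. With \<open>y = 1/h\<close> the difference quotient from
  the right is \<open>y q(y) exp (-y)\<close>, a polynomial times a decaying exponential.\<close>

lemma flat_deriv_has_derivative: "(flat_deriv n has_real_derivative flat_deriv (Suc n) x) (at x)"
proof (cases x "0::real" rule: linorder_cases)
  case greater
  have "((\<lambda>x. poly (flat_poly n) (1 / x) * exp (- (1 / x))) has_real_derivative flat_deriv (Suc n) x) (at x)"
    using greater unfolding flat_deriv_def
    by (auto intro!: derivative_eq_intros poly_DERIV[THEN DERIV_chain2] simp: field_simps power2_eq_square)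
  then show ?thesis
    by (rule has_field_derivative_transform_within_open[of _ _ _ "{0<..}"])
      (use greater in \<open>auto simp: flat_deriv_def\<close>)
next
  case less
  have "((\<lambda>x. 0) has_real_derivative 0) (at x)" by simp
  then have "(flat_deriv n has_real_derivative 0) (at x)"
    by (rule has_field_derivative_transform_within_open[of _ _ _ "{..<0}"])
      (use less in \<open>auto simp: flat_deriv_def\<close>)
  then show ?thesis using less by (simp add: flat_deriv_def)
next
  case equal
  have "((\<lambda>h. flat_deriv n h / h) \<longlongrightarrow> 0) (at 0)"
    unfolding filterlim_at_split
  proof
    have "((\<lambda>h. 0) \<longlongrightarrow> 0) (at_left (0::real))" by simp
    then show "((\<lambda>h. flat_deriv n h / h) \<longlongrightarrow> 0) (at_left 0)"
      by (rule tendsto_cong[THEN iffD1, rotated]) (auto simp: eventually_at_filter flat_deriv_def)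
    have "((\<lambda>y. poly (pCons 0 (flat_poly n)) y * exp (- y)) \<longlongrightarrow> 0) at_top"
      by (rule poly_exp_tendsto_0)
    then have "((\<lambda>h. poly (pCons 0 (flat_poly n)) (inverse h) * exp (- inverse h)) \<longlongrightarrow> 0) (at_right (0::real))"
      by (rule filterlim_compose) (rule filterlim_inverse_at_top_right)
    then show "((\<lambda>h. flat_deriv n h / h) \<longlongrightarrow> 0) (at_right 0)"
      by (rule tendsto_cong[THEN iffD1, rotated])
        (auto simp: eventually_at_filter flat_deriv_def field_simps)
  qed
  then show ?thesis using equal by (simp add: has_field_derivative_iff flat_deriv_def)
qed

definition flat :: "real \<Rightarrow> real" where
  "flat x = (if x > 0 then exp (- (1 / x)) else 0)"

lemma smooth_flat:
  assumes "smooth f" shows "smooth (\<lambda>x. flat (f x))"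
  using smooth_compose_tower[of flat_deriv, OF flat_deriv_has_derivative assms, of 0]
  by (simp add: flat_def flat_deriv_def cong: if_cong)

section \<open>Twists\<close>

lemma Diff_area_iff:
  "f \<in> carrier Diff_area \<longleftrightarrow> f \<in> extensional S2 \<and> bij_betw f S2 S2 \<and> smooth_on S2 f \<and>
    smooth_on S2 (inv_into S2 f) \<and> preserves_area f"
  by (auto simp: Diff_area_def Bij_def)

text \<open>Off the sphere an extensional function is the constant \<open>undefined\<close>.\<close>

lemma extensional_continuous_measurable:
  fixes f :: "real^3 \<Rightarrow> real^3"
  assumes "f \<in> extensional S2" "continuous_on S2 f"
  shows "f \<in> borel_measurable borel"
proof -
  have "(\<lambda>x. indicator S2 x *\<^sub>R f x) \<in> borel_measurable borel"
    by (rule borel_measurable_continuous_on_indicator[OF _ assms(2)]) (simp add: S2_borel)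
  then have "(\<lambda>x. indicator S2 x *\<^sub>R f x + indicator (- S2) x *\<^sub>R undefined) \<in> borel_measurable borel"
    using S2_borel by measurable
  also have "(\<lambda>x. indicator S2 x *\<^sub>R f x + indicator (- S2) x *\<^sub>R undefined) = f"
    using assms(1) by (auto simp: fun_eq_iff indicator_def extensional_def)
  finally show ?thesis .
qed

lemma Diff_area_distr:
  assumes "f \<in> carrier Diff_area"
  shows "f \<in> borel_measurable borel" "distr area_measure borel f = area_measure"
proof -
  show m: "f \<in> borel_measurable borel"
    using assms smooth_on_imp_continuous_on by (auto simp: Diff_area_iff intro: extensional_continuous_measurable)
  show "distr area_measure borel f = area_measure"
    using assms m by (intro distr_area_measure) (auto simp: Diff_area_iff)
qed

lemma smooth_paths_area_isotopy:
  assumes "\<phi> \<in> smooth_paths f g"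
  shows "area_isotopy \<phi>"
proof -
  have C: "\<phi> t \<in> carrier Diff_area" if "t \<in> {0..1}" for t
    using assms that by (simp add: smooth_paths_def)
  have sm: "smooth_on ({0..1} \<times> S2) (\<lambda>(t, x). \<phi> t x)"
    using assms by (simp add: smooth_paths_def)
  have bij: "bij_betw (\<phi> t) S2 S2" if "t \<in> {0..1}" for t
    using C[OF that] by (simp add: Diff_area_iff)
  show ?thesis
  proof unfold_locales
    show "\<phi> t x \<in> S2" if "t \<in> {0..1}" "x \<in> S2" for t x
      using bij[OF that(1)] that(2) by (rule bij_betw_apply)
    show "inj_on (\<phi> t) S2" if "t \<in> {0..1}" for t
      using bij[OF that] by (rule bij_betw_imp_inj_on)
    show "\<phi> t ` S2 = S2" if "t \<in> {0..1}" for t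
      using bij[OF that] by (rule bij_betw_imp_surj_on)
    show "continuous_on S2 (inv_into S2 (\<phi> t))" if "t \<in> {0..1}" for t
      using C[OF that] by (intro smooth_on_imp_continuous_on) (simp add: Diff_area_iff)
  qed (use smooth_on_time_derivative[OF sm] smooth_on_imp_continuous_on[OF sm] Diff_area_distr[OF C] in auto)
qed

text \<open>Written with \<open>axis\<close> vectors, so that the rules for sums and scalar
  multiples yield smoothness and derivatives.\<close>

definition rotz :: "real \<Rightarrow> real^3 \<Rightarrow> real^3" where
  "rotz s x = (cos s * x$1 - sin s * x$2) *\<^sub>R axis 1 1 + (sin s * x$1 + cos s * x$2) *\<^sub>R axis 2 1 + x$3 *\<^sub>R axis 3 1"

lemma rotz_nth [simp]:
  "rotz s x $ 1 = cos s * x$1 - sin s * x$2"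
  "rotz s x $ 2 = sin s * x$1 + cos s * x$2"
  "rotz s x $ 3 = x$3"
  by (simp_all add: rotz_def axis_def)

lemma rotz_rotz: "rotz s (rotz s' x) = rotz (s + s') x"
  by (simp add: vec_eq_iff forall_3 cos_add sin_add algebra_simps)

lemma rotz_0: "rotz 0 x = x"
  by (simp add: vec_eq_iff forall_3)

lemma rotz_S2: "rotz s x \<in> S2 \<longleftrightarrow> x \<in> S2"
proof -
  have "(cos s * x$1 - sin s * x$2)\<^sup>2 + (sin s * x$1 + cos s * x$2)\<^sup>2 = (x$1)\<^sup>2 + (x$2)\<^sup>2"
    using sin_cos_squared_add[of s] by algebra
  then show ?thesis by (simp add: S2_iff)
qed

definition twist :: "(real \<Rightarrow> real) \<Rightarrow> real^3 \<Rightarrow> real^3" where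
  "twist r x = rotz (r (x$3)) x"

lemma twist_nth3 [simp]: "twist r x $ 3 = x $ 3"
  by (simp add: twist_def)

text \<open>Twists keep heights, so the outer angle may be read off at the original point. Hence
  twists commute and add.\<close>

lemma twist_twist: "twist r (twist r' x) = twist (\<lambda>h. r h + r' h) x"
  by (simp add: twist_def rotz_rotz)

lemma twist_S2: "twist r x \<in> S2 \<longleftrightarrow> x \<in> S2"
  by (simp add: twist_def rotz_S2)

text \<open>The velocity field of the rotation \<open>rotz\<close>.\<close>

definition spinz :: "real^3 \<Rightarrow> real^3" where
  "spinz x = (- x$2) *\<^sub>R axis 1 1 + x$1 *\<^sub>R axis 2 1"

lemma spinz_nth [simp]: "spinz x $ 1 = - x$2" "spinz x $ 2 = x$1" "spinz x $ 3 = 0"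
  by (simp_all add: spinz_def axis_def)

lemma smooth_rotz:
  fixes X :: "'a::euclidean_space \<Rightarrow> real^3"
  assumes s: "smooth s" and X: "\<And>i. smooth (\<lambda>z. X z $ i)"
  shows "smooth (\<lambda>z. rotz (s z) (X z))"
  unfolding rotz_def
  by (intro smooth_add smooth_scaleR smooth_diff smooth_mult smooth_sin_cos smooth_const s X)

text \<open>A rigid rotation plus the shear caused by the variation of the angle with
  height.\<close>

lemma twist_has_derivative:
  assumes r: "(r has_real_derivative r') (at (x$3))"
  shows "(twist r has_derivative (\<lambda>w. rotz (r (x$3)) w + (r' * w$3) *\<^sub>R spinz (twist r x))) (at x within S)"
proof -
  have nth: "((\<lambda>x::real^3. x $ i) has_derivative (\<lambda>w. w $ i)) (at x within S)" for i
    by (rule bounded_linear_imp_has_derivative) (rule bounded_linear_vec_nth)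
  have R: "((\<lambda>x::real^3. r (x$3)) has_derivative (\<lambda>w. r' * w$3)) (at x within S)"
    using has_derivative_compose[OF nth[of 3] r[unfolded has_field_derivative_def]] by simp
  have S: "((\<lambda>x::real^3. sin (r (x$3))) has_derivative (\<lambda>w. r' * w$3 * cos (r (x$3)))) (at x within S)"
    using has_derivative_sin[OF R] by simp
  have C: "((\<lambda>x::real^3. cos (r (x$3))) has_derivative (\<lambda>w. r' * w$3 * (- sin (r (x$3))))) (at x within S)"
    using has_derivative_cos[OF R] by simp
  show ?thesis
    unfolding twist_def[abs_def] rotz_def
    by (rule has_derivative_eq_rhs,
      (rule has_derivative_add has_derivative_scaleR has_derivative_diff has_derivative_mult nth S C has_derivative_const)+)
     (simp add: fun_eq_iff vec_eq_iff forall_3 axis_def rotz_def algebra_simps)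
qed

text \<open>Height is, up to scale, the Hamiltonian of the rotation: the area form contracted with
  \<open>spinz\<close> is proportional to the vertical component. The shear terms are therefore
  multiples of \<open>u$3 * v$3\<close> with opposite signs and cancel.\<close>

lemma twist_preserves_area:
  assumes r: "\<And>h. r differentiable (at h)" and f: "\<And>x. x \<in> S2 \<Longrightarrow> f x = twist r x"
  shows "preserves_area f"
  unfolding preserves_area_def
proof
  fix x assume x: "x \<in> S2"
  obtain r' where r': "(r has_real_derivative r') (at (x$3))"
    using r real_differentiableE by metis
  let ?D = "\<lambda>w. rotz (r (x$3)) w + (r' * w$3) *\<^sub>R spinz (twist r x)"
  have "(f has_derivative ?D) (at x within S2)"
    by (rule has_derivative_transform[OF x _ twist_has_derivative[OF r']]) (rule f)
  moreover have "area_form (f x) (?D u) (?D v) = area_form x u v"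
    if "u \<in> tangent x" "v \<in> tangent x" for u v
  proof -
    obtain a b c where X: "x$1 = a" "x$2 = b" "x$3 = c" by blast
    obtain u1 u2 u3 where U: "u$1 = u1" "u$2 = u2" "u$3 = u3" by blast
    obtain v1 v2 v3 where V: "v$1 = v1" "v$2 = v2" "v$3 = v3" by blast
    obtain S C where SC: "sin (r c) = S" "cos (r c) = C" by blast
    have rel: "a\<^sup>2 + b\<^sup>2 + c\<^sup>2 = 1/4" "a * u1 + b * u2 + c * u3 = 0" "a * v1 + b * v2 + c * v3 = 0"
      "S\<^sup>2 + C\<^sup>2 = 1"
      using x that sin_cos_squared_add[of "r c"]
      by (simp_all add: S2_iff tangent_def inner_real3 X U V SC)
    have "x \<bullet> cross3 u v = rotz (r (x$3)) x \<bullet> cross3 (rotz (r (x$3)) u) (rotz (r (x$3)) v)"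
      unfolding inner_real3 cross3_nth rotz_nth X U V SC using rel(4) by algebra
    moreover have "rotz (r (x$3)) x \<bullet> cross3 (rotz (r (x$3)) u + (r' * u$3) *\<^sub>R spinz (twist r x)) (rotz (r (x$3)) v + (r' * v$3) *\<^sub>R spinz (twist r x)) =
      rotz (r (x$3)) x \<bullet> cross3 (rotz (r (x$3)) u) (rotz (r (x$3)) v) +
      r' * (v3 * (rotz (r (x$3)) x \<bullet> cross3 (rotz (r (x$3)) u) (spinz (rotz (r (x$3)) x))) +
            u3 * (rotz (r (x$3)) x \<bullet> cross3 (spinz (rotz (r (x$3)) x)) (rotz (r (x$3)) v)))"
      unfolding twist_def by (simp add: inner_real3 cross3_nth U V algebra_simps)
    moreover have "rotz (r (x$3)) x \<bullet> cross3 (rotz (r (x$3)) u) (spinz (rotz (r (x$3)) x)) = - u3 / 4"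
      unfolding inner_real3 cross3_nth rotz_nth spinz_nth X U V SC using rel by algebra
    moreover have "rotz (r (x$3)) x \<bullet> cross3 (spinz (rotz (r (x$3)) x)) (rotz (r (x$3)) v) = v3 / 4"
      unfolding inner_real3 cross3_nth rotz_nth spinz_nth X U V SC using rel by algebra
    ultimately show ?thesis
      unfolding area_form_def f[OF x] twist_def by simp
  qed
  ultimately show "\<exists>D. (f has_derivative D) (at x within S2) \<and>
    (\<forall>u\<in>tangent x. \<forall>v\<in>tangent x. area_form (f x) (D u) (D v) = area_form x u v)" by blast
qed

text \<open>In the affine coordinate \<open>z\<close> of the chart this is the argument of \<open>1 - z(x) / z(y)\<close>. It is
  meant for \<open>x$3 > y$3\<close>, that is \<open>|z(x)| < |z(y)|\<close>, where the denominator is positive.\<close>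

definition gap_angle :: "real^3 \<Rightarrow> real^3 \<Rightarrow> real" where
  "gap_angle x y = - arctan ((x$2 * y$1 - x$1 * y$2) / ((1/2 + x$3) * (1/2 - y$3) - (x$1 * y$1 + x$2 * y$2)))"

lemma abs_gap_angle_le: "\<bar>gap_angle x y\<bar> \<le> pi"
  unfolding gap_angle_def using arctan_bounded by (smt (verit) pi_gt_zero field_sum_of_halves)

lemma gap_angle_measurable [measurable]: "(\<lambda>(x, y). gap_angle x y) \<in> borel_measurable (borel \<Otimes>\<^sub>M borel)"
proof -
  have nth: "(\<lambda>v::real^3. v $ i) \<in> borel_measurable borel" for i
    by (intro borel_measurable_continuous_onI continuous_intros)
  note [measurable] = measurable_compose[OF _ nth]
  show ?thesis unfolding gap_angle_def by (simp add: split_beta') measurable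
qed

text \<open>\<open>S\<close> and \<open>W\<close> are the inner and cross product of the horizontal
  parts of the points, and \<open>(S + i W) / m\<close> is \<open>z(x) / z(y)\<close>. With
  \<open>n = (1/2 - h) (1/2 + k)\<close>, all follows from \<open>S^2 + W^2 = m n\<close> and from
  the squared distance \<open>m + n - 2 S\<close>.\<close>

lemma rotating_pair:
  fixes h k S W \<alpha> \<beta> :: real
  assumes hk: "h > k" "h \<le> 1/2" "k \<ge> - 1/2"
    and SW: "S\<^sup>2 + W\<^sup>2 = (1/4 - h\<^sup>2) * (1/4 - k\<^sup>2)"
  defines "m \<equiv> (1/2 + h) * (1/2 - k)"
  shows "m - S > 0" "1/2 - 2 * (S + h * k) > 0"
    "- ((((\<alpha> - \<beta>) * S) * (m - S) + W * (- ((\<alpha> - \<beta>) * W))) / ((m - S)\<^sup>2 + W\<^sup>2)) + (\<beta> * (1/2 + k) - \<alpha> * (1/2 - h)) =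
      2 * (\<alpha> * (k / 4 - (S + h * k) * h) + \<beta> * (h / 4 - (S + h * k) * k)) / (1/2 - 2 * (S + h * k))"
proof -
  define n where "n = (1/2 - h) * (1/2 + k)"
  define D where "D = 1/2 - 2 * (S + h * k)"
  have m: "m > 0" unfolding m_def using hk by (intro mult_pos_pos) auto
  have n: "n \<ge> 0" unfolding n_def using hk by (intro mult_nonneg_nonneg) auto
  \<comment> \<open>Here the order of the heights enters: it gives
    \<open>S^2 <= m n < m^2\<close>.\<close>
  have mn: "m - n = h - k" by (simp add: m_def n_def algebra_simps)
  have smn: "S\<^sup>2 + W\<^sup>2 = m * n"
    using SW by (simp add: m_def n_def power2_eq_square algebra_simps)
  have "S\<^sup>2 \<le> m * n" using smn by (metis add_increasing2 order_refl zero_le_power2 le_add_same_cancel1)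
  also have "m * n < m\<^sup>2" using m mn hk by (simp add: power2_eq_square)
  finally have "S < m" using m by (metis abs_ge_self abs_of_pos le_less_trans power2_less_imp_less abs_le_square_iff not_le)
  then show "m - S > 0" by simp
  have Dmn: "D = m + n - 2 * S" by (simp add: D_def m_def n_def algebra_simps)
  have mD: "(m - S)\<^sup>2 + W\<^sup>2 = m * D"
    using smn unfolding Dmn by algebra
  have "m * D > 0" using \<open>S < m\<close> unfolding mD[symmetric] by (simp add: add_pos_nonneg)
  then have D: "D > 0" using m by (simp add: zero_less_mult_iff)
  then show "1/2 - 2 * (S + h * k) > 0" by (simp add: D_def)
  have "(((\<alpha> - \<beta>) * S) * (m - S) + W * (- ((\<alpha> - \<beta>) * W))) = (\<alpha> - \<beta>) * (S - n) * m"
    using smn by algebra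
  then have "- ((((\<alpha> - \<beta>) * S) * (m - S) + W * (- ((\<alpha> - \<beta>) * W))) / ((m - S)\<^sup>2 + W\<^sup>2)) = - ((\<alpha> - \<beta>) * (S - n) / D)"
    unfolding mD using m D by simp
  moreover have "2 * (\<alpha> * (k / 4 - (S + h * k) * h) + \<beta> * (h / 4 - (S + h * k) * k)) =
     - ((\<alpha> - \<beta>) * (S - n)) + (\<beta> * (1/2 + k) - \<alpha> * (1/2 - h)) * D"
    by (simp add: D_def n_def field_simps)
  ultimately show "- ((((\<alpha> - \<beta>) * S) * (m - S) + W * (- ((\<alpha> - \<beta>) * W))) / ((m - S)\<^sup>2 + W\<^sup>2)) + (\<beta> * (1/2 + k) - \<alpha> * (1/2 - h)) =
      2 * (\<alpha> * (k / 4 - (S + h * k) * h) + \<beta> * (h / 4 - (S + h * k) * k)) / (1/2 - 2 * (S + h * k))"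
    unfolding D_def[symmetric] using D by (simp add: add_divide_distrib diff_divide_distrib)
qed

lemma S2_third_bounds: "x \<in> S2 \<Longrightarrow> - 1/2 \<le> x$3" "x \<in> S2 \<Longrightarrow> x$3 \<le> 1/2"
proof -
  assume "x \<in> S2"
  then have "(x$3)\<^sup>2 \<le> (1/2)\<^sup>2" unfolding S2_iff by (simp add: power_divide) (smt (verit) zero_le_power2)
  then have "\<bar>x$3\<bar> \<le> 1/2" by (metis abs_le_square_iff abs_of_nonneg zero_le_divide_1_iff zero_le_numeral)
  then show "- 1/2 \<le> x$3" "x$3 \<le> 1/2" by auto
qed

text \<open>\<open>rate\<close> differs from the derivative of the angle by a number that depends on
  angular speeds and heights only, hence is constant in time. It is the part of \<open>rate\<close>
  that is not the change of an angle.\<close>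

lemma gap_angle_derivative:
  assumes x: "(x has_vector_derivative \<alpha> *\<^sub>R spinz (x t)) (at t within T)" "x t \<in> S2"
    and y: "(y has_vector_derivative \<beta> *\<^sub>R spinz (y t)) (at t within T)" "y t \<in> S2"
    and c3: "\<And>s. x s $ 3 = h" "\<And>s. y s $ 3 = k" and hk: "h > k"
  shows "((\<lambda>t. gap_angle (x t) (y t) + t * (\<beta> * (1/2 + k) - \<alpha> * (1/2 - h))) has_real_derivative
    rate (x t) (\<alpha> *\<^sub>R spinz (x t)) (y t) (\<beta> *\<^sub>R spinz (y t))) (at t within T)"
proof -
  have nth: "((\<lambda>t. z t $ i) has_real_derivative (c *\<^sub>R spinz (z t)) $ i) (at t within T)"
    if "(z has_vector_derivative c *\<^sub>R spinz (z t)) (at t within T)" for z c i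
    using bounded_linear.has_vector_derivative[OF bounded_linear_vec_nth that]
    by (simp add: has_real_derivative_iff_has_vector_derivative)
  have x1: "((\<lambda>t. x t $ 1) has_real_derivative - \<alpha> * x t $ 2) (at t within T)"
    and x2: "((\<lambda>t. x t $ 2) has_real_derivative \<alpha> * x t $ 1) (at t within T)"
    and y1: "((\<lambda>t. y t $ 1) has_real_derivative - \<beta> * y t $ 2) (at t within T)"
    and y2: "((\<lambda>t. y t $ 2) has_real_derivative \<beta> * y t $ 1) (at t within T)"
    using nth[OF x(1), of 1] nth[OF x(1), of 2] nth[OF y(1), of 1] nth[OF y(1), of 2] by simp_all
  define S where "S t = x t $ 1 * y t $ 1 + x t $ 2 * y t $ 2" for t
  define W where "W t = x t $ 2 * y t $ 1 - x t $ 1 * y t $ 2" for t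
  define m where "m = (1/2 + h) * (1/2 - k)"
  have S': "(S has_real_derivative - ((\<alpha> - \<beta>) * W t)) (at t within T)"
    unfolding S_def W_def
    by (rule DERIV_cong[OF DERIV_add[OF DERIV_mult[OF x1 y1] DERIV_mult[OF x2 y2]]]) (simp add: algebra_simps)
  have W': "(W has_real_derivative (\<alpha> - \<beta>) * S t) (at t within T)"
    unfolding S_def W_def
    by (rule DERIV_cong[OF DERIV_diff[OF DERIV_mult[OF x2 y1] DERIV_mult[OF x1 y2]]]) (simp add: algebra_simps)
  have rel: "(x t $ 1)\<^sup>2 + (x t $ 2)\<^sup>2 = 1/4 - h\<^sup>2" "(y t $ 1)\<^sup>2 + (y t $ 2)\<^sup>2 = 1/4 - k\<^sup>2"
    using x(2) y(2) by (simp_all add: S2_iff c3)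
  have SW: "(S t)\<^sup>2 + (W t)\<^sup>2 = (1/4 - h\<^sup>2) * (1/4 - k\<^sup>2)"
    unfolding rel[symmetric] S_def W_def by algebra
  have b: "h \<le> 1/2" "k \<ge> - 1/2"
    using S2_third_bounds[OF x(2)] S2_third_bounds[OF y(2)] by (simp_all add: c3)
  note rp = rotating_pair[OF hk b SW, folded m_def]
  have q: "((\<lambda>t. W t / (m - S t)) has_real_derivative
      (((\<alpha> - \<beta>) * S t) * (m - S t) - W t * (0 - - ((\<alpha> - \<beta>) * W t))) / ((m - S t) * (m - S t))) (at t within T)"
    by (rule DERIV_divide[OF W' DERIV_diff[OF DERIV_const S']]) (use rp(1) in simp)
  have "((\<lambda>t. - arctan (W t / (m - S t)) + t * (\<beta> * (1/2 + k) - \<alpha> * (1/2 - h))) has_real_derivative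
     - (inverse (1 + (W t / (m - S t))\<^sup>2) * ((((\<alpha> - \<beta>) * S t) * (m - S t) - W t * (0 - - ((\<alpha> - \<beta>) * W t))) / ((m - S t) * (m - S t))))
      + 1 * (\<beta> * (1/2 + k) - \<alpha> * (1/2 - h))) (at t within T)"
    by (intro DERIV_add DERIV_minus DERIV_cmult_right DERIV_ident DERIV_chain2[OF DERIV_arctan q])
  moreover have "(\<lambda>t. gap_angle (x t) (y t) + t * (\<beta> * (1/2 + k) - \<alpha> * (1/2 - h))) =
      (\<lambda>t. - arctan (W t / (m - S t)) + t * (\<beta> * (1/2 + k) - \<alpha> * (1/2 - h)))"
    by (simp add: gap_angle_def W_def S_def m_def c3)
  moreover have "- (inverse (1 + (W t / (m - S t))\<^sup>2) * ((((\<alpha> - \<beta>) * S t) * (m - S t) - W t * (0 - - ((\<alpha> - \<beta>) * W t))) / ((m - S t) * (m - S t))))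
      + 1 * (\<beta> * (1/2 + k) - \<alpha> * (1/2 - h)) = rate (x t) (\<alpha> *\<^sub>R spinz (x t)) (y t) (\<beta> *\<^sub>R spinz (y t))"
  proof -
    define d where "d = m - S t"
    have d: "d > 0" using rp(1) by (simp add: d_def)
    have "inverse (1 + (W t / d)\<^sup>2) / (d * d) = 1 / (d\<^sup>2 + (W t)\<^sup>2)"
    proof -
      have "1 + (W t / d)\<^sup>2 = (d\<^sup>2 + (W t)\<^sup>2) / (d * d)"
        using d by (simp add: add_divide_distrib power2_eq_square)
      then show ?thesis using d by simp
    qed
    then have "inverse (1 + (W t / d)\<^sup>2) * ((((\<alpha> - \<beta>) * S t) * d - W t * (0 - - ((\<alpha> - \<beta>) * W t))) / (d * d)) =
      (((\<alpha> - \<beta>) * S t) * d + W t * (- ((\<alpha> - \<beta>) * W t))) / (d\<^sup>2 + (W t)\<^sup>2)"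
    proof -
      assume h: "inverse (1 + (W t / d)\<^sup>2) / (d * d) = 1 / (d\<^sup>2 + (W t)\<^sup>2)"
      have "inverse (1 + (W t / d)\<^sup>2) * (N / (d * d)) = N * (inverse (1 + (W t / d)\<^sup>2) / (d * d))" for N
        by simp
      then show ?thesis unfolding h by simp
    qed
    moreover have "rate (x t) (\<alpha> *\<^sub>R spinz (x t)) (y t) (\<beta> *\<^sub>R spinz (y t)) =
      2 * (\<alpha> * (k / 4 - (S t + h * k) * h) + \<beta> * (h / 4 - (S t + h * k) * k)) / (1/2 - 2 * (S t + h * k))"
    proof -
      have "y t \<bullet> cross3 (x t) (\<alpha> *\<^sub>R spinz (x t)) = \<alpha> * (k / 4 - (S t + h * k) * h)"
        unfolding inner_real3 cross3_nth S_def c3 using rel by (simp add: c3) algebra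
      moreover have "x t \<bullet> cross3 (y t) (\<beta> *\<^sub>R spinz (y t)) = \<beta> * (h / 4 - (S t + h * k) * k)"
        unfolding inner_real3 cross3_nth S_def c3 using rel by (simp add: c3) algebra
      moreover have "(norm (x t - y t))\<^sup>2 = 1/2 - 2 * (S t + h * k)"
        unfolding norm_sq_real3 S_def using rel by (simp add: c3) algebra
      ultimately show ?thesis unfolding rate_def by simp
    qed
    ultimately show ?thesis using rp(3)[of \<alpha> \<beta>] unfolding d_def by simp
  qed
  ultimately show ?thesis by simp
qed

text \<open>All rotation is confined to heights between 0 and 1/4. Heights range over
  \<open>[-1/2, 1/2]\<close>, so one free band remains above for \<open>x1\<close> and two below for
  \<open>x3\<close> and \<open>x4\<close>.\<close>

locale bands =
  fixes l r :: "'d::finite \<Rightarrow> real"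
  assumes lr: "0 \<le> l i" "l i < r i" "r i \<le> 1/4"
    and disjoint: "i \<noteq> j \<Longrightarrow> r i \<le> l j \<or> r j \<le> l i"
begin

definition bump :: "'d \<Rightarrow> real \<Rightarrow> real" where
  "bump i h = flat (h - l i) * flat (r i - h)"

definition prof :: "real^'d \<Rightarrow> real \<Rightarrow> real" where
  "prof u h = (\<Sum>i\<in>UNIV. u$i * bump i h)"

definition embed :: "real^'d \<Rightarrow> real^3 \<Rightarrow> real^3" where
  "embed u = restrict (twist (prof u)) S2"

definition straight :: "real^'d \<Rightarrow> real^'d \<Rightarrow> real \<Rightarrow> real^3 \<Rightarrow> real^3" where
  "straight v u t = embed (v + t *\<^sub>R u)"

lemma bump_bounds: "0 \<le> bump i h" "bump i h \<le> 1"
proof -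
  have "0 \<le> flat y \<and> flat y \<le> 1" for y by (simp add: flat_def)
  then show "0 \<le> bump i h" "bump i h \<le> 1" unfolding bump_def by (auto intro: mult_le_one)
qed

lemma bump_pos_iff: "bump i h > 0 \<longleftrightarrow> l i < h \<and> h < r i"
  by (auto simp: bump_def flat_def zero_less_mult_iff)

lemma bump_eq_0: "\<not> (l i < h \<and> h < r i) \<Longrightarrow> bump i h = 0"
  using bump_pos_iff bump_bounds(1) by (metis order_le_less)

lemma prof_add: "prof (u + v) h = prof u h + prof v h"
  by (simp add: prof_def distrib_right sum.distrib)

lemma prof_scaleR: "prof (c *\<^sub>R u) h = c * prof u h"
  by (simp add: prof_def sum_distrib_left mult.assoc)

lemma prof_0: "prof 0 h = 0"
  by (simp add: prof_def)

lemma abs_prof_le: "\<bar>prof u h\<bar> \<le> l1_norm u"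
proof -
  have "\<bar>prof u h\<bar> \<le> (\<Sum>i\<in>UNIV. \<bar>u$i * bump i h\<bar>)"
    unfolding prof_def by (rule sum_abs)
  also have "\<dots> \<le> (\<Sum>i\<in>UNIV. \<bar>u$i\<bar>)"
    by (intro sum_mono) (use bump_bounds in \<open>simp add: abs_mult mult_left_le\<close>)
  finally show ?thesis by (simp add: l1_norm_def)
qed

lemma smooth_bump:
  assumes "smooth f"
  shows "smooth (\<lambda>x. bump i (f x))"
  unfolding bump_def by (intro smooth_mult smooth_flat smooth_diff smooth_const assms)

lemma prof_differentiable: "prof u differentiable (at h)"
proof -
  have "smooth (prof u)"
    unfolding prof_def[abs_def]
    by (intro smooth_sum smooth_mult smooth_const smooth_bump smooth_bounded_linear bounded_linear_ident) simp
  then have "Ck_on (Suc 0) UNIV (prof u)" by blast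
  then show ?thesis by simp
qed

lemma smooth_nth: "smooth (\<lambda>x::real^3. x $ i)"
  by (rule smooth_bounded_linear) (rule bounded_linear_vec_nth)

lemma smooth_on_embed: "smooth_on S2 (embed u)"
proof (rule smooth_imp_smooth_on)
  show "smooth (\<lambda>x. rotz (\<Sum>i\<in>UNIV. u$i * bump i (x$3)) x)"
    by (intro smooth_rotz smooth_sum smooth_mult smooth_const smooth_bump smooth_nth) simp
qed (simp add: embed_def twist_def prof_def)

lemma embed_S2: "x \<in> S2 \<Longrightarrow> embed u x \<in> S2"
  by (simp add: embed_def twist_S2)

lemma embed_embed: "x \<in> S2 \<Longrightarrow> embed u (embed v x) = embed (u + v) x"
  by (simp add: embed_def twist_S2 twist_twist) (simp add: twist_def prof_add)

lemma embed_0: "x \<in> S2 \<Longrightarrow> embed 0 x = x"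
  by (simp add: embed_def twist_def prof_0 rotz_0)

lemma embed_bij: "bij_betw (embed u) S2 S2"
  by (rule bij_betw_byWitness[where f' = "embed (- u)"]) (auto simp: embed_embed embed_0 embed_S2)

lemma inv_into_embed:
  assumes "x \<in> S2" shows "inv_into S2 (embed u) x = embed (- u) x"
  by (rule inv_into_f_eq[OF bij_betw_imp_inj_on[OF embed_bij]]) (use assms in \<open>auto simp: embed_embed embed_0 embed_S2\<close>)

lemma smooth_on_cong: "(\<And>x. x \<in> S \<Longrightarrow> f x = g x) \<Longrightarrow> smooth_on S f \<longleftrightarrow> smooth_on S g"
  unfolding smooth_on_def by (intro ball_cong refl ex_cong1) auto

lemma embed_Diff_area: "embed u \<in> carrier Diff_area"
proof -
  have "preserves_area (embed u)"
    by (rule twist_preserves_area[OF prof_differentiable]) (simp add: embed_def)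
  moreover have "smooth_on S2 (inv_into S2 (embed u))"
    using smooth_on_embed[of "- u"] smooth_on_cong[of S2 "embed (- u)"] inv_into_embed by metis
  moreover have "embed u \<in> extensional S2" by (simp add: embed_def)
  ultimately show ?thesis
    using embed_bij smooth_on_embed by (simp add: Diff_area_iff)
qed

lemma embed_hom: "embed \<in> hom vector_group Diff_area"
proof (rule homI)
  fix u v
  have "embed u \<in> Bij S2" "embed v \<in> Bij S2"
    using embed_Diff_area by (auto simp: Diff_area_def)
  then have "embed u \<otimes>\<^bsub>Diff_area\<^esub> embed v = compose S2 (embed u) (embed v)"
    by (simp add: Diff_area_def BijGroup_def)
  also have "\<dots> = embed (u + v)"
  proof
    fix x show "compose S2 (embed u) (embed v) x = embed (u + v) x"
      using embed_embed[of x u v] by (cases "x \<in> S2") (auto simp: compose_def embed_def)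
  qed
  finally show "embed (u \<otimes>\<^bsub>vector_group\<^esub> v) = embed u \<otimes>\<^bsub>Diff_area\<^esub> embed v"
    by (simp add: vector_group_def)
qed (rule embed_Diff_area)

lemma straight_smooth_paths: "straight v u \<in> smooth_paths (embed v) (embed (v + u))"
proof -
  have n: "smooth (\<lambda>z::real \<times> (real^3). snd z $ i)" for i
    by (intro smooth_bounded_linear bounded_linear_compose[OF bounded_linear_vec_nth bounded_linear_snd])
  have f: "smooth (\<lambda>z::real \<times> (real^3). fst z)"
    by (intro smooth_bounded_linear bounded_linear_fst)
  have "smooth_on ({0..1} \<times> S2) (\<lambda>(t, x). straight v u t x)"
  proof (rule smooth_imp_smooth_on)
    show "smooth (\<lambda>z::real \<times> (real^3). rotz (\<Sum>i\<in>UNIV. (v$i + fst z * u$i) * bump i (snd z $ 3)) (snd z))"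
      by (intro smooth_rotz smooth_sum smooth_mult smooth_add smooth_const smooth_bump n f) simp
  qed (auto simp: straight_def embed_def twist_def prof_def)
  moreover have "straight v u 0 = embed v" "straight v u 1 = embed (v + u)" "straight v u t \<in> carrier Diff_area" for t
    by (simp_all add: straight_def embed_Diff_area)
  ultimately show ?thesis by (simp add: smooth_paths_def)
qed

lemma straight_has_derivative:
  assumes x: "x \<in> S2"
  shows "((\<lambda>s. straight v u s x) has_vector_derivative prof u (x$3) *\<^sub>R spinz (straight v u t x)) (at t within T)"
proof -
  let ?s = "\<lambda>s. prof v (x$3) + s * prof u (x$3)"
  have eq: "straight v u s x = rotz (?s s) x" for s
    using x by (simp add: straight_def embed_def twist_def prof_add prof_scaleR)
  have d: "(?s has_real_derivative prof u (x$3)) (at t within T)"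
    by (auto intro!: derivative_eq_intros)
  have C: "((\<lambda>s. cos (?s s)) has_vector_derivative - sin (?s t) * prof u (x$3)) (at t within T)"
    using DERIV_chain2[OF DERIV_cos d] by (simp only: has_real_derivative_iff_has_vector_derivative)
  have S: "((\<lambda>s. sin (?s s)) has_vector_derivative cos (?s t) * prof u (x$3)) (at t within T)"
    using DERIV_chain2[OF DERIV_sin d] by (simp only: has_real_derivative_iff_has_vector_derivative)
  \<comment> \<open>The height of \<open>x\<close> is constant along the path, so the motion is
    linear in the cosine and sine of one angle.\<close>
  define G where "G c s = (c * x$1 - s * x$2) *\<^sub>R axis 1 1 + (s * x$1 + c * x$2) *\<^sub>R (axis 2 1 :: real^3)" for c s
  have G: "bounded_linear (\<lambda>p. G (fst p) (snd p))"
    unfolding linear_conv_bounded_linear[symmetric] G_def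
    by (rule linearI) (simp_all add: vec_eq_iff forall_3 axis_def algebra_simps)
  have "((\<lambda>s. G (cos (?s s)) (sin (?s s)) + x$3 *\<^sub>R axis 3 1) has_vector_derivative
     G (- sin (?s t) * prof u (x$3)) (cos (?s t) * prof u (x$3)) + 0) (at t within T)"
    using bounded_linear.has_vector_derivative[OF G has_vector_derivative_Pair[OF C S]]
    by (intro has_vector_derivative_add has_vector_derivative_const) simp
  moreover have "G (cos (?s s)) (sin (?s s)) + x$3 *\<^sub>R axis 3 1 = straight v u s x" for s
    unfolding eq rotz_def G_def ..
  moreover have "G (- sin (?s t) * prof u (x$3)) (cos (?s t) * prof u (x$3)) + 0 = prof u (x$3) *\<^sub>R spinz (straight v u t x)"
    unfolding eq by (simp add: vec_eq_iff forall_3 G_def axis_def algebra_simps)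
  ultimately show ?thesis by simp
qed

lemma straight_vel:
  assumes "x \<in> S2" "t \<in> {0..1}"
  shows "vel (straight v u) t x = prof u (x$3) *\<^sub>R spinz (straight v u t x)"
  unfolding vel_def
  by (rule vector_derivative_within_closed_interval[OF _ _ straight_has_derivative]) (use assms in auto)

lemma straight_nth3: "x \<in> S2 \<Longrightarrow> straight v u t x $ 3 = x $ 3"
  by (simp add: straight_def embed_def)

lemma theta_straight:
  assumes x: "x \<in> S2" and y: "y \<in> S2" and xy: "x$3 > y$3"
  shows "theta (straight v u) x y = prof u (y$3) * (1/2 + y$3) - prof u (x$3) * (1/2 - x$3) +
    gap_angle (embed (v + u) x) (embed (v + u) y) - gap_angle (embed v x) (embed v y)"
proof -
  let ?c = "prof u (y$3) * (1/2 + y$3) - prof u (x$3) * (1/2 - x$3)"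
  let ?g = "\<lambda>t. gap_angle (straight v u t x) (straight v u t y) + t * ?c"
  have S: "straight v u t z \<in> S2" if "z \<in> S2" for t z
    using that by (simp add: straight_def embed_S2)
  have "((\<lambda>t. rate (straight v u t x) (vel (straight v u) t x) (straight v u t y) (vel (straight v u) t y))
      has_integral (?g 1 - ?g 0)) {0..1}"
  proof (rule fundamental_theorem_of_calculus)
    fix t :: real assume t: "t \<in> {0..1}"
    show "(?g has_vector_derivative rate (straight v u t x) (vel (straight v u) t x) (straight v u t y) (vel (straight v u) t y)) (at t within {0..1})"
      unfolding straight_vel[OF x t] straight_vel[OF y t] has_real_derivative_iff_has_vector_derivative[symmetric]
      by (rule gap_angle_derivative) (use x y xy straight_nth3 S in \<open>auto intro: straight_has_derivative\<close>)
  qed simp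
  then show ?thesis unfolding theta_def by (simp add: integral_unique straight_def)
qed

text \<open>The speed is at most \<open>l1_norm u\<close> everywhere, since bump functions and the
  field \<open>spinz\<close> on the sphere are bounded by 1.\<close>

lemma Lp_length_straight_le:
  assumes p: "p > 0"
  shows "Lp_length p (straight v u) \<le> (2 * pi) powr (1 / p) * l1_norm u"
proof -
  interpret A: area_isotopy "straight v u"
    by (rule smooth_paths_area_isotopy[OF straight_smooth_paths])
  have l1: "0 \<le> l1_norm u" by (simp add: l1_norm_def sum_nonneg)
  have norm_spinz: "norm (spinz x) \<le> 1" if "x \<in> S2" for x
  proof -
    have "(norm (spinz x))\<^sup>2 \<le> 1\<^sup>2" using that unfolding norm_sq_real3 S2_iff by simp (smt (verit) zero_le_power2)
    then show ?thesis by (rule power2_le_imp_le) simp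
  qed
  have gen: "norm (generating_field (straight v u) t x) \<le> l1_norm u" if t: "t \<in> {0..1}" and x: "x \<in> S2" for t x
  proof -
    have y: "inv_into S2 (straight v u t) x \<in> S2" using x A.surj[OF t] by (metis inv_into_into)
    have eq: "generating_field (straight v u) t x = prof u (inv_into S2 (straight v u t) x $ 3) *\<^sub>R
        spinz (straight v u t (inv_into S2 (straight v u t) x))"
      by (simp add: generating_field_def vel_def[symmetric] straight_vel[OF y t])
    have "norm (generating_field (straight v u) t x) \<le> l1_norm u * 1"
      unfolding eq norm_scaleR by (intro mult_mono abs_prof_le norm_spinz A.maps_to[OF t y] l1) simp
    then show ?thesis by simp
  qed
  have inner: "(LINT x:S2|area_measure. norm (generating_field (straight v u) t x) powr p) \<le> 2 * pi * l1_norm u powr p"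
    if t: "t \<in> {0..1}" for t
  proof -
    have "(LINT x:S2|area_measure. norm (generating_field (straight v u) t x) powr p) \<le> (\<integral>x. l1_norm u powr p \<partial>area_measure)"
      unfolding set_lebesgue_integral_def
    \<comment> \<open>A non-integrable left side would have integral 0, still below the nonnegative
      bound.\<close>
    proof (rule integral_mono')
      show "indicator S2 x *\<^sub>R norm (generating_field (straight v u) t x) powr p \<le> l1_norm u powr p" for x
        using gen[OF t, of x] p by (auto simp: indicator_def intro!: powr_mono2)
    qed auto
    then show ?thesis by (simp add: measure_def emeasure_area_measure_UNIV)
  qed
  have "Lp_length p (straight v u) \<le> (\<integral>t. indicator {0..1} t * ((2 * pi) powr (1 / p) * l1_norm u) \<partial>(lborel :: real measure))"
    unfolding Lp_length_def set_lebesgue_integral_def[of lborel]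
  proof (rule integral_mono')
    fix t :: real
    show "indicator {0..1} t *\<^sub>R (LINT x:S2|area_measure. norm (generating_field (straight v u) t x) powr p) powr (1 / p)
      \<le> indicator {0..1} t * ((2 * pi) powr (1 / p) * l1_norm u)"
    proof (cases "t \<in> {0..1}")
      case True
      have "0 \<le> (LINT x:S2|area_measure. norm (generating_field (straight v u) t x) powr p)"
        unfolding set_lebesgue_integral_def by (rule integral_nonneg_AE) auto
      then have "(LINT x:S2|area_measure. norm (generating_field (straight v u) t x) powr p) powr (1 / p)
        \<le> (2 * pi * l1_norm u powr p) powr (1 / p)"
        using inner[OF True] p by (intro powr_mono2) auto
      also have "\<dots> = (2 * pi) powr (1 / p) * l1_norm u"
        using p l1 by (simp add: powr_mult powr_powr)
      finally show ?thesis using True by simp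
    qed simp
  qed (use l1 in auto)
  then show ?thesis by simp
qed

end

section \<open>Averages over bands\<close>

definition band :: "real \<Rightarrow> real \<Rightarrow> (real^3) set" where
  "band a b = {x \<in> S2. a < x$3 \<and> x$3 < b}"

lemma nth_measurable: "(\<lambda>v::real^3. v $ i) \<in> borel_measurable borel"
  by (intro borel_measurable_continuous_onI continuous_intros)

lemma band_borel [measurable]: "band a b \<in> sets borel"
proof -
  note [measurable] = nth_measurable S2_borel
  have "band a b = S2 \<inter> {x \<in> space borel. a < x$3 \<and> x$3 < b}" by (auto simp: band_def)
  also have "\<dots> \<in> sets borel" using S2_borel by measurable
  finally show ?thesis .
qed

text \<open>In the chart the band is open and, by the point at height \<open>h\<close>, nonempty;
  and the density is positive.\<close>

lemma emeasure_band_pos: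
  assumes "a < h" "h < b" "-1/2 < h" "h < 1/2"
  shows "emeasure area_measure (band a b) \<noteq> 0"
proof
  assume 0: "emeasure area_measure (band a b) = 0"
  define V where "V = {v. a < chart2 v $ 3 \<and> chart2 v $ 3 < b}"
  have V: "open V"
    unfolding V_def by (intro open_Collect_conj open_Collect_less continuous_intros chart2_continuous)
  \<comment> \<open>A point of the sphere at height \<open>h\<close>; \<open>h > -1/2\<close> keeps
    it off the pole that the chart misses.\<close>
  define x :: "real^3" where "x = vector [sqrt (1/4 - h\<^sup>2), 0, h]"
  have "\<bar>h\<bar> \<le> 1/2" using assms by simp
  then have "h\<^sup>2 \<le> 1/4" using abs_le_square_iff[of h "1/2"] by (simp add: power_divide)
  then have "x \<in> S2" by (simp add: x_def S2_iff)
  moreover have "x \<noteq> vector [0, 0, - (1/2)]" using assms by (auto simp: x_def vec_eq_iff forall_3)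
  ultimately have "unchart x \<in> V" using assms by (simp add: V_def chart2_unchart x_def)
  then have "\<not> negligible V" using open_not_negligible[OF V] by blast
  have "0 = (\<integral>\<^sup>+x. indicator (band a b) x \<partial>area_measure)" using 0 by simp
  also have "\<dots> = (\<integral>\<^sup>+v. ennreal (dens v) * indicator (band a b) (chart2 v) \<partial>lborel)"
    by (rule nn_integral_area_measure) simp
  finally have "(\<integral>\<^sup>+v. ennreal (dens v) * indicator (band a b) (chart2 v) \<partial>lborel) = 0" ..
  moreover have nz: "ennreal (dens v) \<noteq> 0" for v
    using dens_pos[of v] by (simp add: ennreal_eq_0_iff not_le)
  ultimately have "AE v in lborel. ennreal (dens v) * indicator (band a b) (chart2 v) = 0"
    by (subst (asm) nn_integral_0_iff_AE) auto
  then have "AE v in lborel. v \<notin> V"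
    by eventually_elim (auto simp: nz V_def band_def chart2_S2 indicator_def split: if_splits)
  then have "emeasure lborel V = 0"
    using V by (subst (asm) AE_iff_measurable[OF _ refl]) (auto simp: borel_open)
  then have "negligible V"
    using V by (simp add: negligible_iff_null_sets null_sets_def emeasure_completion borel_open)
  with \<open>\<not> negligible V\<close> show False ..
qed

definition unif :: "(real^3) set \<Rightarrow> (real^3) measure" where
  "unif B = uniform_measure area_measure B"

lemma sets_unif [measurable_cong, simp]: "sets (unif B) = sets borel"
  by (simp add: unif_def)

lemma space_unif [simp]: "space (unif B) = UNIV"
  by (simp add: unif_def)

lemma AE_unif:
  assumes "B \<in> sets borel"
  shows "AE x in unif B. x \<in> B"
  unfolding unif_def using assms by (intro AE_uniform_measureI) auto

lemma emeasure_unif_UNIV: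
  assumes "B \<in> sets borel" "emeasure area_measure B \<noteq> 0"
  shows "emeasure (unif B) UNIV = 1"
  unfolding unif_def using assms by (subst emeasure_uniform_measure) (auto simp: area.emeasure_finite less_top[symmetric] intro!: ennreal_divide_self)

lemma nn_integral_unif_le:
  assumes [measurable]: "B \<in> sets borel" "f \<in> borel_measurable borel"
  shows "(\<integral>\<^sup>+x. f x \<partial>unif B) \<le> (\<integral>\<^sup>+x. f x \<partial>area_measure) / emeasure area_measure B"
proof -
  have "(\<integral>\<^sup>+x. f x \<partial>unif B) = (\<integral>\<^sup>+x. f x * indicator B x \<partial>area_measure) / emeasure area_measure B"
    unfolding unif_def by (rule nn_integral_uniform_measure) auto
  also have "\<dots> \<le> (\<integral>\<^sup>+x. f x \<partial>area_measure) / emeasure area_measure B"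
    by (intro divide_right_mono_ennreal nn_integral_mono) (auto simp: indicator_def)
  finally show ?thesis .
qed

lemma distr_unif:
  assumes f: "f \<in> borel_measurable borel" "distr area_measure borel f = area_measure"
    and B: "B \<in> sets borel" "\<And>x. x \<in> S2 \<Longrightarrow> f x \<in> B \<longleftrightarrow> x \<in> B"
  shows "distr (unif B) borel f = unif B"
proof (rule measure_eqI)
  fix X assume "X \<in> sets (distr (unif B) borel f)"
  then have X [measurable]: "X \<in> sets borel" by simp
  note [measurable] = f(1) B(1)
  have "emeasure area_measure (B \<inter> f -` X) = emeasure area_measure (f -` (B \<inter> X))"
    by (rule emeasure_eq_AE) (use AE_area_measure_S2 B(2) measurable_sets[OF f(1) X] measurable_sets[OF f(1), of "B \<inter> X"] in auto)
  also have "\<dots> = emeasure (distr area_measure borel f) (B \<inter> X)"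
    by (subst emeasure_distr) auto
  finally have "emeasure area_measure (B \<inter> f -` X) = emeasure area_measure (B \<inter> X)" by (simp add: f(2))
  moreover have "f \<in> unif B \<rightarrow>\<^sub>M borel" using f(1) by (simp cong: measurable_cong_sets)
  ultimately show "emeasure (distr (unif B) borel f) X = emeasure (unif B) X"
    using measurable_sets[OF f(1) X] by (simp add: emeasure_distr unif_def)
qed simp

text \<open>The same map moves both variables, but each measure is invariant by itself, so the
  substitution can be made in one integral after the other.\<close>

lemma integral_diagonal_invariant:
  assumes f [measurable]: "f \<in> borel_measurable borel"
    and M: "sets M = sets borel" "distr M borel f = M" and N: "sets N = sets borel" "distr N borel f = N" "sigma_finite_measure N"
    and G [measurable]: "(\<lambda>(x, y). G x y) \<in> borel_measurable (borel \<Otimes>\<^sub>M borel)"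
  shows "(\<integral>x. \<integral>y. G (f x) (f y) \<partial>N \<partial>M) = (\<integral>x. \<integral>y. G x y \<partial>N \<partial>M :: real)"
proof -
  interpret N: sigma_finite_measure N by fact
  note [measurable_cong] = M(1) N(1)
  have [measurable]: "G x \<in> borel_measurable borel" for x
    using measurable_compose[OF measurable_Pair1' G, of x] by simp
  have "(\<integral>y. G (f x) (f y) \<partial>N) = (\<integral>y. G (f x) y \<partial>N)" for x
  proof -
    have "(\<integral>y. G (f x) y \<partial>distr N borel f) = (\<integral>y. G (f x) (f y) \<partial>N)"
      by (rule integral_distr) (use f N(1) in \<open>simp_all cong: measurable_cong_sets\<close>)
    then show ?thesis by (simp add: N(2))
  qed
  then have "(\<integral>x. \<integral>y. G (f x) (f y) \<partial>N \<partial>M) = (\<integral>x. (\<lambda>x. \<integral>y. G x y \<partial>N) (f x) \<partial>M)" by simp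
  also have "\<dots> = (\<integral>x. (\<integral>y. G x y \<partial>N) \<partial>distr M borel f)"
  proof (rule integral_distr[symmetric])
    show "f \<in> M \<rightarrow>\<^sub>M borel" using f M(1) by (simp cong: measurable_cong_sets)
    have "(\<lambda>(x, y). G x y) \<in> borel_measurable (borel \<Otimes>\<^sub>M N)"
      using G by (simp cong: measurable_cong_sets sets_pair_measure_cong add: N(1))
    then show "(\<lambda>x. \<integral>y. G x y \<partial>N) \<in> borel_measurable borel"
      by (rule N.borel_measurable_lebesgue_integral)
  qed
  finally show ?thesis by (simp add: M(2))
qed

lemma bounded_integrable:
  fixes f :: "real^3 \<Rightarrow> real"
  assumes "finite_measure N" "sets N = sets borel" "f \<in> borel_measurable borel" "\<And>x. \<bar>f x\<bar> \<le> B"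
  shows "integrable N f"
  using assms by (intro finite_measure.integrable_const_bound[of N _ B]) (auto cong: measurable_cong_sets)

lemma abs_integral_le:
  fixes f :: "real^3 \<Rightarrow> real"
  assumes "emeasure N UNIV = 1" "sets N = sets borel" "f \<in> borel_measurable borel" "\<And>x. \<bar>f x\<bar> \<le> B"
  shows "\<bar>\<integral>x. f x \<partial>N\<bar> \<le> B"
proof -
  have sp: "space N = UNIV" using sets_eq_imp_space_eq[OF assms(2)] by simp
  have fin: "finite_measure N" by (rule finite_measureI) (simp add: sp assms(1))
  have "\<bar>\<integral>x. f x \<partial>N\<bar> \<le> (\<integral>x. \<bar>f x\<bar> \<partial>N)" by (rule integral_abs_bound)
  also have "\<dots> \<le> (\<integral>x. B \<partial>N)"
    using bounded_integrable[OF fin assms(2-4)] assms(4) finite_measure.integrable_const[OF fin]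
    by (intro integral_mono integrable_abs) auto
  also have "\<dots> = B" by (simp add: sp measure_def assms(1))
  finally show ?thesis .
qed

lemma measurable_section:
  assumes "(\<lambda>(x, y). G x y) \<in> borel_measurable (borel \<Otimes>\<^sub>M borel)"
  shows "G x \<in> borel_measurable borel" "(\<lambda>y. G y x) \<in> borel_measurable borel"
proof -
  have "(\<lambda>y. (x, y)) \<in> borel \<rightarrow>\<^sub>M borel \<Otimes>\<^sub>M borel" "(\<lambda>y. (y, x)) \<in> borel \<rightarrow>\<^sub>M borel \<Otimes>\<^sub>M borel"
    by simp_all
  from this[THEN measurable_compose, OF assms]
  show "G x \<in> borel_measurable borel" "(\<lambda>y. G y x) \<in> borel_measurable borel" by simp_all
qed

text \<open>The error terms \<open>D\<close> have vanishing averages, so only the difference of the averages of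
  \<open>a\<close> and \<open>b\<close> survives the integration over all four variables.\<close>

lemma average_four_points:
  fixes N1 N2 N3 N4 :: "(real^3) measure" and D12 D23 D34 D14 :: "real^3 \<Rightarrow> real^3 \<Rightarrow> real"
  assumes N: "emeasure N1 UNIV = 1" "emeasure N2 UNIV = 1" "emeasure N3 UNIV = 1" "emeasure N4 UNIV = 1"
    "sets N1 = sets borel" "sets N2 = sets borel" "sets N3 = sets borel" "sets N4 = sets borel"
    and meas: "a \<in> borel_measurable borel" "b \<in> borel_measurable borel"
      "(\<lambda>(x, y). D12 x y) \<in> borel_measurable (borel \<Otimes>\<^sub>M borel)" "(\<lambda>(x, y). D23 x y) \<in> borel_measurable (borel \<Otimes>\<^sub>M borel)"
      "(\<lambda>(x, y). D34 x y) \<in> borel_measurable (borel \<Otimes>\<^sub>M borel)" "(\<lambda>(x, y). D14 x y) \<in> borel_measurable (borel \<Otimes>\<^sub>M borel)"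
      "(\<lambda>(x, y). T x y) \<in> borel_measurable (borel \<Otimes>\<^sub>M borel)"
    and bd: "\<And>x. \<bar>a x\<bar> \<le> B" "\<And>x. \<bar>b x\<bar> \<le> B" "\<And>x y. \<bar>D12 x y\<bar> \<le> B" "\<And>x y. \<bar>D23 x y\<bar> \<le> B"
      "\<And>x y. \<bar>D34 x y\<bar> \<le> B" "\<And>x y. \<bar>D14 x y\<bar> \<le> B"
    and zero: "(\<integral>x. \<integral>y. D12 x y \<partial>N2 \<partial>N1) = 0" "(\<integral>x. \<integral>y. D23 x y \<partial>N3 \<partial>N2) = 0"
      "(\<integral>x. \<integral>y. D34 x y \<partial>N4 \<partial>N3) = 0" "(\<integral>x. \<integral>y. D14 x y \<partial>N4 \<partial>N1) = 0"
    and le: "AE x1 in N1. AE x2 in N2. AE x3 in N3. AE x4 in N4.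
      ennreal \<bar>a x2 - b x3 + D12 x1 x2 - D23 x2 x3 + D34 x3 x4 - D14 x1 x4\<bar> \<le> T x1 x2 + T x2 x3 + T x3 x4 + T x1 x4"
  shows "ennreal \<bar>(\<integral>x. a x \<partial>N2) - (\<integral>x. b x \<partial>N3)\<bar> \<le>
    (\<integral>\<^sup>+x. \<integral>\<^sup>+y. T x y \<partial>N2 \<partial>N1) + (\<integral>\<^sup>+x. \<integral>\<^sup>+y. T x y \<partial>N3 \<partial>N2) +
    (\<integral>\<^sup>+x. \<integral>\<^sup>+y. T x y \<partial>N4 \<partial>N3) + (\<integral>\<^sup>+x. \<integral>\<^sup>+y. T x y \<partial>N4 \<partial>N1)"
proof -
  have sp: "space N1 = UNIV" "space N2 = UNIV" "space N3 = UNIV" "space N4 = UNIV"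
    using N(5-8) by (auto dest: sets_eq_imp_space_eq)
  have fin: "finite_measure N1" "finite_measure N2" "finite_measure N3" "finite_measure N4"
    by (auto intro!: finite_measureI simp: sp N)
  interpret N1: finite_measure N1 by fact
  interpret N2: finite_measure N2 by fact
  interpret N3: finite_measure N3 by fact
  interpret N4: finite_measure N4 by fact
  note D1 = measurable_section(1)[OF meas(3)] measurable_section(1)[OF meas(4)]
    measurable_section(1)[OF meas(5)] measurable_section(1)[OF meas(6)]
  have one: "measure N1 UNIV = 1" "measure N2 UNIV = 1" "measure N3 UNIV = 1" "measure N4 UNIV = 1"
    by (simp_all add: measure_def N)
  define d12 d23 d34 d14 where "d12 x = (\<integral>y. D12 x y \<partial>N2)" and "d23 x = (\<integral>y. D23 x y \<partial>N3)"
    and "d34 x = (\<integral>y. D34 x y \<partial>N4)" and "d14 x = (\<integral>y. D14 x y \<partial>N4)" for x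
  have dm: "d12 \<in> borel_measurable borel" "d23 \<in> borel_measurable borel" "d34 \<in> borel_measurable borel" "d14 \<in> borel_measurable borel"
    unfolding d12_def[abs_def] d23_def[abs_def] d34_def[abs_def] d14_def[abs_def]
    by (rule N2.borel_measurable_lebesgue_integral N3.borel_measurable_lebesgue_integral N4.borel_measurable_lebesgue_integral,
      use meas N in \<open>simp cong: measurable_cong_sets sets_pair_measure_cong\<close>)+
  have db: "\<bar>d12 x\<bar> \<le> B" "\<bar>d23 x\<bar> \<le> B" "\<bar>d34 x\<bar> \<le> B" "\<bar>d14 x\<bar> \<le> B" for x
    unfolding d12_def d23_def d34_def d14_def by (rule abs_integral_le[OF _ _ D1(1)] abs_integral_le[OF _ _ D1(2)]
      abs_integral_le[OF _ _ D1(3)] abs_integral_le[OF _ _ D1(4)]; use N bd in simp)+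
  note bi = bounded_integrable[OF fin(1) N(5)] bounded_integrable[OF fin(2) N(6)]
    bounded_integrable[OF fin(3) N(7)] bounded_integrable[OF fin(4) N(8)]
  have i4: "integrable N4 (D34 x)" "integrable N4 (D14 x)" for x
    by (rule bi(4), rule D1, rule bd)+
  have i3: "integrable N3 b" "integrable N3 (D23 x)" "integrable N3 d34" for x
    by (rule bi(3)[OF meas(2) bd(2)] bi(3)[OF D1(2) bd(4)] bi(3)[OF dm(3) db(3)])+
  have i2: "integrable N2 a" "integrable N2 (D12 x)" "integrable N2 d23" for x
    by (rule bi(2)[OF meas(1) bd(1)] bi(2)[OF D1(1) bd(3)] bi(2)[OF dm(2) db(2)])+
  have i1: "integrable N1 d12" "integrable N1 d14"
    by (rule bi(1)[OF dm(1) db(1)] bi(1)[OF dm(4) db(4)])+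
  \<comment> \<open>The successive partial averages over \<open>x4\<close>, \<open>x3\<close>,
    \<open>x2\<close>. A vanishing mean drops a \<open>D\<close> term once its first variable is
    integrated too. The absolute value moves inside one integral at a time.\<close>
  define F4 where "F4 x1 x2 x3 x4 = a x2 - b x3 + D12 x1 x2 - D23 x2 x3 + D34 x3 x4 - D14 x1 x4" for x1 x2 x3 x4
  define F3 where "F3 x1 x2 x3 = a x2 - b x3 + D12 x1 x2 - D23 x2 x3 + d34 x3 - d14 x1" for x1 x2 x3
  define F2 where "F2 x1 x2 = a x2 - (\<integral>x. b x \<partial>N3) + D12 x1 x2 - d23 x2 - d14 x1" for x1 x2
  define F1 where "F1 x1 = (\<integral>x. a x \<partial>N2) - (\<integral>x. b x \<partial>N3) + d12 x1 - d14 x1" for x1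
  have I4: "integrable N4 (F4 x1 x2 x3)" "(\<integral>x. F4 x1 x2 x3 x \<partial>N4) = F3 x1 x2 x3" for x1 x2 x3
    unfolding F4_def[abs_def] F3_def using i4 by (simp_all add: one sp d34_def d14_def)
  have I3: "integrable N3 (F3 x1 x2)" "(\<integral>x. F3 x1 x2 x \<partial>N3) = F2 x1 x2" for x1 x2
    unfolding F3_def[abs_def] F2_def using i3 zero(3) by (simp_all add: one sp d23_def d34_def[symmetric])
  have I2: "integrable N2 (F2 x1)" "(\<integral>x. F2 x1 x \<partial>N2) = F1 x1" for x1
    unfolding F2_def[abs_def] F1_def using i2 zero(2) by (simp_all add: one sp d12_def d23_def[symmetric])
  have I1: "integrable N1 F1" "(\<integral>x. F1 x \<partial>N1) = (\<integral>x. a x \<partial>N2) - (\<integral>x. b x \<partial>N3)"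
    unfolding F1_def[abs_def] using i1 zero(1,4) by (simp_all add: one sp d12_def[symmetric] d14_def[symmetric])
  have "ennreal \<bar>(\<integral>x. a x \<partial>N2) - (\<integral>x. b x \<partial>N3)\<bar> \<le> (\<integral>\<^sup>+x1. ennreal \<bar>F1 x1\<bar> \<partial>N1)"
    using integral_norm_bound_ennreal[OF I1(1)] by (simp add: I1(2))
  also have "\<dots> \<le> (\<integral>\<^sup>+x1. \<integral>\<^sup>+x2. ennreal \<bar>F2 x1 x2\<bar> \<partial>N2 \<partial>N1)"
    using integral_norm_bound_ennreal[OF I2(1)] by (intro nn_integral_mono) (simp add: I2(2))
  also have "\<dots> \<le> (\<integral>\<^sup>+x1. \<integral>\<^sup>+x2. \<integral>\<^sup>+x3. ennreal \<bar>F3 x1 x2 x3\<bar> \<partial>N3 \<partial>N2 \<partial>N1)"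
    using integral_norm_bound_ennreal[OF I3(1)] by (intro nn_integral_mono) (simp add: I3(2))
  also have "\<dots> \<le> (\<integral>\<^sup>+x1. \<integral>\<^sup>+x2. \<integral>\<^sup>+x3. \<integral>\<^sup>+x4. ennreal \<bar>F4 x1 x2 x3 x4\<bar> \<partial>N4 \<partial>N3 \<partial>N2 \<partial>N1)"
    using integral_norm_bound_ennreal[OF I4(1)] by (intro nn_integral_mono) (simp add: I4(2))
  also have "\<dots> \<le> (\<integral>\<^sup>+x1. \<integral>\<^sup>+x2. \<integral>\<^sup>+x3. \<integral>\<^sup>+x4. T x1 x2 + T x2 x3 + T x3 x4 + T x1 x4 \<partial>N4 \<partial>N3 \<partial>N2 \<partial>N1)"
  proof (rule nn_integral_mono_AE)
    show "AE x1 in N1. (\<integral>\<^sup>+x2. \<integral>\<^sup>+x3. \<integral>\<^sup>+x4. ennreal \<bar>F4 x1 x2 x3 x4\<bar> \<partial>N4 \<partial>N3 \<partial>N2) \<le>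
       (\<integral>\<^sup>+x2. \<integral>\<^sup>+x3. \<integral>\<^sup>+x4. T x1 x2 + T x2 x3 + T x3 x4 + T x1 x4 \<partial>N4 \<partial>N3 \<partial>N2)"
      using le
    proof eventually_elim
      case (elim x1)
      show ?case
      proof (rule nn_integral_mono_AE)
        show "AE x2 in N2. (\<integral>\<^sup>+x3. \<integral>\<^sup>+x4. ennreal \<bar>F4 x1 x2 x3 x4\<bar> \<partial>N4 \<partial>N3) \<le>
          (\<integral>\<^sup>+x3. \<integral>\<^sup>+x4. T x1 x2 + T x2 x3 + T x3 x4 + T x1 x4 \<partial>N4 \<partial>N3)"
          using elim
        proof eventually_elim
          case (elim x2)
          show ?case
          proof (rule nn_integral_mono_AE)
            show "AE x3 in N3. (\<integral>\<^sup>+x4. ennreal \<bar>F4 x1 x2 x3 x4\<bar> \<partial>N4) \<le>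
              (\<integral>\<^sup>+x4. T x1 x2 + T x2 x3 + T x3 x4 + T x1 x4 \<partial>N4)"
              using elim by eventually_elim (auto simp: F4_def intro: nn_integral_mono_AE)
          qed
        qed
      qed
    qed
  qed
  also have "\<dots> = (\<integral>\<^sup>+x. \<integral>\<^sup>+y. T x y \<partial>N2 \<partial>N1) + (\<integral>\<^sup>+x. \<integral>\<^sup>+y. T x y \<partial>N3 \<partial>N2) +
    (\<integral>\<^sup>+x. \<integral>\<^sup>+y. T x y \<partial>N4 \<partial>N3) + (\<integral>\<^sup>+x. \<integral>\<^sup>+y. T x y \<partial>N4 \<partial>N1)"
  proof -
    note Tm = measurable_section[OF meas(7)]
    have Tm': "(\<lambda>y. T x y) \<in> borel_measurable M" "(\<lambda>y. T y x) \<in> borel_measurable M" if "sets M = sets borel" for x M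
      using Tm that by (simp_all cong: measurable_cong_sets)
    have TI: "(\<lambda>x. \<integral>\<^sup>+y. T x y \<partial>N) \<in> borel_measurable M"
      if "sigma_finite_measure N" "sets N = sets borel" "sets M = sets borel" for N M
      by (rule sigma_finite_measure.borel_measurable_nn_integral[OF that(1)])
        (use meas(7) that in \<open>simp cong: measurable_cong_sets sets_pair_measure_cong\<close>)
    note tm = Tm'[OF N(5)] Tm'[OF N(6)] Tm'[OF N(7)] Tm'[OF N(8)]
    note ti = TI[OF N4.sigma_finite_measure_axioms N(8) N(7)] TI[OF N3.sigma_finite_measure_axioms N(7) N(6)]
      TI[OF N2.sigma_finite_measure_axioms N(6) N(5)] TI[OF N4.sigma_finite_measure_axioms N(8) N(5)]
    define t4 t3 t2 where "t4 x = (\<integral>\<^sup>+y. T x y \<partial>N4)" and "t3 x = (\<integral>\<^sup>+y. T x y \<partial>N3)"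
      and "t2 x = (\<integral>\<^sup>+y. T x y \<partial>N2)" for x
    note ti = ti[folded t4_def t3_def t2_def]
    have s4: "(\<integral>\<^sup>+x4. T x1 x2 + T x2 x3 + T x3 x4 + T x1 x4 \<partial>N4) = T x1 x2 + T x2 x3 + t4 x3 + t4 x1" for x1 x2 x3
      by (simp add: nn_integral_add borel_measurable_add tm sp N t4_def)
    have s3: "(\<integral>\<^sup>+x3. T x1 x2 + T x2 x3 + t4 x3 + t4 x1 \<partial>N3) = T x1 x2 + t3 x2 + (\<integral>\<^sup>+x. t4 x \<partial>N3) + t4 x1" for x1 x2
      by (simp add: nn_integral_add borel_measurable_add tm ti sp N t3_def)
    have s2: "(\<integral>\<^sup>+x2. T x1 x2 + t3 x2 + (\<integral>\<^sup>+x. t4 x \<partial>N3) + t4 x1 \<partial>N2) =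
        t2 x1 + (\<integral>\<^sup>+x. t3 x \<partial>N2) + (\<integral>\<^sup>+x. t4 x \<partial>N3) + t4 x1" for x1
      by (simp add: nn_integral_add borel_measurable_add tm ti sp N t2_def)
    have s1: "(\<integral>\<^sup>+x1. t2 x1 + (\<integral>\<^sup>+x. t3 x \<partial>N2) + (\<integral>\<^sup>+x. t4 x \<partial>N3) + t4 x1 \<partial>N1) =
        (\<integral>\<^sup>+x. t2 x \<partial>N1) + (\<integral>\<^sup>+x. t3 x \<partial>N2) + (\<integral>\<^sup>+x. t4 x \<partial>N3) + (\<integral>\<^sup>+x. t4 x \<partial>N1)"
      by (simp add: nn_integral_add borel_measurable_add tm ti sp N)
    show ?thesis unfolding s4 s3 s2 s1 by (simp add: t2_def[abs_def] t3_def[abs_def] t4_def[abs_def])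
  qed
  finally show ?thesis .
qed

lemma unif_pair_le:
  fixes T :: "real^3 \<Rightarrow> real^3 \<Rightarrow> ennreal"
  assumes T: "(\<lambda>(x, y). T x y) \<in> borel_measurable (borel \<Otimes>\<^sub>M borel)" and B: "A \<in> sets borel" "B \<in> sets borel"
    and pos: "emeasure area_measure B \<noteq> 0"
  shows "(\<integral>\<^sup>+x. \<integral>\<^sup>+y. T x y \<partial>unif B \<partial>unif A) \<le>
    (\<integral>\<^sup>+x. \<integral>\<^sup>+y. T x y \<partial>area_measure \<partial>area_measure) / (emeasure area_measure A * emeasure area_measure B)"
proof -
  let ?a = "emeasure area_measure A" and ?b = "emeasure area_measure B"
  have "(\<lambda>(x, y). T x y) \<in> borel_measurable (borel \<Otimes>\<^sub>M area_measure)"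
    using T by (simp cong: measurable_cong_sets sets_pair_measure_cong)
  then have m: "(\<lambda>x. \<integral>\<^sup>+y. T x y \<partial>area_measure) \<in> borel_measurable borel"
    by (rule area.borel_measurable_nn_integral)
  have "(\<integral>\<^sup>+x. \<integral>\<^sup>+y. T x y \<partial>unif B \<partial>unif A) \<le> (\<integral>\<^sup>+x. (\<integral>\<^sup>+y. T x y \<partial>area_measure) / ?b \<partial>unif A)"
    by (intro nn_integral_mono nn_integral_unif_le B measurable_section[OF T])
  also have "\<dots> \<le> (\<integral>\<^sup>+x. (\<integral>\<^sup>+y. T x y \<partial>area_measure) / ?b \<partial>area_measure) / ?a"
    by (rule nn_integral_unif_le[OF B(1)]) (intro borel_measurable_divide_ennreal m borel_measurable_const)
  also have "(\<integral>\<^sup>+x. (\<integral>\<^sup>+y. T x y \<partial>area_measure) / ?b \<partial>area_measure) =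
      (\<integral>\<^sup>+x. (\<integral>\<^sup>+y. T x y \<partial>area_measure) \<partial>area_measure) / ?b"
    by (rule nn_integral_divide) (use m in \<open>simp cong: measurable_cong_sets\<close>)
  also have "\<dots> / ?a = (\<integral>\<^sup>+x. (\<integral>\<^sup>+y. T x y \<partial>area_measure) \<partial>area_measure) / (?a * ?b)"
    using pos area.emeasure_finite by (simp add: divide_ennreal_def ennreal_inverse_mult less_top[symmetric] mult.assoc mult.commute mult.left_commute)
  finally show ?thesis .
qed

section \<open>The lower bound for the length of paths between twists\<close>

context bands
begin

lemma embed_nth3: "x \<in> S2 \<Longrightarrow> embed u x $ 3 = x $ 3"
  by (simp add: embed_def)

lemma embed_unif: "distr (unif (band a b)) borel (embed u) = unif (band a b)"
  by (rule distr_unif[OF Diff_area_distr[OF embed_Diff_area] band_borel])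
    (auto simp: band_def embed_S2 embed_nth3)

definition height_avg :: "'d \<Rightarrow> real" where
  "height_avg i = (\<integral>x. bump i (x$3) \<partial>unif (band (l i) (r i)))"

lemma bump_measurable: "(\<lambda>x::real^3. bump i (x$3)) \<in> borel_measurable borel"
proof -
  have "Ck_on 0 UNIV (\<lambda>x::real^3. bump i (x$3))" using smooth_bump[OF smooth_nth[of 3], of i] by blast
  then show ?thesis by (intro borel_measurable_continuous_onI) simp
qed

lemma band_pos: "emeasure area_measure (band (l i) (r i)) \<noteq> 0"
  by (rule emeasure_band_pos[of _ "(l i + r i) / 2"]) (use lr[of i] in auto)

lemma height_avg_pos: "height_avg i > 0"
proof -
  let ?N = "unif (band (l i) (r i))"
  have fin: "finite_measure ?N"
    by (rule finite_measureI) (simp add: emeasure_unif_UNIV band_pos)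
  have int: "integrable ?N (\<lambda>x. bump i (x$3))"
    by (rule bounded_integrable[OF fin sets_unif bump_measurable, where B = 1]) (simp add: bump_bounds)
  have "height_avg i \<noteq> 0"
  proof
    assume "height_avg i = 0"
    then have "AE x in ?N. bump i (x$3) = 0"
      using integral_nonneg_eq_0_iff_AE[OF int] bump_bounds by (simp add: height_avg_def)
    moreover have "AE x in ?N. x \<in> band (l i) (r i)" by (rule AE_unif) simp
    ultimately have "AE x in ?N. False"
    proof eventually_elim
      case (elim x)
      from elim(2) have "bump i (x$3) > 0" unfolding bump_pos_iff by (simp add: band_def)
      with elim(1) show ?case by simp
    qed
    then have "emeasure ?N UNIV = 0"
      using AE_iff_measurable[of UNIV ?N "\<lambda>_. False"] by simp
    then show False by (simp add: emeasure_unif_UNIV band_pos)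
  qed
  moreover have "height_avg i \<ge> 0" unfolding height_avg_def by (rule integral_nonneg_AE) (simp add: bump_bounds)
  ultimately show ?thesis by simp
qed

end

context bands
begin

text \<open>The boundary term of \<open>theta_straight\<close>, bounded however large
  \<open>u\<close> is.\<close>

definition defect :: "real^'d \<Rightarrow> real^'d \<Rightarrow> real^3 \<Rightarrow> real^3 \<Rightarrow> real" where
  "defect v u x y = gap_angle (embed (v + u) x) (embed (v + u) y) - gap_angle (embed v x) (embed v y)"

lemma abs_defect_le: "\<bar>defect v u x y\<bar> \<le> 2 * pi"
  using abs_gap_angle_le[of "embed (v + u) x" "embed (v + u) y"] abs_gap_angle_le[of "embed v x" "embed v y"]
  unfolding defect_def by linarith

lemma gap_embed_measurable: "(\<lambda>(x, y). gap_angle (embed v x) (embed v y)) \<in> borel_measurable (borel \<Otimes>\<^sub>M borel)"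
proof -
  note [measurable] = Diff_area_distr(1)[OF embed_Diff_area[of v]]
  have "(\<lambda>z. (embed v (fst z), embed v (snd z))) \<in> borel \<Otimes>\<^sub>M borel \<rightarrow>\<^sub>M borel \<Otimes>\<^sub>M borel" by measurable
  from measurable_compose[OF this gap_angle_measurable] show ?thesis by (simp add: split_beta')
qed

lemma defect_measurable: "(\<lambda>(x, y). defect v u x y) \<in> borel_measurable (borel \<Otimes>\<^sub>M borel)"
proof -
  note [measurable] = gap_embed_measurable[of v] gap_embed_measurable[of "v + u"]
  have "(\<lambda>z. (\<lambda>(x, y). gap_angle (embed (v + u) x) (embed (v + u) y)) z - (\<lambda>(x, y). gap_angle (embed v x) (embed v y)) z)
    \<in> borel_measurable (borel \<Otimes>\<^sub>M borel)" by measurable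
  then show ?thesis by (simp add: defect_def split_beta')
qed

text \<open>Every \<open>embed w\<close> preserves the uniform measure of each band, so both gap
  angles have the average of \<open>gap_angle\<close> itself.\<close>

lemma integral_defect:
  assumes A: "emeasure area_measure (band a b) \<noteq> 0" and B: "emeasure area_measure (band c d) \<noteq> 0"
  shows "(\<integral>x. \<integral>y. defect v u x y \<partial>unif (band c d) \<partial>unif (band a b)) = 0"
proof -
  let ?M = "unif (band a b)" and ?N = "unif (band c d)"
  have fM: "finite_measure ?M" by (rule finite_measureI) (simp add: emeasure_unif_UNIV A)
  have fN: "finite_measure ?N" by (rule finite_measureI) (simp add: emeasure_unif_UNIV B)
  interpret M: finite_measure ?M by fact
  interpret N: finite_measure ?N by fact
  let ?g = "\<lambda>w x. \<integral>y. gap_angle (embed w x) (embed w y) \<partial>?N"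
  note sec = measurable_section(1)[OF gap_embed_measurable]
  have i: "integrable ?N (\<lambda>y. gap_angle (embed w x) (embed w y))" for w x
    by (rule bounded_integrable[OF fN _ sec, where B = pi]) (auto intro: abs_gap_angle_le)
  have gm: "?g w \<in> borel_measurable borel" for w
    by (rule N.borel_measurable_lebesgue_integral)
      (use gap_embed_measurable[of w] in \<open>simp cong: measurable_cong_sets sets_pair_measure_cong\<close>)
  have gi: "integrable ?M (?g w)" for w
    by (rule bounded_integrable[OF fM _ gm, where B = pi])
      (auto intro!: abs_integral_le[OF _ _ sec] abs_gap_angle_le simp: emeasure_unif_UNIV B)
  have inv: "(\<integral>x. ?g w x \<partial>?M) = (\<integral>x. \<integral>y. gap_angle x y \<partial>?N \<partial>?M)" for w
    by (rule integral_diagonal_invariant[OF Diff_area_distr(1)[OF embed_Diff_area] _ embed_unif _ embed_unif N.sigma_finite_measure_axioms gap_angle_measurable])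
      simp_all
  have "(\<integral>x. \<integral>y. defect v u x y \<partial>?N \<partial>?M) = (\<integral>x. ?g (v + u) x - ?g v x \<partial>?M)"
    unfolding defect_def by (simp add: i)
  also have "\<dots> = 0" by (simp add: gi inv)
  finally show ?thesis .
qed

text \<open>The contributions of \<open>x1\<close> and \<open>x4\<close> cancel, and at
  \<open>x2\<close> and \<open>x3\<close> the weights \<open>1/2 + h\<close> and
  \<open>1/2 - h\<close> of the two edges add up to 1.\<close>

lemma cocycle_straight:
  assumes "x1 \<in> S2" "x2 \<in> S2" "x3 \<in> S2" "x4 \<in> S2" "x1$3 > x2$3" "x2$3 > x3$3" "x3$3 > x4$3"
  shows "theta (straight v u) x1 x2 - theta (straight v u) x2 x3 + theta (straight v u) x3 x4 - theta (straight v u) x1 x4 =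
    prof u (x2$3) - prof u (x3$3) + defect v u x1 x2 - defect v u x2 x3 + defect v u x3 x4 - defect v u x1 x4"
  using assms by (simp add: theta_straight defect_def algebra_simps)

text \<open>The cocycle of an arbitrary path is computed on the straight one with the same ends. The
  \<open>- 0\<close> fits \<open>average_four_points\<close> with \<open>b = 0\<close>, as
  \<open>x3\<close> lies in a band without rotation.\<close>

lemma four_point_bound:
  assumes \<phi>: "\<phi> \<in> smooth_paths (embed v) (embed (v + u))"
    and x: "x1 \<in> band (1/4) 1" "x2 \<in> band (l i) (r i)" "x3 \<in> band (-1/4) 0" "x4 \<in> band (-1) (-1/4)"
  shows "ennreal \<bar>u$i * bump i (x2$3) - 0 + defect v u x1 x2 - defect v u x2 x3 + defect v u x3 x4 - defect v u x1 x4\<bar> \<le>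
    area_isotopy.total \<phi> x1 x2 + area_isotopy.total \<phi> x2 x3 + area_isotopy.total \<phi> x3 x4 + area_isotopy.total \<phi> x1 x4"
proof -
  interpret P: area_isotopy \<phi> by (rule smooth_paths_area_isotopy[OF \<phi>])
  interpret S: area_isotopy "straight v u" by (rule smooth_paths_area_isotopy[OF straight_smooth_paths])
  have S2: "x1 \<in> S2" "x2 \<in> S2" "x3 \<in> S2" "x4 \<in> S2" using x by (auto simp: band_def)
  have ord: "x1$3 > x2$3" "x2$3 > x3$3" "x3$3 > x4$3" using x lr[of i] by (auto simp: band_def)
  then have ne: "x1 \<noteq> x2" "x2 \<noteq> x3" "x3 \<noteq> x4" "x4 \<noteq> x1" by auto
  have ends: "\<phi> 0 = straight v u 0" "\<phi> 1 = straight v u 1"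
    using \<phi> straight_smooth_paths[of v u] by (auto simp: smooth_paths_def)
  have "bump j (x2$3) = 0" if "j \<noteq> i" for j
    using disjoint[OF that] x(2) by (intro bump_eq_0) (auto simp: band_def)
  then have "prof u (x2$3) = (\<Sum>j\<in>UNIV. if j = i then u$i * bump i (x2$3) else 0)"
    unfolding prof_def by (intro sum.cong) auto
  then have p2: "prof u (x2$3) = u$i * bump i (x2$3)" by simp
  have "bump j (x3$3) = 0" for j
    by (rule bump_eq_0) (use x(3) lr(1)[of j] in \<open>auto simp: band_def\<close>)
  then have p3: "prof u (x3$3) = 0" by (simp add: prof_def)
  have "theta \<phi> x1 x2 - theta \<phi> x2 x3 + theta \<phi> x3 x4 - theta \<phi> x4 x1 =
      theta (straight v u) x1 x2 - theta (straight v u) x2 x3 + theta (straight v u) x3 x4 - theta (straight v u) x4 x1"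
    by (rule theta_cocycle_unique[OF P.c1_isotopy_axioms S.c1_isotopy_axioms]) (use ends S2 ne in auto)
  then have "u$i * bump i (x2$3) - 0 + defect v u x1 x2 - defect v u x2 x3 + defect v u x3 x4 - defect v u x1 x4 =
      theta \<phi> x1 x2 - theta \<phi> x2 x3 + theta \<phi> x3 x4 - theta \<phi> x1 x4"
    using cocycle_straight[OF S2 ord, of v u] by (simp add: p2 p3 P.theta_commute[of x4 x1] S.theta_commute[of x4 x1])
  then have "\<bar>u$i * bump i (x2$3) - 0 + defect v u x1 x2 - defect v u x2 x3 + defect v u x3 x4 - defect v u x1 x4\<bar> \<le>
      \<bar>theta \<phi> x1 x2\<bar> + \<bar>theta \<phi> x2 x3\<bar> + \<bar>theta \<phi> x3 x4\<bar> + \<bar>theta \<phi> x1 x4\<bar>"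
    by linarith
  then have "ennreal \<bar>u$i * bump i (x2$3) - 0 + defect v u x1 x2 - defect v u x2 x3 + defect v u x3 x4 - defect v u x1 x4\<bar> \<le>
      ennreal \<bar>theta \<phi> x1 x2\<bar> + ennreal \<bar>theta \<phi> x2 x3\<bar> + ennreal \<bar>theta \<phi> x3 x4\<bar> + ennreal \<bar>theta \<phi> x1 x4\<bar>"
    by (simp add: ennreal_plus[symmetric] ennreal_leI del: ennreal_plus)
  also have "\<dots> \<le> P.total x1 x2 + P.total x2 x3 + P.total x3 x4 + P.total x1 x4"
    by (intro add_mono P.abs_theta_le_total S2) (use ne in auto)
  finally show ?thesis .
qed

text \<open>The constant collects \<open>pole_const\<close>, the factor of
  \<open>L1_le_energy\<close>, the inverse areas of the bands and \<open>height_avg i\<close>; it is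
  the same for all \<open>v\<close>, \<open>u\<close> and paths.\<close>

lemma coordinate_bound:
  assumes p: "p > 1"
  shows "\<exists>K\<ge>0. \<forall>v u \<phi>. \<phi> \<in> smooth_paths (embed v) (embed (v + u)) \<longrightarrow> \<bar>u$i\<bar> \<le> K * Lp_length p \<phi>"
proof -
  let ?B1 = "band (1/4) 1" and ?B2 = "band (l i) (r i)" and ?B3 = "band (-1/4) 0" and ?B4 = "band (-1) (-1/4)"
  let ?m = "emeasure area_measure"
  define c where "c = 1 / (?m ?B1 * ?m ?B2) + 1 / (?m ?B2 * ?m ?B3) + 1 / (?m ?B3 * ?m ?B4) + 1 / (?m ?B1 * ?m ?B4)"
  define C where "C = 2 * pole_const * ennreal (2 * pi + 1) * c"
  \<comment> \<open>The numbers are heights inside the three free bands and strictly between the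
    poles.\<close>
  have pos: "?m ?B1 \<noteq> 0" "?m ?B2 \<noteq> 0" "?m ?B3 \<noteq> 0" "?m ?B4 \<noteq> 0"
    by (rule emeasure_band_pos[of _ "3/8"] band_pos emeasure_band_pos[of _ "-1/8"] emeasure_band_pos[of _ "-3/8"]; simp)+
  have "1 / (?m A * ?m B) < \<infinity>" if "?m A \<noteq> 0" "?m B \<noteq> 0" for A B
    using that by (simp add: ennreal_divide_eq_top_iff less_top[symmetric])
  then have "c < \<infinity>" using pos by (simp add: c_def)
  then have C: "C < \<infinity>"
    using pole_const_finite by (simp add: C_def ennreal_mult_less_top)
  have main: "\<bar>u$i\<bar> * height_avg i \<le> enn2real C * Lp_length p \<phi>"
    if \<phi>: "\<phi> \<in> smooth_paths (embed v) (embed (v + u))" for v u \<phi>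
  proof -
    interpret P: area_isotopy \<phi> by (rule smooth_paths_area_isotopy[OF \<phi>])
    have Tm: "(\<lambda>(x, y). P.total x y) \<in> borel_measurable (borel \<Otimes>\<^sub>M borel)"
      using P.total_measurable[OF measurable_fst measurable_snd] by (simp add: split_beta')
    have L: "Lp_length p \<phi> \<ge> 0"
      unfolding Lp_length_def set_lebesgue_integral_def[of lborel] by (rule integral_nonneg_AE) simp
    define J where "J = (\<integral>\<^sup>+x. \<integral>\<^sup>+y. P.total x y \<partial>area_measure \<partial>area_measure)"
    have "ennreal \<bar>(\<integral>x. u$i * bump i (x$3) \<partial>unif ?B2) - (\<integral>x. 0 \<partial>unif ?B3)\<bar> \<le>
      (\<integral>\<^sup>+x. \<integral>\<^sup>+y. P.total x y \<partial>unif ?B2 \<partial>unif ?B1) + (\<integral>\<^sup>+x. \<integral>\<^sup>+y. P.total x y \<partial>unif ?B3 \<partial>unif ?B2) +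
      (\<integral>\<^sup>+x. \<integral>\<^sup>+y. P.total x y \<partial>unif ?B4 \<partial>unif ?B3) + (\<integral>\<^sup>+x. \<integral>\<^sup>+y. P.total x y \<partial>unif ?B4 \<partial>unif ?B1)"
    \<comment> \<open>This bound secures integrability; the resulting estimate is free of
      it.\<close>
    proof (rule average_four_points[where B = "max \<bar>u$i\<bar> (2 * pi)"])
      show "AE x1 in unif ?B1. AE x2 in unif ?B2. AE x3 in unif ?B3. AE x4 in unif ?B4.
        ennreal \<bar>u$i * bump i (x2$3) - 0 + defect v u x1 x2 - defect v u x2 x3 + defect v u x3 x4 - defect v u x1 x4\<bar>
        \<le> P.total x1 x2 + P.total x2 x3 + P.total x3 x4 + P.total x1 x4"
        using AE_unif[OF band_borel[of "1/4" 1]]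
      proof eventually_elim
        case (elim x1)
        note x1 = elim
        show ?case using AE_unif[OF band_borel[of "l i" "r i"]]
        proof eventually_elim
          case (elim x2)
          note x2 = elim
          show ?case using AE_unif[OF band_borel[of "-1/4" 0]]
          proof eventually_elim
            case (elim x3)
            show ?case using AE_unif[OF band_borel[of "-1" "-1/4"]]
              by eventually_elim (rule four_point_bound[OF \<phi> x1 x2 elim])
          qed
        qed
      qed
      show "(\<lambda>x::real^3. u$i * bump i (x$3)) \<in> borel_measurable borel"
        by (intro borel_measurable_times borel_measurable_const bump_measurable)
      show "\<bar>u$i * bump i (x$3)\<bar> \<le> max \<bar>u$i\<bar> (2 * pi)" for x :: "real^3"
        using bump_bounds[of i "x$3"] by (simp add: abs_mult mult_left_le le_max_iff_disj)
      show "\<bar>defect v u x y\<bar> \<le> max \<bar>u$i\<bar> (2 * pi)" "\<bar>defect v u x y\<bar> \<le> max \<bar>u$i\<bar> (2 * pi)"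
        "\<bar>defect v u x y\<bar> \<le> max \<bar>u$i\<bar> (2 * pi)" "\<bar>defect v u x y\<bar> \<le> max \<bar>u$i\<bar> (2 * pi)" for x y
        using abs_defect_le[of v u x y] by (simp_all add: le_max_iff_disj)
    qed (use pos in \<open>simp_all add: emeasure_unif_UNIV defect_measurable integral_defect Tm le_max_iff_disj\<close>)
    also have "\<dots> \<le> J / (?m ?B1 * ?m ?B2) + J / (?m ?B2 * ?m ?B3) + J / (?m ?B3 * ?m ?B4) + J / (?m ?B1 * ?m ?B4)"
      unfolding J_def by (intro add_mono unif_pair_le Tm band_borel pos)
    also have "\<dots> = J * c"
      by (simp add: c_def distrib_left ennreal_times_divide)
    also have "\<dots> \<le> (2 * pole_const * ennreal (2 * pi + 1) * ennreal (Lp_length p \<phi>)) * c"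
      unfolding J_def by (intro mult_right_mono P.total_le_Lp_length p) simp
    also have "\<dots> = C * ennreal (Lp_length p \<phi>)" by (simp add: C_def mult_ac)
    also have "\<dots> = ennreal (enn2real C * Lp_length p \<phi>)"
      using C L by (simp add: ennreal_mult less_top)
    finally have le: "\<bar>(\<integral>x. u$i * bump i (x$3) \<partial>unif ?B2)\<bar> \<le> enn2real C * Lp_length p \<phi>"
      using L by (simp add: ennreal_le_iff)
    have eq: "(\<integral>x. u$i * bump i (x$3) \<partial>unif ?B2) = u$i * height_avg i"
      by (simp add: height_avg_def)
    show ?thesis using le height_avg_pos[of i] unfolding eq abs_mult by simp
  qed
  show ?thesis
  proof (intro exI[of _ "enn2real C / height_avg i"] conjI allI impI)
    show "enn2real C / height_avg i \<ge> 0" using height_avg_pos[of i] by simp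
    fix v u \<phi> assume "\<phi> \<in> smooth_paths (embed v) (embed (v + u))"
    from main[OF this] show "\<bar>u$i\<bar> \<le> enn2real C / height_avg i * Lp_length p \<phi>"
      using height_avg_pos[of i] by (simp add: field_simps)
  qed
qed

lemma l1_bound:
  assumes p: "p > 1"
  shows "\<exists>K\<ge>0. \<forall>v u \<phi>. \<phi> \<in> smooth_paths (embed v) (embed (v + u)) \<longrightarrow> l1_norm u \<le> K * Lp_length p \<phi>"
proof -
  obtain K where K: "\<And>i. K i \<ge> 0" "\<And>i v u \<phi>. \<phi> \<in> smooth_paths (embed v) (embed (v + u)) \<Longrightarrow> \<bar>u$i\<bar> \<le> K i * Lp_length p \<phi>"
    using coordinate_bound[OF p] by metis
  show ?thesis
  proof (intro exI[of _ "\<Sum>i\<in>UNIV. K i"] conjI allI impI)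
    show "(\<Sum>i\<in>UNIV. K i) \<ge> 0" by (intro sum_nonneg K)
    fix v u \<phi> assume "\<phi> \<in> smooth_paths (embed v) (embed (v + u))"
    then show "l1_norm u \<le> (\<Sum>i\<in>UNIV. K i) * Lp_length p \<phi>"
      unfolding l1_norm_def sum_distrib_right by (intro sum_mono K)
  qed
qed

text \<open>The straight path bounds the distance from above; the lower bound holds for every path
  and so passes to the infimum.\<close>

lemma bilipschitz_embed:
  assumes p: "p > 1"
  shows "embed \<in> mon vector_group Diff_area \<and> (\<exists>K::real. K \<ge> 1 \<and>
    (\<forall>v w. ereal (1 / K * l1_norm (v - w)) \<le> Lp_dist p (embed v) (embed w) \<and>
            Lp_dist p (embed v) (embed w) \<le> ereal (K * l1_norm (v - w))))"
proof -
  obtain K0 where K0: "K0 \<ge> 0" "\<And>v u \<phi>. \<phi> \<in> smooth_paths (embed v) (embed (v + u)) \<Longrightarrow> l1_norm u \<le> K0 * Lp_length p \<phi>"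
    using l1_bound[OF p] by metis
  define K where "K = max 1 (max K0 ((2 * pi) powr (1 / p)))"
  have K: "K \<ge> 1" "K \<ge> K0" "K \<ge> (2 * pi) powr (1 / p)" by (auto simp: K_def)
  have comm: "l1_norm (v - w) = l1_norm (w - v)" for v w :: "real^'d"
    by (simp add: l1_norm_def abs_minus_commute)
  have lower: "ereal (1 / K * l1_norm (v - w)) \<le> Lp_dist p (embed v) (embed w)" for v w
    unfolding Lp_dist_def
  proof (rule INF_greatest)
    fix \<phi> assume "\<phi> \<in> smooth_paths (embed v) (embed w)"
    then have "l1_norm (w - v) \<le> K0 * Lp_length p \<phi>" using K0(2)[of \<phi> v "w - v"] by simp
    moreover have "Lp_length p \<phi> \<ge> 0"
      unfolding Lp_length_def set_lebesgue_integral_def[of lborel] by (rule integral_nonneg_AE) simp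
    ultimately have "l1_norm (v - w) \<le> K * Lp_length p \<phi>"
      using K(2) comm[of v w] by (metis mult_right_mono order_trans)
    then show "ereal (1 / K * l1_norm (v - w)) \<le> ereal (Lp_length p \<phi>)"
      using K(1) by (simp add: field_simps)
  qed
  have upper: "Lp_dist p (embed v) (embed w) \<le> ereal (K * l1_norm (v - w))" for v w
  proof -
    have "straight v (w - v) \<in> smooth_paths (embed v) (embed w)"
      using straight_smooth_paths[of v "w - v"] by simp
    then have "Lp_dist p (embed v) (embed w) \<le> ereal (Lp_length p (straight v (w - v)))"
      unfolding Lp_dist_def by (rule INF_lower)
    also have "\<dots> \<le> ereal (K * l1_norm (v - w))"
    proof -
      have "0 \<le> l1_norm (v - w)" by (simp add: l1_norm_def sum_nonneg)
      then show ?thesis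
        using Lp_length_straight_le[of p v "w - v"] p K(3) comm[of v w]
        by (simp, metis mult_right_mono order_trans)
    qed
    finally show ?thesis .
  qed
  \<comment> \<open>Injectivity comes from the metric: if the images agree, their distance is at
    most 0 by \<open>upper\<close>, and \<open>lower\<close> forces \<open>v = w\<close>.\<close>
  have "v = w" if "embed v = embed w" for v w
  proof -
    have "ereal (1 / K * l1_norm (v - w)) \<le> ereal (K * l1_norm (v - v))"
      using lower[of v w] upper[of v v] that by (metis order_trans)
    then have "l1_norm (v - w) \<le> 0" using K(1) by (simp add: l1_norm_def field_simps)
    then have "(\<Sum>i\<in>UNIV. \<bar>(v - w) $ i\<bar>) = 0"
      by (simp add: l1_norm_def sum_nonneg order_antisym)
    then have "\<And>i. \<bar>(v - w) $ i\<bar> = 0" by (subst (asm) sum_nonneg_eq_0_iff) auto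
    then show ?thesis by (simp add: vec_eq_iff)
  qed
  then have "embed \<in> mon vector_group Diff_area"
    using embed_hom by (auto simp: mon_def inj_on_def)
  with K(1) lower upper show ?thesis by blast
qed

end

theorem corollary4:
  fixes p :: real
  assumes "p > 2"
  shows "\<exists>I \<in> mon (vector_group :: (real^'d) monoid) Diff_area. \<exists>K::real. K \<ge> 1 \<and>
    (\<forall>v w. ereal (1 / K * l1_norm (v - w)) \<le> Lp_dist p (I v) (I w) \<and>
            Lp_dist p (I v) (I w) \<le> ereal (K * l1_norm (v - w)))"
proof -
  obtain f :: "'d \<Rightarrow> nat" and n where f: "bij_betw f UNIV {0..<n}"
    using ex_bij_betw_finite_nat[of "UNIV :: 'd set"] by auto
  have fn: "f i < n" for i using bij_betwE[OF f] by auto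
  have n: "n > 0" using fn by (metis gr_zeroI not_less_zero)
  \<comment> \<open>The interval \<open>[0, 1/4]\<close> is cut into \<open>n\<close> equal pieces,
    numbered by \<open>f\<close>; neighbours share an end point at most.\<close>
  have "bands (\<lambda>i. real (f i) / (4 * n)) (\<lambda>i. (real (f i) + 1) / (4 * n))"
  proof
    fix i j
    show "0 \<le> real (f i) / (4 * n)" by simp
    show "real (f i) / (4 * n) < (real (f i) + 1) / (4 * n)" using n by (simp add: divide_strict_right_mono)
    have "real (f i) + 1 \<le> n" using fn[of i] by linarith
    then show "(real (f i) + 1) / (4 * n) \<le> 1 / 4" using n by (simp add: field_simps)
    assume "i \<noteq> j"
    then have "f i \<noteq> f j" using f by (metis UNIV_I bij_betw_imp_inj_on inj_onD)
    then consider "real (f i) + 1 \<le> real (f j)" | "real (f j) + 1 \<le> real (f i)" by linarith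
    then show "(real (f i) + 1) / (4 * n) \<le> real (f j) / (4 * n) \<or> (real (f j) + 1) / (4 * n) \<le> real (f i) / (4 * n)"
      by cases (auto intro!: divide_right_mono)
  qed
  from bands.bilipschitz_embed[OF this, of p] assms show ?thesis by (intro bexI) auto
qed

end
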